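(* For every integer $n\geq 1$, let $X=A\vee\mathbb{H}_n$ be the one-point union of the space $A$ and the $n$-dimensional Hawaiian earring $\mathbb{H}_n$ defined in the context, and give $\pi_1(X)$ and $\pi_n(X)$ the quotient topologies described in the context. Then the natural group action $a:\pi_1(X)\times\pi_n(X)\to\pi_n(X)$, $a(x,y)=x\ast y$, is not continuous (where $\pi_1(X)\times\pi_n(X)$ has the product topology).
   Context: Topology on homotopy groups: for a based space $X$ and $n\ge 1$, $\Omega^n(X)$ is the space of based maps $S^n\to X$ with the compact-open topology, and $\pi_n(X)$ has the quotient topology with respect to $q_n:\Omega^n(X)\to\pi_n(X)$, $q_n(f)=[f]$. The $\pi_1$-action: let $s_0\in S^n$ be the basepoint, $I=[0,1]$, and fix a retraction $r:S^n\times I\to Z$ onto $Z=(\{s_0\}\times I)\cup(S^n\times\{0\})$. For a loop $\alpha:(I,\{0,1\})\to (X,x_0)$ and a based map $\gamma:S^n\to X$, define $f:Z\to X$ by $f(s_0,t)=\alpha(1-t)$ and $f(s,0)=\gamma(s)$, and define $\alpha\ast\gamma:S^n\to X$ by $(\alpha\ast\gamma)(s)=f(r(s,1))$. The action is $[\alpha]\ast[\gamma]=[\alpha\ast\gamma]$. For $n=1$ it is the action of $\pi_1(X)$ on itself by conjugation. The space $A$: let $D\subseteq\mathbb{R}^2$ be the closed disk having $[0,1]\times\{0\}$ as a diameter. For $m\ge1$ let $C_m\subseteq\mathbb{R}^2$ be the circle having $[0,\frac{m+1}{m}]\times\{0\}$ as a diameter. Set $A=D\cup\bigcup_{m\ge1}C_m\subseteq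 \mathbb{R}^2$, with basepoint the origin. The space $\mathbb{H}_n$: for $m\ge1$ let $S_m\subseteq\mathbb{R}^{n+1}$ be the $n$-dimensional sphere centered at $(1/m,0,\dots,0)$ with radius $1/m$. Set $\mathbb{H}_n=\bigcup_{m\ge1}S_m\subseteq\mathbb{R}^{n+1}$ (subspace topology), with basepoint the origin. $X=A\vee\mathbb{H}_n$ is obtained by identifying the basepoints of $A$ and $\mathbb{H}_n$; the common point is the basepoint of $X$. *)

theory Defs
  imports "HOL-Analysis.Analysis"
begin

section \<open>Quotient spaces, disjoint unions and one-point unions\<close>

definition quotient_topology :: "'a topology \<Rightarrow> ('a \<times> 'a) set \<Rightarrow> 'a set topology" where
  "quotient_topology X R =
     topology (\<lambda>U. U \<subseteq> topspace X // R \<and> openin X {x \<in> topspace X. R `` {x} \<in> U})"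

lemma openin_quotient_topology:
  "openin (quotient_topology X R) U \<longleftrightarrow>
     U \<subseteq> topspace X // R \<and> openin X {x \<in> topspace X. R `` {x} \<in> U}"
proof -
  have "istopology (\<lambda>U. U \<subseteq> topspace X // R \<and> openin X {x \<in> topspace X. R `` {x} \<in> U})"
    unfolding istopology_def
  proof (intro conjI allI impI; (elim conjE)?)
    fix S T
    assume "openin X {x \<in> topspace X. R `` {x} \<in> S}" "openin X {x \<in> topspace X. R `` {x} \<in> T}"
    moreover have "{x \<in> topspace X. R `` {x} \<in> S \<inter> T} =
        {x \<in> topspace X. R `` {x} \<in> S} \<inter> {x \<in> topspace X. R `` {x} \<in> T}" by blast
    ultimately show "openin X {x \<in> topspace X. R `` {x} \<in> S \<inter> T}"
      by (simp only: openin_Int)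
  next
    fix \<K>
    assume *: "\<forall>U\<in>\<K>. U \<subseteq> topspace X // R \<and> openin X {x \<in> topspace X. R `` {x} \<in> U}"
    have "{x \<in> topspace X. R `` {x} \<in> \<Union>\<K>} = (\<Union>U\<in>\<K>. {x \<in> topspace X. R `` {x} \<in> U})" by blast
    then show "openin X {x \<in> topspace X. R `` {x} \<in> \<Union>\<K>}" using * by auto
  qed blast+
  then show ?thesis
    unfolding quotient_topology_def by (simp add: topology_inverse')
qed

lemma topspace_quotient_topology [simp]: "topspace (quotient_topology X R) = topspace X // R"
proof -
  have "{x \<in> topspace X. R `` {x} \<in> topspace X // R} = topspace X"
    by (auto simp: quotient_def)
  then have "openin (quotient_topology X R) (topspace X // R)"
    by (simp add: openin_quotient_topology)
  then show ?thesis
    by (metis openin_quotient_topology openin_subset openin_topspace subset_antisym)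
qed

lemma quotient_map_quotient_topology:
  "quotient_map X (quotient_topology X R) (\<lambda>x. R `` {x})"
  unfolding quotient_map_def topspace_quotient_topology
  by (auto simp: openin_quotient_topology quotient_def)

definition disjoint_union :: "'a topology \<Rightarrow> 'b topology \<Rightarrow> ('a + 'b) topology" where
  "disjoint_union X Y =
     topology (\<lambda>U. U \<subseteq> topspace X <+> topspace Y \<and> openin X (Inl -` U) \<and> openin Y (Inr -` U))"

lemma openin_disjoint_union_iff:
  "openin (disjoint_union X Y) U \<longleftrightarrow>
     U \<subseteq> topspace X <+> topspace Y \<and> openin X (Inl -` U) \<and> openin Y (Inr -` U)"
proof -
  have "istopology (\<lambda>U. U \<subseteq> topspace X <+> topspace Y \<and> openin X (Inl -` U) \<and> openin Y (Inr -` U))"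
    unfolding istopology_def
    by (auto simp: vimage_Union)
  then show ?thesis
    unfolding disjoint_union_def by (simp add: topology_inverse')
qed

lemma topspace_disjoint_union [simp]:
  "topspace (disjoint_union X Y) = topspace X <+> topspace Y"
proof -
  have "Inl -` (topspace X <+> topspace Y) = topspace X"
       "Inr -` (topspace X <+> topspace Y) = topspace Y" by auto
  then have "openin (disjoint_union X Y) (topspace X <+> topspace Y)"
    by (simp add: openin_disjoint_union_iff)
  then show ?thesis
    by (metis openin_disjoint_union_iff openin_subset openin_topspace subset_antisym)
qed

definition wedge_rel :: "'a topology \<Rightarrow> 'a \<Rightarrow> 'b topology \<Rightarrow> 'b \<Rightarrow> (('a + 'b) \<times> ('a + 'b)) set" where
  "wedge_rel X x0 Y y0 =
     {(p, q). p \<in> topspace (disjoint_union X Y) \<and> q \<in> topspace (disjoint_union X Y) \<and>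
              (p = q \<or> {p, q} \<subseteq> {Inl x0, Inr y0})}"

definition wedge :: "'a topology \<Rightarrow> 'a \<Rightarrow> 'b topology \<Rightarrow> 'b \<Rightarrow> ('a + 'b) set topology" where
  "wedge X x0 Y y0 = quotient_topology (disjoint_union X Y) (wedge_rel X x0 Y y0)"

definition wedge_point :: "'a topology \<Rightarrow> 'a \<Rightarrow> 'b topology \<Rightarrow> 'b \<Rightarrow> ('a + 'b) set" where
  "wedge_point X x0 Y y0 = wedge_rel X x0 Y y0 `` {Inl x0}"

lemma equiv_wedge_rel: "equiv (topspace (disjoint_union X Y)) (wedge_rel X x0 Y y0)"
  by (rule equivI) (auto simp: wedge_rel_def refl_on_def sym_def trans_def)

lemma wedge_point:
  assumes "x0 \<in> topspace X" "y0 \<in> topspace Y"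
  shows "wedge_point X x0 Y y0 = {Inl x0, Inr y0}"
    and "wedge_point X x0 Y y0 = wedge_rel X x0 Y y0 `` {Inr y0}"
    and "wedge_point X x0 Y y0 \<in> topspace (wedge X x0 Y y0)"
proof -
  show "wedge_point X x0 Y y0 = {Inl x0, Inr y0}"
    and "wedge_point X x0 Y y0 = wedge_rel X x0 Y y0 `` {Inr y0}"
    using assms by (auto simp: wedge_point_def wedge_rel_def)
  show "wedge_point X x0 Y y0 \<in> topspace (wedge X x0 Y y0)"
    unfolding wedge_point_def wedge_def topspace_quotient_topology
    by (rule quotientI) (use assms in auto)
qed


section \<open>Topologized homotopy groups\<close>

text \<open>Maps are extensional, so that they are determined by their values on the domain.\<close>

definition compact_open :: "'a topology \<Rightarrow> 'b topology \<Rightarrow> ('a \<Rightarrow> 'b) topology" where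
  "compact_open X Y =
     topology_generated_by
       {{f \<in> extensional (topspace X). continuous_map X Y f \<and> f ` K \<subseteq> U} | K U.
          compactin X K \<and> openin Y U}"

lemma topspace_compact_open:
  "topspace (compact_open X Y) = {f \<in> extensional (topspace X). continuous_map X Y f}"
proof -
  have "{f \<in> extensional (topspace X). continuous_map X Y f} \<in>
      {{f \<in> extensional (topspace X). continuous_map X Y f \<and> f ` K \<subseteq> U} | K U.
          compactin X K \<and> openin Y U}"
    by (intro CollectI exI[of _ "{}"] exI[of _ "{}"]) auto
  then show ?thesis
    unfolding compact_open_def topology_generated_by_topspace by blast
qed

text \<open>Below, \<open>s\<close> is the basepoint of the \<open>n\<close>-sphere and \<open>x0\<close> the basepoint of \<open>X\<close>.\<close>

definition sphere_space :: "nat \<Rightarrow> (nat \<Rightarrow> real) \<Rightarrow> 'a topology \<Rightarrow> 'a \<Rightarrow> ((nat \<Rightarrow> real) \<Rightarrow> 'a) topology" where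
  "sphere_space n s X x0 = subtopology (compact_open (nsphere n) X) {f. f s = x0}"

definition based_homotopy ::
    "nat \<Rightarrow> (nat \<Rightarrow> real) \<Rightarrow> 'a topology \<Rightarrow> 'a \<Rightarrow> (((nat \<Rightarrow> real) \<Rightarrow> 'a) \<times> ((nat \<Rightarrow> real) \<Rightarrow> 'a)) set" where
  "based_homotopy n s X x0 =
     {(f, g). f \<in> topspace (sphere_space n s X x0) \<and> g \<in> topspace (sphere_space n s X x0) \<and>
              homotopic_with (\<lambda>h. h s = x0) (nsphere n) X f g}"

definition homotopy_group ::
    "nat \<Rightarrow> (nat \<Rightarrow> real) \<Rightarrow> 'a topology \<Rightarrow> 'a \<Rightarrow> ((nat \<Rightarrow> real) \<Rightarrow> 'a) set topology" where
  "homotopy_group n s X x0 = quotient_topology (sphere_space n s X x0) (based_homotopy n s X x0)"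

lemma topspace_sphere_space:
  "topspace (sphere_space n s X x0) =
     {f \<in> extensional (topspace (nsphere n)). continuous_map (nsphere n) X f \<and> f s = x0}"
  by (auto simp: sphere_space_def topspace_compact_open)

lemma equiv_based_homotopy:
  "equiv (topspace (sphere_space n s X x0)) (based_homotopy n s X x0)"
proof (rule equivI)
  show "refl_on (topspace (sphere_space n s X x0)) (based_homotopy n s X x0)"
    by (auto simp: refl_on_def based_homotopy_def topspace_sphere_space)
  show "sym (based_homotopy n s X x0)"
    by (auto simp: sym_def based_homotopy_def homotopic_with_sym)
  show "trans (based_homotopy n s X x0)"
    unfolding trans_def based_homotopy_def by (auto intro: homotopic_with_trans)
qed (auto simp: based_homotopy_def)


section \<open>The action of the fundamental group\<close>

text \<open>A map \<open>e\<close> exhibiting the circle, based at \<open>s\<close>, as the unit interval with its endpoints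
  identified: a based map \<open>\<alpha>\<close> on the circle corresponds to the loop \<open>\<alpha> \<circ> e\<close>.\<close>

definition circle_param :: "(nat \<Rightarrow> real) \<Rightarrow> (real \<Rightarrow> nat \<Rightarrow> real) \<Rightarrow> bool" where
  "circle_param s e \<longleftrightarrow>
     quotient_map (top_of_set {0..1}) (nsphere 1) e \<and> e 0 = s \<and> e 1 = s \<and> inj_on e {0..<1}"

definition cyl :: "nat \<Rightarrow> ((nat \<Rightarrow> real) \<times> real) topology" where
  "cyl n = prod_topology (nsphere n) (top_of_set {0..1})"

definition cyl_base :: "nat \<Rightarrow> (nat \<Rightarrow> real) \<Rightarrow> ((nat \<Rightarrow> real) \<times> real) set" where
  "cyl_base n s = {s} \<times> {0..1} \<union> topspace (nsphere n) \<times> {0}"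

definition cyl_retraction :: "nat \<Rightarrow> (nat \<Rightarrow> real) \<Rightarrow> ((nat \<Rightarrow> real) \<times> real \<Rightarrow> (nat \<Rightarrow> real) \<times> real) \<Rightarrow> bool" where
  "cyl_retraction n s r \<longleftrightarrow> retraction_maps (cyl n) (subtopology (cyl n) (cyl_base n s)) r id"

text \<open>A point \<open>(y, t)\<close> of \<open>cyl_base n s\<close> with \<open>t \<noteq> 0\<close> has \<open>y = s\<close>; at \<open>(s, 0)\<close>
  both prescriptions give the basepoint.\<close>

definition glue :: "(real \<Rightarrow> 'a) \<Rightarrow> ((nat \<Rightarrow> real) \<Rightarrow> 'a) \<Rightarrow> (nat \<Rightarrow> real) \<times> real \<Rightarrow> 'a" where
  "glue p \<gamma> = (\<lambda>(y, t). if t = 0 then \<gamma> y else p (1 - t))"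

definition act_map ::
    "nat \<Rightarrow> ((nat \<Rightarrow> real) \<times> real \<Rightarrow> (nat \<Rightarrow> real) \<times> real) \<Rightarrow> (real \<Rightarrow> 'a) \<Rightarrow> ((nat \<Rightarrow> real) \<Rightarrow> 'a) \<Rightarrow>
      (nat \<Rightarrow> real) \<Rightarrow> 'a" where
  "act_map n r p \<gamma> = restrict (\<lambda>x. glue p \<gamma> (r (x, 1))) (topspace (nsphere n))"

text \<open>The operation induced on classes; it is independent of representatives by
  \<open>pi1_action_class\<close> below.\<close>

definition pi1_action ::
    "nat \<Rightarrow> (nat \<Rightarrow> real) \<Rightarrow> (real \<Rightarrow> nat \<Rightarrow> real) \<Rightarrow>
     ((nat \<Rightarrow> real) \<times> real \<Rightarrow> (nat \<Rightarrow> real) \<times> real) \<Rightarrow> 'a topology \<Rightarrow> 'a \<Rightarrow>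
     ((nat \<Rightarrow> real) \<Rightarrow> 'a) set \<Rightarrow> ((nat \<Rightarrow> real) \<Rightarrow> 'a) set \<Rightarrow> ((nat \<Rightarrow> real) \<Rightarrow> 'a) set" where
  "pi1_action n s e r X x0 a b =
     (\<Union>\<alpha>\<in>a. \<Union>\<gamma>\<in>b. based_homotopy n s X x0 `` {act_map n r (\<alpha> \<circ> e) \<gamma>})"

lemma act_map_homotopy:
  assumes s: "s \<in> topspace (nsphere n)"
    and e: "circle_param s1 e"
    and r: "cyl_retraction n s r"
    and \<alpha>: "(\<alpha>, \<alpha>') \<in> based_homotopy 1 s1 X x0"
    and \<gamma>: "(\<gamma>, \<gamma>') \<in> based_homotopy n s X x0"
  shows "(act_map n r (\<alpha> \<circ> e) \<gamma>, act_map n r (\<alpha>' \<circ> e) \<gamma>') \<in> based_homotopy n s X x0"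
proof -
  let ?I = "top_of_set {0..1::real}"
  let ?Z = "subtopology (cyl n) (cyl_base n s)"
  let ?W = "prod_topology ?I ?Z"
  have ec: "continuous_map ?I (nsphere 1) e" and e01: "e 0 = s1" "e 1 = s1"
    using e by (auto simp: circle_param_def quotient_imp_continuous_map)
  have rc: "continuous_map (cyl n) ?Z r" and rid: "\<And>z. z \<in> topspace ?Z \<Longrightarrow> r z = z"
    using r by (auto simp: cyl_retraction_def retraction_maps_def)
  obtain g where gc: "continuous_map (prod_topology ?I (nsphere 1)) X g"
    and g0: "\<And>x. g (0, x) = \<alpha> x" and g1: "\<And>x. g (1, x) = \<alpha>' x"
    and gs: "\<And>t. t \<in> {0..1} \<Longrightarrow> g (t, s1) = x0"
    using \<alpha> by (auto simp: based_homotopy_def homotopic_with_def)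
  obtain h where hc: "continuous_map (prod_topology ?I (nsphere n)) X h"
    and h0: "\<And>x. h (0, x) = \<gamma> x" and h1: "\<And>x. h (1, x) = \<gamma>' x"
    and hs: "\<And>t. t \<in> {0..1} \<Longrightarrow> h (t, s) = x0"
    using \<gamma> by (auto simp: based_homotopy_def homotopic_with_def)
  define F where "F = (\<lambda>(u, y, t). if t = 0 then h (u, y) else g (u, e (1 - t)))"
  have topZ: "topspace ?Z = cyl_base n s"
    using s by (auto simp: cyl_def cyl_base_def)
  have p1: "continuous_map ?W ?I fst"
    by (simp add: continuous_map_fst)
  have p2: "continuous_map ?W (cyl n) snd"
    by (meson continuous_map_into_fulltopology continuous_map_snd)
  have p3: "continuous_map ?W (nsphere n) (\<lambda>z. fst (snd z))"
    using continuous_map_compose[OF p2, unfolded cyl_def, OF continuous_map_fst]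
    by (simp add: o_def cyl_def)
  have p4: "continuous_map ?W ?I (\<lambda>z. snd (snd z))"
    using continuous_map_compose[OF p2, unfolded cyl_def, OF continuous_map_snd]
    by (simp add: o_def cyl_def)
  have p5: "continuous_map ?W ?I (\<lambda>z. 1 - snd (snd z))"
  proof -
    have "continuous_map ?I ?I (\<lambda>t. 1 - t)"
      by (auto intro!: continuous_intros)
    from continuous_map_compose[OF p4 this] show ?thesis by (simp add: o_def)
  qed
  have c1: "continuous_map ?W X (\<lambda>z. h (fst z, fst (snd z)))"
    using continuous_map_compose[OF continuous_map_pairedI[OF p1 p3] hc] by (simp add: o_def)
  have c2: "continuous_map ?W X (\<lambda>z. g (fst z, e (1 - snd (snd z))))"
  proof -
    have "continuous_map ?W (nsphere 1) (\<lambda>z. e (1 - snd (snd z)))"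
      using continuous_map_compose[OF p5 ec] by (simp add: o_def)
    from continuous_map_compose[OF continuous_map_pairedI[OF p1 this] gc]
    show ?thesis by (simp add: o_def)
  qed
  define T where "T b = (if b then {z \<in> topspace ?W. snd (snd z) \<in> {0}}
                              else {z \<in> topspace ?W. fst (snd z) \<in> {s}})" for b
  have Fc: "continuous_map ?W X F"
  proof (rule pasting_lemma_closed[where I = UNIV and T = T and
        f = "\<lambda>b z. if b then h (fst z, fst (snd z)) else g (fst z, e (1 - snd (snd z)))"])
    fix b
    have "closedin ?I {0}" by (simp add: closedin_closed_eq)
    moreover have "closedin (nsphere n) {s}"
      by (metis Hausdorff_Euclidean_space Hausdorff_space_subtopology closedin_Hausdorff_singleton
          nsphere_def s)
    ultimately show "closedin ?W (T b)"
      unfolding T_def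
      using closedin_continuous_map_preimage[OF p4, of "{0}"]
        closedin_continuous_map_preimage[OF p3, of "{s}"]
      by (cases b) (simp_all only: if_True if_False)
    show "continuous_map (subtopology ?W (T b)) X
        (\<lambda>z. if b then h (fst z, fst (snd z)) else g (fst z, e (1 - snd (snd z))))"
      using c1 c2 by (cases b) (auto simp: continuous_map_from_subtopology)
  next
    fix b c z assume "z \<in> topspace ?W \<inter> T b \<inter> T c"
    then show "(if b then h (fst z, fst (snd z)) else g (fst z, e (1 - snd (snd z)))) =
               (if c then h (fst z, fst (snd z)) else g (fst z, e (1 - snd (snd z))))"
      using e01 gs hs by (cases b; cases c) (auto simp: T_def)
  next
    fix z assume z: "z \<in> topspace ?W"
    obtain u y t where zz: "z = (u, y, t)" by (cases z)
    have "t = 0 \<or> y = s" using z topZ by (auto simp: zz cyl_base_def)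
    then show "\<exists>b. b \<in> UNIV \<and> z \<in> T b \<and>
        F z = (if b then h (fst z, fst (snd z)) else g (fst z, e (1 - snd (snd z))))"
      using z by (intro exI[of _ "t = 0"]) (auto simp: T_def F_def zz)
  qed auto
  define K where "K = (\<lambda>(u, x). F (u, r (x, 1)))"
  have Kc: "continuous_map (prod_topology ?I (nsphere n)) X K"
  proof -
    have "continuous_map (nsphere n) (cyl n) (\<lambda>x. (x, 1))"
      unfolding cyl_def by (intro continuous_map_pairedI) auto
    from continuous_map_compose[OF this rc]
    have "continuous_map (nsphere n) ?Z (\<lambda>x. r (x, 1))" by (simp add: o_def)
    from continuous_map_compose[OF continuous_map_snd this]
    have "continuous_map (prod_topology ?I (nsphere n)) ?Z (\<lambda>w. r (snd w, 1))"
      by (simp add: o_def)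
    from continuous_map_compose[OF continuous_map_pairedI[OF continuous_map_fst this] Fc]
    show ?thesis by (simp add: o_def K_def case_prod_unfold)
  qed
  have "(s, 1) \<in> topspace ?Z" using topZ by (simp add: cyl_base_def)
  then have rs: "r (s, 1) = (s, 1)" by (rule rid)
  have K0: "K (0, x) = glue (\<alpha> \<circ> e) \<gamma> (r (x, 1))" for x
    by (simp add: K_def F_def glue_def g0 h0 case_prod_beta)
  have K1: "K (1, x) = glue (\<alpha>' \<circ> e) \<gamma>' (r (x, 1))" for x
    by (simp add: K_def F_def glue_def g1 h1 case_prod_beta)
  have Ks: "K (u, s) = x0" if "u \<in> {0..1}" for u
    using that gs e01 by (simp add: K_def F_def rs)
  have hom: "homotopic_with (\<lambda>h. h s = x0) (nsphere n) X
      (act_map n r (\<alpha> \<circ> e) \<gamma>) (act_map n r (\<alpha>' \<circ> e) \<gamma>')"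
  proof -
    have "homotopic_with (\<lambda>h. h s = x0) (nsphere n) X
        (\<lambda>x. glue (\<alpha> \<circ> e) \<gamma> (r (x, 1))) (\<lambda>x. glue (\<alpha>' \<circ> e) \<gamma>' (r (x, 1)))"
      unfolding homotopic_with_def using Kc K0 K1 Ks by blast
    then show ?thesis
      by (rule homotopic_with_eq) (use s in \<open>auto simp: act_map_def\<close>)
  qed
  moreover have "act_map n r p q \<in> extensional (topspace (nsphere n))" for p and q :: "(nat \<Rightarrow> real) \<Rightarrow> 'a"
    by (simp add: act_map_def)
  ultimately show ?thesis
    using homotopic_with_imp_continuous_maps[OF hom] homotopic_with_imp_property[OF hom]
    by (simp add: based_homotopy_def topspace_sphere_space)
qed

lemma pi1_action_class:
  assumes s: "s \<in> topspace (nsphere n)"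
    and e: "circle_param s1 e"
    and r: "cyl_retraction n s r"
    and \<alpha>: "\<alpha> \<in> topspace (sphere_space 1 s1 X x0)"
    and \<gamma>: "\<gamma> \<in> topspace (sphere_space n s X x0)"
  shows "act_map n r (\<alpha> \<circ> e) \<gamma> \<in> topspace (sphere_space n s X x0)"
    and "pi1_action n s e r X x0 (based_homotopy 1 s1 X x0 `` {\<alpha>}) (based_homotopy n s X x0 `` {\<gamma>})
           = based_homotopy n s X x0 `` {act_map n r (\<alpha> \<circ> e) \<gamma>}"
proof -
  have refl: "(\<alpha>, \<alpha>) \<in> based_homotopy 1 s1 X x0" "(\<gamma>, \<gamma>) \<in> based_homotopy n s X x0"
    using \<alpha> \<gamma> equiv_based_homotopy by (metis equiv_class_self Image_singleton_iff)+
  show "act_map n r (\<alpha> \<circ> e) \<gamma> \<in> topspace (sphere_space n s X x0)"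
    using act_map_homotopy[OF s e r refl] by (simp add: based_homotopy_def)
  have "based_homotopy n s X x0 `` {act_map n r (\<alpha>' \<circ> e) \<gamma>'} =
        based_homotopy n s X x0 `` {act_map n r (\<alpha> \<circ> e) \<gamma>}"
    if "(\<alpha>, \<alpha>') \<in> based_homotopy 1 s1 X x0" "(\<gamma>, \<gamma>') \<in> based_homotopy n s X x0" for \<alpha>' \<gamma>'
    using equiv_class_eq[OF equiv_based_homotopy act_map_homotopy[OF s e r that]] by simp
  then show "pi1_action n s e r X x0 (based_homotopy 1 s1 X x0 `` {\<alpha>}) (based_homotopy n s X x0 `` {\<gamma>})
           = based_homotopy n s X x0 `` {act_map n r (\<alpha> \<circ> e) \<gamma>}"
    unfolding pi1_action_def using refl by blast
qed


section \<open>The spaces\<close>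

definition space_A :: "(real \<times> real) topology" where
  "space_A = top_of_set
     (cball (1/2, 0) (1/2) \<union>
      (\<Union>m\<in>{1::nat..}. sphere ((real m + 1) / (2 * real m), 0) ((real m + 1) / (2 * real m))))"

definition hawaiian_earring :: "nat \<Rightarrow> (nat \<Rightarrow> real) topology" where
  "hawaiian_earring n = subtopology (Euclidean_space (Suc n))
     (\<Union>m\<in>{1::nat..}. {x. (x 0 - 1 / real m)\<^sup>2 + (\<Sum>i=1..n. (x i)\<^sup>2) = (1 / real m)\<^sup>2})"

abbreviation space_X :: "nat \<Rightarrow> ((real \<times> real) + (nat \<Rightarrow> real)) set topology" where
  "space_X n \<equiv> wedge space_A (0, 0) (hawaiian_earring n) (\<lambda>i. 0)"

abbreviation base_X :: "nat \<Rightarrow> ((real \<times> real) + (nat \<Rightarrow> real)) set" where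
  "base_X n \<equiv> wedge_point space_A (0, 0) (hawaiian_earring n) (\<lambda>i. 0)"

lemma basepoints:
  "(0, 0) \<in> topspace space_A" "(\<lambda>i. 0) \<in> topspace (hawaiian_earring n)"
  by (auto simp: space_A_def hawaiian_earring_def topspace_Euclidean_space dist_Pair_Pair dist_real_def
      intro!: bexI[of _ 1])

end

theory Submission
  imports Defs "HOL-Homology.Homology"
begin

text \<open>
  Let \<open>\<alpha>\<close> run \<open>k\<close> times around the \<open>m\<close>-th circle \<open>C\<close> of \<open>A\<close>, and let \<open>\<gamma>\<close> be a map of degree
  \<open>\<plusminus>2 ^ m\<close> onto the \<open>k\<close>-th sphere of the earring. For fixed \<open>k\<close> the loops \<open>\<alpha>\<close> converge, as \<open>m\<close> grows,
  to the \<open>k\<close>-fold boundary loop of the disk, which is nullhomotopic; and the maps \<open>\<gamma>\<close> converge to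
  the constant map, as \<open>k\<close> grows, uniformly in \<open>m\<close>. So every product of neighbourhoods of the two
  neutral elements contains some pair \<open>([\<alpha>], [\<gamma>])\<close>: choose \<open>k\<close> first, and then \<open>m\<close> depending on \<open>k\<close>.

  On the other hand the classes \<open>[\<alpha> \<cdot> \<gamma>]\<close> stay away from the neutral element. A map in such a class
  must wind \<open>k\<close> times around a circle of diameter at least 1, which bounds \<open>k\<close> on a
  neighbourhood of a given map by uniform continuity. For fixed \<open>k\<close> the degree over the \<open>k\<close>-th sphere
  is locally constant and determines \<open>m\<close>. To avoid lifting homotopies, the classes are
  enlarged to sets of maps that are open and closed in the mapping space; such sets are
  automatically saturated under homotopy.
\<close>

section \<open>Degrees of self-maps of spheres\<close>

text \<open>On mapping spaces the formula for the action is continuous; it fails on classes because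
  neighbourhoods of a pair are boxes of open sets of two quotients, and the product of two quotient
  maps need not be a quotient map. This is why the witnesses carry two indices, chosen one after the
  other. The total degree over an earring sphere cannot detect the loop, since the action preserves
  it. A finer invariant does: retract \<open>X\<close> onto the \<open>m\<close>-th circle and lift
  the composite to a real height, with height 0 at the basepoint. Points sent into the
  \<open>k\<close>-th sphere off its basepoint have integer height, so the degree over that sphere
  splits into contributions of the integer heights, and acting with \<open>k\<close> turns places
  the contribution of \<open>\<gamma>\<close> at height \<open>k\<close>. The powers of 2 encode
  \<open>m\<close> injectively as a nonzero degree. They come from iterating one map of degree 2;
  the sign stays open because the homeomorphism that corrects the basepoint may reverse
  orientation.\<close>

lemma relative_homology_nsphere_hemispheres:
  assumes "c \<in> carrier (relative_homology_group p (nsphere n) {x. x k = 0})"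
  obtains u v where
    "u \<in> carrier (relative_homology_group p (subtopology (nsphere n) {x. x k \<ge> 0}) {x. x k = 0})"
    "v \<in> carrier (relative_homology_group p (subtopology (nsphere n) {x. x k \<le> 0}) {x. x k = 0})"
    "c = hom_induced p (subtopology (nsphere n) {x. x k \<ge> 0}) {x. x k = 0} (nsphere n) {x. x k = 0} id u
         \<otimes>\<^bsub>relative_homology_group p (nsphere n) {x. x k = 0}\<^esub>
         hom_induced p (subtopology (nsphere n) {x. x k \<le> 0}) {x. x k = 0} (nsphere n) {x. x k = 0} id v"
proof -
  let ?S = "nsphere n"
  let ?E = "{x::nat\<Rightarrow>real. x k = 0}"
  let ?P = "{x::nat\<Rightarrow>real. x k \<ge> 0}" and ?M = "{x::nat\<Rightarrow>real. x k \<le> 0}"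
  let ?U = "subtopology ?S ?P" and ?L = "subtopology ?S ?M"
  let ?H = "relative_homology_group p"
  have "(\<lambda>(x, y). hom_induced p ?U ?E ?S ?E id x \<otimes>\<^bsub>?H ?S ?E\<^esub> hom_induced p ?L ?E ?S ?E id y)
        \<in> Group.iso (?H ?U ?E \<times>\<times> ?H ?L ?E) (?H ?S ?E)"
  \<comment> \<open>The two hemisphere isomorphisms are excisions; with the exact sequences of the
    triples through \<open>?P\<close> and \<open>?M\<close> they split the group of the sphere
    modulo the equator as a direct sum.\<close>
  proof (rule conjunct1 [OF exact_sequence_sum_lemma [OF abelian_relative_homology_group]])
    show "hom_induced p ?U ?E ?S ?M id \<in> Group.iso (?H ?U ?E) (?H ?S ?M)"
      by (rule iso_relative_homology_group_upper_hemisphere)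
    show "hom_induced p ?L ?E ?S ?P id \<in> Group.iso (?H ?L ?E) (?H ?S ?P)"
      by (rule iso_relative_homology_group_lower_hemisphere)
    show "exact_seq ([?H ?S ?P, ?H ?S ?E, ?H ?U ?E],
          [hom_induced p ?S ?E ?S ?P id, hom_induced p ?U ?E ?S ?E id])"
      by (rule homology_exactness_triple_3) force
    show "exact_seq ([?H ?S ?M, ?H ?S ?E, ?H ?L ?E],
          [hom_induced p ?S ?E ?S ?M id, hom_induced p ?L ?E ?S ?E id])"
      by (rule homology_exactness_triple_3) force
  qed (simp_all add: hom_induced_compose' subset_iff)
  then have "carrier (?H ?S ?E) \<subseteq>
      (\<lambda>(x, y). hom_induced p ?U ?E ?S ?E id x \<otimes>\<^bsub>?H ?S ?E\<^esub> hom_induced p ?L ?E ?S ?E id y) `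
        carrier (?H ?U ?E \<times>\<times> ?H ?L ?E)"
    by (simp add: iso_iff)
  from subsetD[OF this assms] show thesis
    using that by auto
qed

text \<open>The constant map factors through the pair \<open>({b}, {b})\<close>, whose relative
  homology is trivial.\<close>

lemma hom_induced_const_point:
  assumes "b \<in> topspace Y" "c \<in> carrier (relative_homology_group p X S)"
  shows "hom_induced p X S Y {b} (\<lambda>_. b) c = \<one>\<^bsub>relative_homology_group p Y {b}\<^esub>"
proof -
  let ?B = "subtopology Y {b}"
  have triv: "trivial_group (relative_homology_group p ?B {b})"
    using trivial_relative_homology_group_topspace[of p ?B] assms by simp
  have "hom_induced p X S Y {b} (\<lambda>_. b) c
      = hom_induced p ?B {b} Y {b} id (hom_induced p X S ?B {b} (\<lambda>_. b) c)"
    using assms(1) hom_induced_compose'[of X ?B "\<lambda>_. b" S "{b}" Y id "{b}" p c]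
    by (simp add: continuous_map_in_subtopology)
  also have "hom_induced p X S ?B {b} (\<lambda>_. b) c = \<one>\<^bsub>relative_homology_group p ?B {b}\<^esub>"
    using triv hom_induced_carrier[of p X S ?B "{b}" "\<lambda>_. b" c]
    by (simp only: trivial_group_def singleton_iff)
  also have "hom_induced p ?B {b} Y {b} id \<dots> = \<one>\<^bsub>relative_homology_group p Y {b}\<^esub>"
    by (meson group_hom.hom_one group_hom_axioms_def group_hom_def group_relative_homology_group hom_induced_hom)
  finally show ?thesis .
qed

text \<open>Modulo the equator a homology class splits into hemisphere parts, and each of
  \<open>f1\<close> and \<open>f2\<close> kills the part on which it is constant, so the degrees
  add. The comparison takes place in homology relative to the point \<open>b\<close>, which for
  \<open>n \<ge> 1\<close> agrees with the homology of the sphere.\<close>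

lemma Brouwer_degree2_hemispheres:
  fixes f1 f2 :: "(nat \<Rightarrow> real) \<Rightarrow> nat \<Rightarrow> real"
  assumes n: "n \<ge> 1"
    and f1: "continuous_map (nsphere n) (nsphere n) f1"
    and f2: "continuous_map (nsphere n) (nsphere n) f2"
    and b: "b \<in> topspace (nsphere n)"
    and f1_lower: "\<And>x. x \<in> topspace (nsphere n) \<Longrightarrow> x k \<le> 0 \<Longrightarrow> f1 x = b"
    and f2_upper: "\<And>x. x \<in> topspace (nsphere n) \<Longrightarrow> x k \<ge> 0 \<Longrightarrow> f2 x = b"
  shows "continuous_map (nsphere n) (nsphere n) (\<lambda>x. if 0 \<le> x k then f1 x else f2 x)"
    and "Brouwer_degree2 n (\<lambda>x. if 0 \<le> x k then f1 x else f2 x) = Brouwer_degree2 n f1 + Brouwer_degree2 n f2"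
proof -
  let ?S = "nsphere n"
  let ?E = "{x::nat\<Rightarrow>real. x k = 0}"
  let ?P = "{x::nat\<Rightarrow>real. x k \<ge> 0}" and ?M = "{x::nat\<Rightarrow>real. x k \<le> 0}"
  let ?U = "subtopology ?S ?P" and ?L = "subtopology ?S ?M"
  let ?H = "homology_group (int n) ?S"
  let ?HE = "relative_homology_group (int n) ?S ?E"
  let ?Hb = "relative_homology_group (int n) ?S {b}"
  define f where "f = (\<lambda>x. if 0 \<le> x k then f1 x else f2 x)"
  have fc: "continuous_map ?S ?S f"
    unfolding f_def
    using f1 f2 f1_lower f2_upper
    by (intro continuous_map_cases_le continuous_map_nsphere_projection)
       (auto intro: continuous_map_from_subtopology)
  then show "continuous_map ?S ?S (\<lambda>x. if 0 \<le> x k then f1 x else f2 x)"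
    by (simp add: f_def)
  have red: "reduced_homology_group (int n) ?S = ?H"
    using n by (simp add: un_reduced_homology_group)
  let ?K = "hom_induced (int n) ?S {} ?S {b} id"
  let ?j = "hom_induced (int n) ?S {} ?S ?E id"
  have K: "?K \<in> iso ?H ?Hb"
    using iso_reduced_homology_by_contractible[of ?S "{b}" "int n"] b
    by (simp add: red contractible_space_singleton)
  interpret K: group_hom ?H ?Hb ?K
    by (simp add: group_hom_axioms_def group_hom_def hom_induced_hom)
  interpret HE: comm_group ?HE by simp
  interpret H: comm_group ?H by simp
  have ext: "hom_induced (int n) X {} ?S {} h = hom_induced (int n) X {} ?S {} (\<lambda>x. if x \<in> topspace ?S then h x else b)"
    if "topspace X \<subseteq> topspace ?S" for h and X :: "(nat \<Rightarrow> real) topology"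
    using that by (intro hom_induced_eq) auto
  have main: "?K (hom_induced (int n) ?S {} ?S {} h c) =
        hom_induced (int n) ?U ?E ?S {b} (\<lambda>x. if x \<in> topspace ?S then h x else b) u \<otimes>\<^bsub>?Hb\<^esub>
        hom_induced (int n) ?L ?E ?S {b} (\<lambda>x. if x \<in> topspace ?S then h x else b) v"
    if h: "continuous_map ?S ?S h" "\<And>x. x \<in> topspace ?S \<Longrightarrow> x k = 0 \<Longrightarrow> h x = b"
      and u: "u \<in> carrier (relative_homology_group (int n) ?U ?E)"
      and v: "v \<in> carrier (relative_homology_group (int n) ?L ?E)"
      and c: "?j c = hom_induced (int n) ?U ?E ?S ?E id u \<otimes>\<^bsub>?HE\<^esub> hom_induced (int n) ?L ?E ?S ?E id v"
    for h c u v
  proof -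
    \<comment> \<open>\<open>?E\<close> is a whole hyperplane, not only the equator; the value
      \<open>b\<close> off the sphere makes \<open>g\<close> a map of pairs into \<open>{b}\<close>
      without changing the induced map.\<close>
    define g where "g = (\<lambda>x. if x \<in> topspace ?S then h x else b)"
    have gc: "continuous_map ?S ?S g"
      using h(1) by (rule continuous_map_eq) (simp add: g_def)
    have gE: "g \<in> ?E \<rightarrow> {b}"
      using h(2) by (auto simp: g_def)
    interpret R: group_hom ?HE ?Hb "hom_induced (int n) ?S ?E ?S {b} g"
      by (simp add: group_hom_axioms_def group_hom_def hom_induced_hom)
    have "?K (hom_induced (int n) ?S {} ?S {} h c) = ?K (hom_induced (int n) ?S {} ?S {} g c)"
      using ext[of ?S h] by (simp add: g_def)
    also have "\<dots> = hom_induced (int n) ?S ?E ?S {b} g (?j c)"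
      using gc gE by (simp add: hom_induced_compose')
    also have "\<dots> = hom_induced (int n) ?S ?E ?S {b} g (hom_induced (int n) ?U ?E ?S ?E id u) \<otimes>\<^bsub>?Hb\<^esub>
        hom_induced (int n) ?S ?E ?S {b} g (hom_induced (int n) ?L ?E ?S ?E id v)"
      unfolding c by (rule R.hom_mult) (auto simp: hom_induced_carrier)
    also have "\<dots> = hom_induced (int n) ?U ?E ?S {b} g u \<otimes>\<^bsub>?Hb\<^esub> hom_induced (int n) ?L ?E ?S {b} g v"
      using gc gE by (simp add: hom_induced_compose')
    finally show ?thesis by (simp add: g_def)
  qed
  have fE: "h x = b" if "h \<in> {f, f1, f2}" "x \<in> topspace ?S" "x k = 0" for h x
    using that f1_lower f2_upper by (auto simp: f_def)
  have "Brouwer_degree2 n f = Brouwer_degree2 n f1 + Brouwer_degree2 n f2"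
  proof (rule Brouwer_degree2_unique[OF fc], unfold red)
    fix c assume c: "c \<in> carrier ?H"
    obtain u v where u: "u \<in> carrier (relative_homology_group (int n) ?U ?E)"
      and v: "v \<in> carrier (relative_homology_group (int n) ?L ?E)"
      and j: "?j c = hom_induced (int n) ?U ?E ?S ?E id u \<otimes>\<^bsub>?HE\<^esub> hom_induced (int n) ?L ?E ?S ?E id v"
      using relative_homology_nsphere_hemispheres[of "?j c"] by (metis hom_induced_carrier)
    let ?x = "\<lambda>h x. if x \<in> topspace ?S then h x else b"
    have one: "hom_induced (int n) ?L ?E ?S {b} (?x f1) v = \<one>\<^bsub>?Hb\<^esub>"
      "hom_induced (int n) ?U ?E ?S {b} (?x f2) u = \<one>\<^bsub>?Hb\<^esub>"
      using hom_induced_const_point[OF b u] hom_induced_const_point[OF b v]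
        hom_induced_eq[of ?L "?x f1" "\<lambda>_. b"] hom_induced_eq[of ?U "?x f2" "\<lambda>_. b"] f1_lower f2_upper
      by auto
    have eq: "hom_induced (int n) ?U ?E ?S {b} (?x f) u = hom_induced (int n) ?U ?E ?S {b} (?x f1) u"
      by (rule fun_cong, rule hom_induced_eq) (auto simp: f_def)
    have ff2: "f x = f2 x" if "x \<in> topspace ?S" "x k \<le> 0" for x
      using that f1_lower[of x] f2_upper[of x] by (cases "x k = 0") (auto simp: f_def)
    have eq2: "hom_induced (int n) ?L ?E ?S {b} (?x f) v = hom_induced (int n) ?L ?E ?S {b} (?x f2) v"
      by (rule fun_cong, rule hom_induced_eq) (simp add: ff2)
    let ?F = "\<lambda>h. hom_induced (int n) ?S {} ?S {} h c"
    have m: "?K (?F h) = hom_induced (int n) ?U ?E ?S {b} (?x h) u \<otimes>\<^bsub>?Hb\<^esub> hom_induced (int n) ?L ?E ?S {b} (?x h) v"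
      if "continuous_map ?S ?S h" "h \<in> {f, f1, f2}" for h
      by (rule main[OF that(1) _ u v j]) (use fE that(2) in blast)
    have car: "?F h \<in> carrier ?H" for h
      by (rule hom_induced_carrier)
    have carb: "hom_induced (int n) ?U ?E ?S {b} h u \<in> carrier ?Hb" 
       "hom_induced (int n) ?L ?E ?S {b} h v \<in> carrier ?Hb" for h
      by (rule hom_induced_carrier)+
    have "?K (?F f1) = hom_induced (int n) ?U ?E ?S {b} (?x f1) u"
      using m[OF f1] one(1) K.H.r_one[OF carb(1)] by simp
    moreover have "?K (?F f2) = hom_induced (int n) ?L ?E ?S {b} (?x f2) v"
      using m[OF f2] one(2) K.H.l_one[OF carb(2)] by simp
    moreover have "?K (?F f) = hom_induced (int n) ?U ?E ?S {b} (?x f1) u \<otimes>\<^bsub>?Hb\<^esub> hom_induced (int n) ?L ?E ?S {b} (?x f2) v"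
      using m[OF fc] eq eq2 by simp
    ultimately have "?K (?F f) = ?K (?F f1) \<otimes>\<^bsub>?Hb\<^esub> ?K (?F f2)"
      by (simp only:)
    also have "\<dots> = ?K (?F f1 \<otimes>\<^bsub>?H\<^esub> ?F f2)"
      by (rule K.hom_mult[symmetric]) (rule car)+
    finally have Keq: "?K (?F f) = ?K (?F f1 \<otimes>\<^bsub>?H\<^esub> ?F f2)" .
    have inj: "inj_on ?K (carrier ?H)"
      using K unfolding iso_def bij_betw_def by blast
    have "?F f1 \<otimes>\<^bsub>?H\<^esub> ?F f2 \<in> carrier ?H"
      by (rule monoid.m_closed[OF group.is_monoid[OF group_relative_homology_group] car car])
    then have "?F f = ?F f1 \<otimes>\<^bsub>?H\<^esub> ?F f2"
      by (rule inj_onD[OF inj Keq car])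
    also have "\<dots> = c [^]\<^bsub>?H\<^esub> Brouwer_degree2 n f1 \<otimes>\<^bsub>?H\<^esub> c [^]\<^bsub>?H\<^esub> Brouwer_degree2 n f2"
      using Brouwer_degree2[of c n, unfolded red, OF c] by (simp only:)
    also have "\<dots> = c [^]\<^bsub>?H\<^esub> (Brouwer_degree2 n f1 + Brouwer_degree2 n f2)"
      by (rule group.int_pow_mult[OF group_relative_homology_group c, symmetric])
    finally show "?F f = c [^]\<^bsub>?H\<^esub> (Brouwer_degree2 n f1 + Brouwer_degree2 n f2)" .
  qed
  then show "Brouwer_degree2 n (\<lambda>x. if 0 \<le> x k then f1 x else f2 x) = Brouwer_degree2 n f1 + Brouwer_degree2 n f2"
    by (simp add: f_def)
qed

section \<open>Homotopies of maps into spheres and local connectedness\<close>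

lemma continuous_map_normalize:
  "continuous_map (subtopology (Euclidean_space (Suc n)) (- {\<lambda>i. 0})) (nsphere n)
     (\<lambda>x i. x i / sqrt (\<Sum>j\<le>n. (x j)\<^sup>2))"
proof -
  have *: "\<lbrakk>\<forall>i\<ge>Suc n. x i = 0; x \<noteq> (\<lambda>i. 0)\<rbrakk> \<Longrightarrow> (\<Sum>j\<le>n. (x j)\<^sup>2) \<noteq> 0" for x :: "nat \<Rightarrow> real"
    by (force simp: fun_eq_iff not_less_eq_eq sum_nonneg_eq_0_iff)
  show ?thesis
    apply (simp add: Euclidean_space_def continuous_map_in_subtopology continuous_map_componentwise_UNIV
                     nsphere continuous_map_componentwise subtopology_subtopology)
    apply (intro conjI allI continuous_intros continuous_map_from_subtopology [OF continuous_map_product_projection])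
        apply (simp_all add: *)
     apply (force simp: sum_nonneg fun_eq_iff not_less_eq_eq sum_nonneg_eq_0_iff power_divide simp flip: sum_divide_distrib)
    done
qed

lemma topspace_nsphere_iff:
  "x \<in> topspace (nsphere n) \<longleftrightarrow> (\<Sum>i\<le>n. (x i)\<^sup>2) = 1 \<and> (\<forall>i>n. x i = 0)"
  by (auto simp: nsphere)

lemma continuous_map_nsphere_iff:
  "continuous_map X (nsphere n) f \<longleftrightarrow>
     (\<forall>i. continuous_map X euclideanreal (\<lambda>x. f x i)) \<and> f ` topspace X \<subseteq> topspace (nsphere n)"
  by (auto simp: nsphere continuous_map_in_subtopology continuous_map_componentwise_UNIV)

lemma continuous_map_nsphere_component:
  "continuous_map X (nsphere n) f \<Longrightarrow> continuous_map X euclideanreal (\<lambda>x. f x i)"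
  by (simp add: continuous_map_nsphere_iff)

text \<open>The homotopy is the normalised straight segment from \<open>f x\<close> to
  \<open>g x\<close>. For unit vectors the segment can meet 0 only at its midpoint, and then the two
  points are antipodal.\<close>

lemma nsphere_nonantipodal_homotopic:
  assumes f: "continuous_map X (nsphere n) f" and g: "continuous_map X (nsphere n) g"
    and fg: "\<And>x. x \<in> topspace X \<Longrightarrow> g x \<noteq> (\<lambda>i. - f x i)"
  shows "homotopic_with (\<lambda>_. True) X (nsphere n) f g"
proof -
  let ?g = "\<lambda>x i. x i / sqrt (\<Sum>j\<le>n. (x j)\<^sup>2)"
  let ?h = "\<lambda>(t::real, x) i. (1 - t) * f x i + t * g x i"
  let ?Y = "subtopology (Euclidean_space (Suc n)) (- {\<lambda>i. 0})"
  let ?T01 = "top_of_set {0..1::real}"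
  have f1: "(\<Sum>i\<le>n. (f x i)\<^sup>2) = 1" "\<And>i. i > n \<Longrightarrow> f x i = 0" 
   and g1: "(\<Sum>i\<le>n. (g x i)\<^sup>2) = 1" "\<And>i. i > n \<Longrightarrow> g x i = 0" if "x \<in> topspace X" for x
    using f g that by (auto simp: continuous_map_nsphere_iff topspace_nsphere_iff image_subset_iff)
  have "continuous_map (prod_topology ?T01 X) (nsphere n) (?g \<circ> ?h)"
  proof (rule continuous_map_compose[OF _ continuous_map_normalize])
    have "continuous_map (prod_topology ?T01 X) euclideanreal (\<lambda>r. f (snd r) k)"
      "continuous_map (prod_topology ?T01 X) euclideanreal (\<lambda>r. g (snd r) k)" for k
      using continuous_map_compose[OF continuous_map_snd continuous_map_nsphere_component[OF f]]
        continuous_map_compose[OF continuous_map_snd continuous_map_nsphere_component[OF g]]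
      by (simp_all add: o_def)
    then have "continuous_map (prod_topology ?T01 X) euclideanreal (\<lambda>r. ?h r k)" for k
      unfolding case_prod_unfold
      by (intro continuous_map_into_fulltopology [OF continuous_map_fst] continuous_intros) auto
    moreover have "?h r \<noteq> (\<lambda>i. 0)" if "r \<in> topspace (prod_topology ?T01 X)" for r
    proof
      obtain t x where r: "r = (t, x)" by (cases r)
      assume "?h r = (\<lambda>i. 0)"
      then have eq: "(1 - t) * f x i = - (t * g x i)" for i
        by (auto simp: r fun_eq_iff add_eq_0_iff2)
      have x: "x \<in> topspace X" using that r by auto
      have "(1 - t)\<^sup>2 = (\<Sum>i\<le>n. ((1 - t) * f x i)^2)"
        using f1[OF x] by (simp add: power_mult_distrib flip: sum_distrib_left)
      also have "\<dots> = t\<^sup>2"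
        using g1[OF x] by (simp add: eq power_mult_distrib flip: sum_distrib_left)
      finally have "t = 1/2"
        by (simp add: power2_eq_iff)
      with eq fg[OF x] show False by (auto simp: fun_eq_iff)
    qed
    ultimately show "continuous_map (prod_topology ?T01 X) ?Y ?h"
      using f1 g1 unfolding Euclidean_space_def continuous_map_in_subtopology continuous_map_componentwise_UNIV
      by auto
  qed
  then show ?thesis
    unfolding homotopic_with
    by (auto simp: homotopic_with f1 g1 intro!: exI[of _ "?g \<circ> ?h"])
qed

text \<open>Normalisation retracts the open set of nonzero vectors onto the sphere, and local
  connectedness passes to open subsets and to retracts. It supplies the connected pieces in
  \<open>twisted_maps_bounded\<close>.\<close>

lemma locally_connected_space_nsphere: "locally_connected_space (nsphere n)"
proof (rule locally_connected_space_retraction_map_image)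
  let ?Y = "subtopology (Euclidean_space (Suc n)) (- {\<lambda>i. 0})"
  let ?g = "\<lambda>x i. x i / sqrt (\<Sum>j\<le>n. (x j)\<^sup>2)"
  have "continuous_map (nsphere n) ?Y id"
    by (auto simp: nsphere_def continuous_map_in_subtopology topspace_Euclidean_space)
  then show "retraction_map ?Y (nsphere n) ?g"
    unfolding retraction_map_def retraction_maps_def
    using continuous_map_normalize[of n]
    by (intro exI[of _ id]) (simp add: topspace_nsphere_iff)
  have "openin (Euclidean_space (Suc n)) (topspace (Euclidean_space (Suc n)) - {\<lambda>i. 0})"
    by (rule openin_diff[OF openin_topspace closedin_Hausdorff_singleton[OF Hausdorff_Euclidean_space]])
       (simp add: topspace_Euclidean_space)
  then show "locally_connected_space ?Y"
    using locally_connected_space_open_subset[OF locally_connected_Euclidean_space]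
    by (metis Diff_eq subtopology_restrict)
qed


section \<open>Based self-maps of degree plus or minus a power of 2\<close>

lemma Brouwer_degree2_funpow:
  assumes "continuous_map (nsphere n) (nsphere n) g"
  shows "continuous_map (nsphere n) (nsphere n) (g ^^ m)"
    and "Brouwer_degree2 n (g ^^ m) = Brouwer_degree2 n g ^ m"
proof (induction m)
  case (Suc m)
  { case 1 show ?case
      unfolding funpow.simps by (rule continuous_map_compose[OF Suc(1) assms]) }
  { case 2 show ?case
      unfolding funpow.simps Brouwer_degree2_compose[OF Suc(1) assms] Suc(2) by simp }
qed auto

text \<open>The orthogonal reflection in the hyperplane perpendicular to \<open>v\<close>.\<close>

definition nsphere_mirror :: "nat \<Rightarrow> (nat \<Rightarrow> real) \<Rightarrow> (nat \<Rightarrow> real) \<Rightarrow> nat \<Rightarrow> real" where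
  "nsphere_mirror n v x = (\<lambda>i. x i - 2 * (\<Sum>j\<le>n. x j * v j) / (\<Sum>j\<le>n. (v j)\<^sup>2) * v i)"

lemma sum_nsphere_mirror:
  assumes "\<exists>j\<le>n. v j \<noteq> 0"
  shows "(\<Sum>j\<le>n. nsphere_mirror n v x j * v j) = - (\<Sum>j\<le>n. x j * v j)"
    and "(\<Sum>j\<le>n. (nsphere_mirror n v x j)\<^sup>2) = (\<Sum>j\<le>n. (x j)\<^sup>2)"
proof -
  define q where "q = (\<Sum>j\<le>n. (v j)\<^sup>2)"
  have q: "q \<noteq> 0" using assms unfolding q_def by (subst sum_nonneg_eq_0_iff) auto
  define c where "c = (\<Sum>j\<le>n. x j * v j) / q"
  have cq: "c * q = (\<Sum>j\<le>n. x j * v j)" using q by (simp add: c_def)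
  have m: "nsphere_mirror n v x j = x j - 2 * c * v j" for j
    by (simp add: nsphere_mirror_def c_def q_def)
  have "(\<Sum>j\<le>n. nsphere_mirror n v x j * v j) = (\<Sum>j\<le>n. x j * v j) - 2 * c * q"
    by (simp add: m q_def algebra_simps sum_subtractf sum_distrib_left power2_eq_square)
  then show "(\<Sum>j\<le>n. nsphere_mirror n v x j * v j) = - (\<Sum>j\<le>n. x j * v j)"
    using cq by (simp add: mult.assoc)
  have "(\<Sum>j\<le>n. (nsphere_mirror n v x j)\<^sup>2) = (\<Sum>j\<le>n. (x j)\<^sup>2) - 4 * c * (\<Sum>j\<le>n. x j * v j) + 4 * c\<^sup>2 * q"
    by (simp add: m q_def power2_diff algebra_simps sum_subtractf sum.distrib sum_distrib_left power_mult_distrib)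
  then show "(\<Sum>j\<le>n. (nsphere_mirror n v x j)\<^sup>2) = (\<Sum>j\<le>n. (x j)\<^sup>2)"
    unfolding cq[symmetric] by (simp add: power2_eq_square)
qed

lemma nsphere_transitive:
  assumes a: "a \<in> topspace (nsphere n)" and b: "b \<in> topspace (nsphere n)"
  obtains t where "homeomorphic_map (nsphere n) (nsphere n) t" "t a = b"
proof (cases "a = b")
  case True
  then show thesis using that[of id] by simp
next
  case False
  \<comment> \<open>The reflection in the perpendicular bisector of the segment from
    \<open>a\<close> to \<open>b\<close> exchanges the two points, and it preserves the sphere
    because they have equal norm.\<close>
  define v where "v = (\<lambda>i. a i - b i)"
  have v0: "v i = 0" if "i > n" for i
    using a b that by (simp add: v_def topspace_nsphere_iff)
  with False have ex: "\<exists>j\<le>n. v j \<noteq> 0"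
    by (metis eq_iff_diff_eq_0 ext not_le v_def)
  have inv: "nsphere_mirror n v (nsphere_mirror n v x) = x" for x
    unfolding nsphere_mirror_def[of n v "nsphere_mirror n v x"] sum_nsphere_mirror[OF ex]
    by (simp add: nsphere_mirror_def)
  have cont: "continuous_map (nsphere n) (nsphere n) (nsphere_mirror n v)"
    unfolding continuous_map_nsphere_iff
  proof (intro conjI allI subsetI)
    show "continuous_map (nsphere n) euclideanreal (\<lambda>x. nsphere_mirror n v x i)" for i
      unfolding nsphere_mirror_def
      by (intro continuous_intros continuous_map_nsphere_projection)
         (use ex in \<open>auto simp: sum_nonneg_eq_0_iff\<close>)
    show "y \<in> topspace (nsphere n)" if "y \<in> nsphere_mirror n v ` topspace (nsphere n)" for y
      using that sum_nsphere_mirror(2)[OF ex]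
      by (auto simp: topspace_nsphere_iff) (simp add: nsphere_mirror_def v0)
  qed
  have "homeomorphic_map (nsphere n) (nsphere n) (nsphere_mirror n v)"
    unfolding homeomorphic_map_maps homeomorphic_maps_def using cont inv by blast
  moreover have "nsphere_mirror n v a = b"
  proof -
    define q where "q = (\<Sum>j\<le>n. (v j)\<^sup>2)"
    have q: "q \<noteq> 0" using ex unfolding q_def by (subst sum_nonneg_eq_0_iff) auto
    have "2 * (\<Sum>j\<le>n. a j * v j) = (\<Sum>j\<le>n. (a j)\<^sup>2) - (\<Sum>j\<le>n. (b j)\<^sup>2) + q"
      by (simp add: q_def v_def power2_eq_square algebra_simps sum_subtractf sum.distrib sum_distrib_left)
    then have "2 * (\<Sum>j\<le>n. a j * v j) = q"
      using a b by (simp add: topspace_nsphere_iff)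
    then show ?thesis
      unfolding nsphere_mirror_def using q by (simp add: q_def v_def)
  qed
  ultimately show thesis by (rule that)
qed

text \<open>The scaling factor \<open>c\<close> solves \<open>c\<^sup>2 * (1 - t\<^sup>2) + (2 * t - 1)\<^sup>2 = 1\<close> for \<open>t = max (x n) 0\<close>.\<close>

definition sphere_pinch :: "nat \<Rightarrow> (nat \<Rightarrow> real) \<Rightarrow> nat \<Rightarrow> real" where
  "sphere_pinch n x = (\<lambda>i. if i = n then 2 * max (x n) 0 - 1
                            else 2 * sqrt (max (x n) 0 / (1 + max (x n) 0)) * x i)"

lemma sum_split_last: fixes n :: nat shows "(\<Sum>i\<le>n. f i) = (\<Sum>i<n. f i) + (f n :: real)"
  using lessThan_Suc_atMost[of n] sum.lessThan_Suc[of f n] by simp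

lemma continuous_map_sphere_pinch: "continuous_map (nsphere n) (nsphere n) (sphere_pinch n)"
  unfolding continuous_map_nsphere_iff
proof (intro conjI allI subsetI)
  have p: "1 + max a 0 \<noteq> 0" for a :: real by linarith
  show "continuous_map (nsphere n) euclideanreal (\<lambda>x. sphere_pinch n x i)" for i
    unfolding sphere_pinch_def
    by (cases "i = n") (auto intro!: continuous_intros continuous_map_nsphere_projection simp: p)
  fix y assume "y \<in> sphere_pinch n ` topspace (nsphere n)"
  then obtain x where x: "x \<in> topspace (nsphere n)" and y: "y = sphere_pinch n x" by auto
  define t where "t = max (x n) 0"
  have t: "t \<ge> 0" by (simp add: t_def)
  have "(\<Sum>i<n. (y i)\<^sup>2) = 4 * (t / (1 + t)) * (\<Sum>i<n. (x i)\<^sup>2)"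
    unfolding sum_distrib_left using t
    by (intro sum.cong) (auto simp: y sphere_pinch_def t_def[symmetric] power_mult_distrib)
  also have "(\<Sum>i<n. (x i)\<^sup>2) = 1 - (x n)\<^sup>2"
    using x by (simp add: topspace_nsphere_iff sum_split_last)
  also have "4 * (t / (1 + t)) * (1 - (x n)\<^sup>2) = 4 * t * (1 - t)"
  proof (cases "x n \<le> 0")
    case False
    then have "t = x n" by (simp add: t_def)
    then show ?thesis using t by (simp add: field_simps power2_eq_square)
  qed (simp add: t_def)
  finally have "(\<Sum>i\<le>n. (y i)\<^sup>2) = 4 * t * (1 - t) + (2 * t - 1)\<^sup>2"
    by (simp add: sum_split_last y sphere_pinch_def t_def)
  also have "\<dots> = 1" by (simp add: power2_eq_square algebra_simps)
  finally show "y \<in> topspace (nsphere n)"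
    using x by (auto simp: topspace_nsphere_iff y sphere_pinch_def)
qed

text \<open>The pinch collapses the lower hemisphere to the south pole and stretches the upper one
  over the sphere. It never sends \<open>x\<close> to its antipode: it scales the coordinates below
  \<open>n\<close> by a nonnegative factor, so such an \<open>x\<close> would be a pole, and both
  poles are fixed. Hence it is homotopic to the identity.\<close>

lemma Brouwer_degree2_sphere_pinch: "Brouwer_degree2 n (sphere_pinch n) = 1"
proof -
  have "homotopic_with (\<lambda>_. True) (nsphere n) (nsphere n) id (sphere_pinch n)"
  proof (rule nsphere_nonantipodal_homotopic[OF continuous_map_id continuous_map_sphere_pinch])
    fix x assume x: "x \<in> topspace (nsphere n)"
    show "sphere_pinch n x \<noteq> (\<lambda>i. - id x i)"
    proof
      assume eq: "sphere_pinch n x = (\<lambda>i. - id x i)"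
      have "2 * max (x n) 0 - 1 = - x n"
        using fun_cong[OF eq, of n] by (simp add: sphere_pinch_def)
      then have xn: "x n = 1 \<or> x n = 1/3" by (auto simp: max_def split: if_splits)
      have xi: "x i = 0" if "i < n" for i
      proof -
        have "(2 * sqrt (max (x n) 0 / (1 + max (x n) 0)) + 1) * x i = 0"
          using fun_cong[OF eq, of i] that by (simp add: sphere_pinch_def algebra_simps)
        moreover have "2 * sqrt (max (x n) 0 / (1 + max (x n) 0)) \<ge> 0" by simp
        ultimately show ?thesis by (auto simp del: real_sqrt_ge_0_iff)
      qed
      have "(x n)\<^sup>2 = 1"
        using x xi by (simp add: topspace_nsphere_iff sum_split_last)
      moreover have "(1/3 :: real)\<^sup>2 \<noteq> 1" by (simp add: power2_eq_square)
      ultimately have "x n = 1" using xn by metis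
      then show False using fun_cong[OF eq, of n] by (simp add: sphere_pinch_def)
    qed
  qed
  then show ?thesis using Brouwer_degree2_homotopic by fastforce
qed

text \<open>A pinch on the upper hemisphere and a pinch after a degree 1 flip \<open>q\<close> on
  the lower one add up to degree 1 + 1.\<close>

lemma ex_Brouwer_degree2_two:
  assumes n: "n \<ge> 1"
  obtains g where "continuous_map (nsphere n) (nsphere n) g" "Brouwer_degree2 n g = 2"
proof -
  let ?S = "nsphere n"
  define r where "r = (\<lambda>k (x::nat\<Rightarrow>real) i. if i = k then - x i else x i)"
  have rc: "continuous_map ?S ?S (r k)" for k
    unfolding r_def by (rule continuous_map_nsphere_reflection)
  \<comment> \<open>An involution has degree 1 or -1, so either \<open>r n\<close> or its composite
    with \<open>r 0\<close> is a degree 1 map that flips the last coordinate;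
    \<open>n \<ge> 1\<close> keeps the two coordinates distinct.\<close>
  have "Brouwer_degree2 n (r n) * Brouwer_degree2 n (r n) = Brouwer_degree2 n (r n \<circ> r n)"
    by (rule Brouwer_degree2_compose[OF rc rc, symmetric])
  also have "r n \<circ> r n = id" by (simp add: r_def fun_eq_iff)
  finally have "Brouwer_degree2 n (r n) = 1 \<or> Brouwer_degree2 n (r n) = -1"
    by (simp only: Brouwer_degree2_id zmult_eq_1_iff) blast
  moreover have r0: "Brouwer_degree2 n (r 0) = -1"
    unfolding r_def by (rule Brouwer_degree2_reflection)
  ultimately have "\<exists>q. continuous_map ?S ?S q \<and> Brouwer_degree2 n q = 1 \<and> (\<forall>x. q x n = - x n)"
  proof (elim disjE)
    assume "Brouwer_degree2 n (r n) = 1"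
    then show ?thesis using rc by (intro exI[of _ "r n"]) (simp add: r_def)
  next
    assume *: "Brouwer_degree2 n (r n) = -1"
    have "(r 0 \<circ> r n) x n = - x n" for x
      using n by (simp add: r_def)
    then show ?thesis using * r0 continuous_map_compose[OF rc rc] Brouwer_degree2_compose[OF rc rc]
      by (intro exI[of _ "r 0 \<circ> r n"]) simp
  qed
  then obtain q where qc: "continuous_map ?S ?S q" and qd: "Brouwer_degree2 n q = 1"
    and qn: "\<And>x. q x n = - x n"
    by blast
  define b :: "nat \<Rightarrow> real" where "b = (\<lambda>i. if i = n then -1 else 0)"
  have b: "b \<in> topspace ?S"
    by (simp add: topspace_nsphere_iff b_def sum_split_last)
  have pb: "sphere_pinch n x = b" if "x n \<le> 0" for x
    using that by (auto simp: sphere_pinch_def b_def)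
  note pc = continuous_map_sphere_pinch[of n]
  note pd = Brouwer_degree2_sphere_pinch[of n]
  have pqb: "(sphere_pinch n \<circ> q) x = b" if "x n \<ge> 0" for x
    using that by (simp add: pb qn)
  show thesis
  proof (rule that)
    show "continuous_map ?S ?S (\<lambda>x. if 0 \<le> x n then sphere_pinch n x else (sphere_pinch n \<circ> q) x)"
      by (rule Brouwer_degree2_hemispheres(1)[OF n pc continuous_map_compose[OF qc pc] b pb pqb])
    have "Brouwer_degree2 n (\<lambda>x. if 0 \<le> x n then sphere_pinch n x else (sphere_pinch n \<circ> q) x)
       = Brouwer_degree2 n (sphere_pinch n) + Brouwer_degree2 n (sphere_pinch n \<circ> q)"
      by (rule Brouwer_degree2_hemispheres(2)[OF n pc continuous_map_compose[OF qc pc] b pb pqb])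
    then show "Brouwer_degree2 n (\<lambda>x. if 0 \<le> x n then sphere_pinch n x else (sphere_pinch n \<circ> q) x) = 2"
      by (simp add: Brouwer_degree2_compose[OF qc pc] pd qd)
  qed
qed

text \<open>After \<open>m\<close> iterations of a map of degree 2, a homeomorphism moves the image
  of \<open>a\<close> to \<open>b\<close>. It may reverse orientation, whence the absolute
  value.\<close>

lemma ex_based_map_degree:
  assumes n: "n \<ge> 1" and a: "a \<in> topspace (nsphere n)" and b: "b \<in> topspace (nsphere n)"
  obtains g where "continuous_map (nsphere n) (nsphere n) g" "g a = b" "\<bar>Brouwer_degree2 n g\<bar> = 2 ^ m"
proof -
  obtain g where g: "continuous_map (nsphere n) (nsphere n) g" and gd: "Brouwer_degree2 n g = 2"
    using ex_Brouwer_degree2_two[OF n] .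
  note gm = Brouwer_degree2_funpow[OF g, of m]
  have "(g ^^ m) a \<in> topspace (nsphere n)"
    using continuous_map_image_subset_topspace[OF gm(1)] a by blast
  then obtain t where t: "homeomorphic_map (nsphere n) (nsphere n) t" and tb: "t ((g ^^ m) a) = b"
    using nsphere_transitive b by metis
  have tc: "continuous_map (nsphere n) (nsphere n) t"
    using t by (rule homeomorphic_imp_continuous_map)
  show thesis
  proof (rule that)
    show "continuous_map (nsphere n) (nsphere n) (t \<circ> g ^^ m)"
      by (rule continuous_map_compose[OF gm(1) tc])
    show "\<bar>Brouwer_degree2 n (t \<circ> g ^^ m)\<bar> = 2 ^ m"
      using Brouwer_degree2_homeomorphic_map[OF t]
      by (simp add: Brouwer_degree2_compose[OF gm(1) tc] abs_mult gm gd)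
  qed (simp add: tb)
qed

section \<open>Compactness and connectedness of spheres\<close>

lemma compact_space_nsphere: "compact_space (nsphere n)"
proof -
  let ?P = "\<Pi>\<^sub>E i\<in>UNIV. {-1..1::real}"
  let ?N = "{x::nat\<Rightarrow>real. (\<Sum>i\<le>n. (x i)\<^sup>2) = 1 \<and> (\<forall>i>n. x i = 0)}"
  have N: "?N = topspace (nsphere n)"
    by (auto simp: topspace_nsphere_iff)
  have "compactin (powertop_real UNIV) ?P"
    by (simp add: compactin_PiE)
  moreover have "closedin (powertop_real UNIV) ?N"
    unfolding euclidean_product_topology closed_closedin[symmetric]
    by (intro closed_Collect_conj closed_Collect_all closed_Collect_imp closed_Collect_eq
        continuous_intros open_Collect_const) (auto intro: continuous_on_product_coordinates)
  moreover have "x i \<in> {-1..1}" if "x \<in> topspace (nsphere n)" for x i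
    using topspace_nsphere_1[OF that, of i] by (simp add: abs_square_le_1 abs_le_iff)
  then have "?N \<subseteq> ?P"
    unfolding N by auto
  ultimately have "compactin (powertop_real UNIV) ?N"
    using closed_compactin by blast
  then show ?thesis
    by (simp add: nsphere compact_space_subtopology)
qed

lemma connected_space_nsphere:
  assumes "n \<ge> 1"
  shows "connected_space (nsphere n)"
proof -
  let ?U = "topspace (nsphere n) \<inter> {x. x 0 \<ge> 0}" and ?L = "topspace (nsphere n) \<inter> {x. x 0 \<le> 0}"
  have "connectedin (nsphere n) ?U" "connectedin (nsphere n) ?L"
    using contractible_space_upper_hemisphere[of 0 n] contractible_space_lower_hemisphere[of 0 n]
    by (auto simp: connectedin_def subtopology_restrict dest: contractible_imp_connected_space)
  moreover have "(\<lambda>i. if i = 1 then 1 else 0) \<in> ?U \<inter> ?L"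
    using assms by (auto simp: topspace_nsphere_iff if_distrib[of "\<lambda>x. x\<^sup>2"] cong: if_cong)
  ultimately have "connectedin (nsphere n) (?U \<union> ?L)"
    by (intro connectedin_Un) auto
  moreover have "?U \<union> ?L = topspace (nsphere n)" by auto
  ultimately show ?thesis by (metis connectedin_topspace)
qed

section \<open>Spaces of based maps on spheres\<close>

lemma openin_sphere_space_subbasic:
  assumes "compactin (nsphere n) K" "openin X V"
  shows "openin (sphere_space n s X x0) {f \<in> topspace (sphere_space n s X x0). f ` K \<subseteq> V}"
proof -
  let ?B = "{f \<in> extensional (topspace (nsphere n)). continuous_map (nsphere n) X f \<and> f ` K \<subseteq> V}"
  have "openin (compact_open (nsphere n) X) ?B"
    unfolding compact_open_def using assms by (intro topology_generated_by_Basis) blast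
  moreover have "{f \<in> topspace (sphere_space n s X x0). f ` K \<subseteq> V} = ?B \<inter> {f. f s = x0}"
    by (auto simp: topspace_sphere_space)
  ultimately show ?thesis
    unfolding sphere_space_def openin_subtopology by blast
qed

text \<open>If \<open>F\<close> maps \<open>{t} \<times> K\<close> into an open set, the tube lemma
  thickens \<open>t\<close> to a neighbourhood with the same property; this is continuity of the
  curried map for the compact-open topology. It turns homotopies and families of loops into
  continuous curves of maps.\<close>

lemma continuous_map_into_sphere_space:
  assumes s: "s \<in> topspace (nsphere n)"
    and F: "continuous_map (prod_topology T (nsphere n)) X F"
    and Fs: "\<And>t. t \<in> topspace T \<Longrightarrow> F (t, s) = x0"
  shows "continuous_map T (sphere_space n s X x0) (\<lambda>t. restrict (\<lambda>z. F (t, z)) (topspace (nsphere n)))"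
proof -
  let ?S = "nsphere n"
  let ?p = "\<lambda>t. restrict (\<lambda>z. F (t, z)) (topspace ?S)"
  have pc: "continuous_map ?S X (?p t)" if "t \<in> topspace T" for t
  proof -
    have "continuous_map ?S (prod_topology T ?S) (\<lambda>z. (t, z))"
      using that by (intro continuous_map_pairedI) auto
    from continuous_map_compose[OF this F] show ?thesis
      by (rule continuous_map_eq) simp
  qed
  have "continuous_map T (compact_open ?S X) ?p"
    unfolding compact_open_def
  proof (rule continuous_on_generated_topo)
    show "?p ` topspace T \<subseteq> \<Union> {{f \<in> extensional (topspace ?S). continuous_map ?S X f \<and> f ` K \<subseteq> U} | K U.
          compactin ?S K \<and> openin X U}"
    proof
      fix f assume "f \<in> ?p ` topspace T"
      then have "f \<in> {f \<in> extensional (topspace ?S). continuous_map ?S X f \<and> f ` {} \<subseteq> {}}"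
        using pc by auto
      then show "f \<in> \<Union> {{f \<in> extensional (topspace ?S). continuous_map ?S X f \<and> f ` K \<subseteq> U} | K U.
          compactin ?S K \<and> openin X U}"
        by (rule UnionI[rotated], intro CollectI exI[of _ "{}"]) simp
    qed
    fix B assume "B \<in> {{f \<in> extensional (topspace ?S). continuous_map ?S X f \<and> f ` K \<subseteq> U} | K U.
          compactin ?S K \<and> openin X U}"
    then obtain K U where B: "B = {f \<in> extensional (topspace ?S). continuous_map ?S X f \<and> f ` K \<subseteq> U}"
      and K: "compactin ?S K" and U: "openin X U" by blast
    let ?W = "{w \<in> topspace (prod_topology T ?S). F w \<in> U}"
    have KS: "K \<subseteq> topspace ?S" using K by (rule compactin_subset_topspace)
    have W: "openin (prod_topology T ?S) ?W"
      by (rule openin_continuous_map_preimage[OF F U])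
    show "openin T (?p -` B \<inter> topspace T)"
    proof (subst openin_subopen, intro ballI)
      fix t assume "t \<in> ?p -` B \<inter> topspace T"
      then have t: "t \<in> topspace T" and tU: "?p t ` K \<subseteq> U" by (auto simp: B)
      have "(t, z) \<in> ?W" if "z \<in> K" for z
      proof -
        have "z \<in> topspace ?S" using that KS by blast
        moreover from this have "?p t z = F (t, z)" by simp
        then have "F (t, z) \<in> U" using tU that by (metis image_subset_iff)
        ultimately show ?thesis using t by simp
      qed
      then have tK: "{t} \<times> K \<subseteq> ?W" by blast
      obtain V V' where V: "openin T V" "openin ?S V'" "t \<in> V" "K \<subseteq> V'" "V \<times> V' \<subseteq> ?W"
        using tube_lemma_right[OF W K t tK] by (elim exE conjE) (rule that)
      have "u \<in> ?p -` B \<inter> topspace T" if u: "u \<in> V" for u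
      proof -
        have uT: "u \<in> topspace T" using openin_subset[OF V(1)] u by blast
        have "?p u z \<in> U" if z: "z \<in> K" for z
        proof -
          have "(u, z) \<in> ?W" using V u z by blast
          then show ?thesis by simp
        qed
        then have "?p u ` K \<subseteq> U" by blast
        moreover have "?p u \<in> extensional (topspace ?S)" by (rule restrict_extensional)
        ultimately show ?thesis using uT pc[OF uT] unfolding B by blast
      qed
      then show "\<exists>V. openin T V \<and> t \<in> V \<and> V \<subseteq> ?p -` B \<inter> topspace T"
        using V by (intro exI[of _ V]) blast
    qed
  qed
  then show ?thesis
    unfolding sphere_space_def continuous_map_in_subtopology
    using s Fs by auto
qed

text \<open>A based homotopy is a path in the mapping space, and a path cannot leave a clopen
  set.\<close>

lemma sphere_space_clopen_saturated:
  assumes s: "s \<in> topspace (nsphere n)"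
    and G: "openin (sphere_space n s X x0) G" "closedin (sphere_space n s X x0) G"
    and fg: "(f, g) \<in> based_homotopy n s X x0" and f: "f \<in> G"
  shows "g \<in> G"
proof -
  let ?S = "nsphere n" and ?I = "top_of_set {0..1::real}"
  obtain h where hc: "continuous_map (prod_topology ?I ?S) X h"
    and h0: "\<And>x. h (0, x) = f x" and h1: "\<And>x. h (1, x) = g x"
    and hs: "\<And>t. t \<in> {0..1} \<Longrightarrow> h (t, s) = x0"
    using fg by (auto simp: based_homotopy_def homotopic_with_def)
  have fe: "f \<in> extensional (topspace ?S)" "g \<in> extensional (topspace ?S)"
    using fg by (auto simp: based_homotopy_def topspace_sphere_space)
  let ?p = "\<lambda>t. restrict (\<lambda>z. h (t, z)) (topspace ?S)"
  have "continuous_map ?I (sphere_space n s X x0) ?p"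
    by (rule continuous_map_into_sphere_space[OF s hc]) (simp add: hs)
  then have "connectedin (sphere_space n s X x0) (?p ` {0..1})"
    by (rule connectedin_continuous_map_image) (simp add: connectedin_subtopology)
  then have "?p ` {0..1} \<subseteq> G \<or> disjnt (?p ` {0..1}) G"
    by (rule connectedin_clopen_cases) (use G in auto)
  moreover have "?p 0 = f" "?p 1 = g"
    using fe by (auto simp: h0 h1 extensional_restrict)
  then have "f \<in> ?p ` {0..1}" "g \<in> ?p ` {0..1}"
    by (intro rev_image_eqI[of 0] rev_image_eqI[of 1]; simp)+
  ultimately show ?thesis using f by (auto simp: disjnt_def)
qed

text \<open>Finitely many subbasic conditions suffice: finitely many balls cover the compact image
  of \<open>\<phi> \<circ> f0\<close>, and on the part of the sphere that \<open>f0\<close> sends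
  near the centre of a ball, \<open>f\<close> is confined to a larger concentric ball.\<close>

lemma sphere_space_uniform_nbhd:
  fixes \<phi> :: "'a \<Rightarrow> 'b::metric_space"
  assumes \<phi>: "continuous_map X euclidean \<phi>" and f0: "f0 \<in> topspace (sphere_space n s X x0)" and e: "e > 0"
  obtains N where "openin (sphere_space n s X x0) N" "f0 \<in> N"
    "\<And>f z. f \<in> N \<Longrightarrow> z \<in> topspace (nsphere n) \<Longrightarrow> dist (\<phi> (f z)) (\<phi> (f0 z)) < e"
proof -
  let ?S = "nsphere n" and ?SS = "sphere_space n s X x0"
  let ?h = "\<lambda>z. \<phi> (f0 z)"
  have hc: "continuous_map ?S euclidean ?h"
    using f0 continuous_map_compose[OF _ \<phi>, of ?S f0] by (simp add: topspace_sphere_space o_def)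
  have "compactin euclidean (?h ` topspace ?S)"
    by (rule image_compactin[OF _ hc]) (use compact_space_nsphere in \<open>simp add: compact_space_def\<close>)
  then have "compact (?h ` topspace ?S)" by simp
  then obtain D where D: "finite D" "?h ` topspace ?S \<subseteq> (\<Union>d\<in>D. ball d (e/4))"
    using compactE_image[of "?h ` topspace ?S" "?h ` topspace ?S" "\<lambda>d. ball d (e/4)"] e
    by (metis (no_types, lifting) UN_I centre_in_ball divide_pos_pos open_ball subsetI zero_less_numeral)
  \<comment> \<open>The radius \<open>e/4\<close> catches the values of \<open>f0\<close>, the
    radius \<open>e/2\<close> receives those of nearby maps, and
    \<open>e/4 + e/2 < e\<close>.\<close>
  define K where "K d = {z \<in> topspace ?S. ?h z \<in> cball d (e/4)}" for d
  define V where "V d = {x \<in> topspace X. \<phi> x \<in> ball d (e/2)}" for d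
  have "closedin ?S (K d)" for d
    unfolding K_def by (rule closedin_continuous_map_preimage[OF hc]) simp
  then have K: "compactin ?S (K d)" for d
    using compact_space_nsphere by (simp add: closedin_compact_space)
  have V: "openin X (V d)" for d
    unfolding V_def by (rule openin_continuous_map_preimage[OF \<phi>]) simp
  let ?N = "topspace ?SS \<inter> (\<Inter>d\<in>D. {f \<in> topspace ?SS. f ` K d \<subseteq> V d})"
  show thesis
  proof (rule that)
    show "openin ?SS ?N"
      using D(1) openin_sphere_space_subbasic[OF K V] by (intro openin_Int_Inter) auto
    have "f0 z \<in> topspace X" if "z \<in> topspace ?S" for z
      using f0 that by (auto simp: topspace_sphere_space continuous_map_def)
    then show "f0 \<in> ?N"
      using f0 e by (auto simp: K_def V_def)
    fix f z assume f: "f \<in> ?N" and z: "z \<in> topspace ?S"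
    then obtain d where d: "d \<in> D" "dist d (?h z) < e/4" using D by auto
    have "z \<in> K d" using z d(2) by (simp add: K_def)
    then have "f z \<in> V d" using f d(1) by blast
    then have "dist d (\<phi> (f z)) < e/2" by (simp add: V_def)
    with d(2) show "dist (\<phi> (f z)) (?h z) < e"
      using e dist_triangle3[of "\<phi> (f z)" "?h z" d] by linarith
  qed
qed

text \<open>By induction on how the open set is generated: a subbasic set given by a nonempty
  compact set contains the constant map only if its open set \<open>U\<close> contains the
  basepoint, and then \<open>U\<close> itself serves as \<open>V\<close>.\<close>

lemma sphere_space_const_nbhd:
  assumes O: "openin (sphere_space n s X x0) N"
    and c: "restrict (\<lambda>_. x0) (topspace (nsphere n)) \<in> N"
  obtains V where "openin X V" "x0 \<in> V"
    "\<And>f. f \<in> topspace (sphere_space n s X x0) \<Longrightarrow> f ` topspace (nsphere n) \<subseteq> V \<Longrightarrow> f \<in> N"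
proof -
  let ?S = "nsphere n" and ?SS = "sphere_space n s X x0"
  let ?c = "restrict (\<lambda>_. x0) (topspace ?S)"
  have "?c \<in> topspace ?SS" using O c openin_subset by blast
  then have "?c ` topspace ?S \<subseteq> topspace X"
    by (intro continuous_map_image_subset_topspace) (simp add: topspace_sphere_space)
  then have x0: "x0 \<in> topspace X"
    using in_topspace_nsphere[of n] by auto
  obtain N' where N': "openin (compact_open ?S X) N'" and NN: "N = N' \<inter> {f. f s = x0}"
    using O by (auto simp: sphere_space_def openin_subtopology)
  from openin_topology_generated_by[OF N'[unfolded compact_open_def]]
  have "?c \<in> N' \<longrightarrow> (\<exists>V. openin X V \<and> x0 \<in> V \<and> (\<forall>f \<in> topspace ?SS. f ` topspace ?S \<subseteq> V \<longrightarrow> f \<in> N'))"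
  proof induction
    case (Int a b)
    show ?case
    proof
      assume "?c \<in> a \<inter> b"
      then obtain V V' where "openin X V" "x0 \<in> V" "\<forall>f \<in> topspace ?SS. f ` topspace ?S \<subseteq> V \<longrightarrow> f \<in> a"
          "openin X V'" "x0 \<in> V'" "\<forall>f \<in> topspace ?SS. f ` topspace ?S \<subseteq> V' \<longrightarrow> f \<in> b"
        using Int by blast
      then show "\<exists>V. openin X V \<and> x0 \<in> V \<and> (\<forall>f \<in> topspace ?SS. f ` topspace ?S \<subseteq> V \<longrightarrow> f \<in> a \<inter> b)"
        by (intro exI[of _ "V \<inter> V'"]) auto
    qed
  next
    case (UN K)
    show ?case
    proof
      assume "?c \<in> \<Union>K"
      then obtain k where k: "k \<in> K" "?c \<in> k" by blast
      with UN.IH[OF k(1)] obtain V where "openin X V" "x0 \<in> V"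
          and V: "\<forall>f \<in> topspace ?SS. f ` topspace ?S \<subseteq> V \<longrightarrow> f \<in> k"
        by (elim impE exE conjE)
      moreover have "\<forall>f \<in> topspace ?SS. f ` topspace ?S \<subseteq> V \<longrightarrow> f \<in> \<Union>K"
        using V k(1) by (intro ballI impI UnionI[OF k(1)]) (simp only:)
      ultimately show "\<exists>V. openin X V \<and> x0 \<in> V \<and> (\<forall>f \<in> topspace ?SS. f ` topspace ?S \<subseteq> V \<longrightarrow> f \<in> \<Union>K)"
        by (intro exI[of _ V] conjI)
    qed
  next
    case (Basis B)
    then obtain K U where B: "B = {f \<in> extensional (topspace ?S). continuous_map ?S X f \<and> f ` K \<subseteq> U}"
      and K: "compactin ?S K" and U: "openin X U" by blast
    have KS: "K \<subseteq> topspace ?S" using K by (rule compactin_subset_topspace)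
    show ?case
    proof
      assume "?c \<in> B"
      show "\<exists>V. openin X V \<and> x0 \<in> V \<and> (\<forall>f \<in> topspace ?SS. f ` topspace ?S \<subseteq> V \<longrightarrow> f \<in> B)"
      proof (cases "K = {}")
        \<comment> \<open>For empty \<open>K\<close> the subbasic set consists of all maps and
          \<open>U\<close> may miss \<open>x0\<close>, so the whole space serves as
          \<open>V\<close>.\<close>
        case True
        then show ?thesis
          using x0 by (intro exI[of _ "topspace X"]) (auto simp: B topspace_sphere_space)
      next
        case False
        with \<open>?c \<in> B\<close> KS have "x0 \<in> U" by (auto simp: B)
        then show ?thesis
          using U KS by (intro exI[of _ U]) (auto simp: B topspace_sphere_space)
      qed
    qed
  qed simp
  then obtain V where "openin X V" "x0 \<in> V" "\<forall>f \<in> topspace ?SS. f ` topspace ?S \<subseteq> V \<longrightarrow> f \<in> N'"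
    using c NN by blast
  then show thesis
    using NN by (intro that[of V]) (auto simp: topspace_sphere_space)
qed

text \<open>If \<open>g x\<close> were the antipode of \<open>f x\<close>, each of the
  \<open>n + 1\<close> coordinates of \<open>f x\<close> would have square below
  \<open>1 / (n + 1)\<close>, against norm 1. So the two maps are never antipodal, hence
  homotopic.\<close>

lemma Brouwer_degree2_close:
  assumes f: "continuous_map (nsphere n) (nsphere n) f" and g: "continuous_map (nsphere n) (nsphere n) g"
    and close: "\<And>x i. x \<in> topspace (nsphere n) \<Longrightarrow> i \<le> n \<Longrightarrow> \<bar>f x i - g x i\<bar> < 1 / (real n + 1)"
  shows "Brouwer_degree2 n f = Brouwer_degree2 n g"
proof (rule Brouwer_degree2_homotopic, rule nsphere_nonantipodal_homotopic[OF f g])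
  fix x assume x: "x \<in> topspace (nsphere n)"
  show "g x \<noteq> (\<lambda>i. - f x i)"
  proof
    assume eq: "g x = (\<lambda>i. - f x i)"
    have "(f x i)\<^sup>2 < 1 / (real n + 1)" if i: "i \<le> n" for i
    proof -
      have "\<bar>f x i\<bar> < 1 / (real n + 1)"
        using close[OF x i] by (simp add: eq)
      moreover have "\<bar>f x i\<bar> \<le> 1"
        using calculation by (rule order.trans[OF less_imp_le]) simp
      ultimately show ?thesis
        using mult_mono[of "\<bar>f x i\<bar>" 1 "\<bar>f x i\<bar>" "\<bar>f x i\<bar>"] by (simp add: power2_eq_square abs_mult_self_eq)
    qed
    then have "(\<Sum>i\<le>n. (f x i)\<^sup>2) < (\<Sum>i\<le>n. 1 / (real n + 1))"
      by (intro sum_strict_mono) auto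
    moreover have "(\<Sum>i\<le>n. (f x i)\<^sup>2) = 1"
      using f x by (auto simp: continuous_map_nsphere_iff topspace_nsphere_iff image_subset_iff)
    ultimately show False by (simp add: field_simps)
  qed
qed

section \<open>Maps on one-point unions\<close>

abbreviation wedge_inl :: "'a topology \<Rightarrow> 'a \<Rightarrow> 'b topology \<Rightarrow> 'b \<Rightarrow> 'a \<Rightarrow> ('a + 'b) set" where
  "wedge_inl X x0 Y y0 a \<equiv> wedge_rel X x0 Y y0 `` {Inl a}"

abbreviation wedge_inr :: "'a topology \<Rightarrow> 'a \<Rightarrow> 'b topology \<Rightarrow> 'b \<Rightarrow> 'b \<Rightarrow> ('a + 'b) set" where
  "wedge_inr X x0 Y y0 b \<equiv> wedge_rel X x0 Y y0 `` {Inr b}"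

text \<open>Only the basepoint class has two representatives, so the choice is immaterial as soon as
  \<open>f\<close> and \<open>g\<close> agree at the basepoints.\<close>

definition wedge_case :: "('a \<Rightarrow> 'c) \<Rightarrow> ('b \<Rightarrow> 'c) \<Rightarrow> ('a + 'b) set \<Rightarrow> 'c" where
  "wedge_case f g p = case_sum f g (SOME q. q \<in> p)"

lemma wedge_case:
  assumes "f x0 = g y0"
  shows "a \<in> topspace X \<Longrightarrow> wedge_case f g (wedge_inl X x0 Y y0 a) = f a"
    and "b \<in> topspace Y \<Longrightarrow> wedge_case f g (wedge_inr X x0 Y y0 b) = g b"
proof -
  have *: "wedge_case f g (wedge_rel X x0 Y y0 `` {q}) = case_sum f g q"
    if "q \<in> topspace (disjoint_union X Y)" for q
  proof -
    have "q \<in> wedge_rel X x0 Y y0 `` {q}"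
      using that by (simp add: wedge_rel_def)
    moreover have "case_sum f g q' = case_sum f g q" if "q' \<in> wedge_rel X x0 Y y0 `` {q}" for q'
      using that assms by (auto simp: wedge_rel_def)
    ultimately show ?thesis
      unfolding wedge_case_def by (metis someI)
  qed
  show "a \<in> topspace X \<Longrightarrow> wedge_case f g (wedge_inl X x0 Y y0 a) = f a"
    using *[of "Inl a"] by auto
  show "b \<in> topspace Y \<Longrightarrow> wedge_case f g (wedge_inr X x0 Y y0 b) = g b"
    using *[of "Inr b"] by auto
qed

lemma continuous_map_wedge_inl: "continuous_map X (wedge X x0 Y y0) (wedge_inl X x0 Y y0)"
proof -
  have "continuous_map X (disjoint_union X Y) Inl"
    unfolding continuous_map_def
  proof (intro conjI allI impI)
    fix U assume U: "openin (disjoint_union X Y) U"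
    have "{x \<in> topspace X. Inl x \<in> U} = Inl -` U"
      using openin_subset[OF U] by auto
    then show "openin X {x \<in> topspace X. Inl x \<in> U}"
      using U by (simp add: openin_disjoint_union_iff)
  qed auto
  from continuous_map_compose[OF this quotient_imp_continuous_map[OF quotient_map_quotient_topology]]
  show ?thesis by (simp add: wedge_def o_def)
qed

lemma continuous_map_wedge_inr: "continuous_map Y (wedge X x0 Y y0) (wedge_inr X x0 Y y0)"
proof -
  have "continuous_map Y (disjoint_union X Y) Inr"
    unfolding continuous_map_def
  proof (intro conjI allI impI)
    fix U assume U: "openin (disjoint_union X Y) U"
    have "{x \<in> topspace Y. Inr x \<in> U} = Inr -` U"
      using openin_subset[OF U] by auto
    then show "openin Y {x \<in> topspace Y. Inr x \<in> U}"
      using U by (simp add: openin_disjoint_union_iff)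
  qed auto
  from continuous_map_compose[OF this quotient_imp_continuous_map[OF quotient_map_quotient_topology]]
  show ?thesis by (simp add: wedge_def o_def)
qed

lemma topspace_wedge_cases:
  assumes "p \<in> topspace (wedge X x0 Y y0)"
  obtains a where "a \<in> topspace X" "p = wedge_inl X x0 Y y0 a"
    | b where "b \<in> topspace Y" "p = wedge_inr X x0 Y y0 b"
  using assms unfolding wedge_def topspace_quotient_topology topspace_disjoint_union
  by (elim quotientE) auto

lemma continuous_map_wedge_case:
  assumes f: "continuous_map X Z f" and g: "continuous_map Y Z g" and fg: "f x0 = g y0"
  shows "continuous_map (wedge X x0 Y y0) Z (wedge_case f g)"
proof -
  let ?D = "disjoint_union X Y"
  have "continuous_map ?D Z (case_sum f g)"
    unfolding continuous_map_def
  proof (intro conjI allI impI)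
    show "case_sum f g \<in> topspace ?D \<rightarrow> topspace Z"
      using f g by (auto simp: continuous_map_def)
    fix U assume U: "openin Z U"
    let ?V = "{q \<in> topspace ?D. case_sum f g q \<in> U}"
    have "Inl -` ?V = {x \<in> topspace X. f x \<in> U}" "Inr -` ?V = {x \<in> topspace Y. g x \<in> U}"
      by auto
    then show "openin ?D ?V"
      using f g U by (auto simp: openin_disjoint_union_iff continuous_map_def)
  qed
  then have "continuous_map ?D Z (wedge_case f g \<circ> (\<lambda>q. wedge_rel X x0 Y y0 `` {q}))"
  proof (rule continuous_map_eq)
    fix q assume "q \<in> topspace ?D"
    then show "case_sum f g q = (wedge_case f g \<circ> (\<lambda>q. wedge_rel X x0 Y y0 `` {q})) q"
      by (auto simp: wedge_case[of f x0 g y0, OF fg])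
  qed
  then show ?thesis
    unfolding wedge_def
    using continuous_compose_quotient_map_eq[OF quotient_map_quotient_topology] by blast
qed

text \<open>The sets \<open>u = \<rho> j * v\<close> are the circles of \<open>space_A\<close>, respectively the spheres of the
  earring, that meet in the zero set of \<open>v\<close> and are isolated from each other elsewhere.\<close>

lemma continuous_map_isolated_piece:
  fixes u v :: "'a \<Rightarrow> real" and \<rho> :: "nat \<Rightarrow> real"
  assumes u: "continuous_map Y euclideanreal u" and v: "continuous_map Y euclideanreal v"
    and h: "continuous_map (subtopology Y {y. u y = \<rho> m * v y}) Z h" and z: "z \<in> topspace Z"
    and m: "m \<ge> 1" and dec: "\<And>i j. 1 \<le> i \<Longrightarrow> i < j \<Longrightarrow> \<rho> j < \<rho> i"
    and v0: "\<And>y. y \<in> topspace Y \<Longrightarrow> v y \<ge> 0"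
    and cover: "\<And>y. y \<in> topspace Y \<Longrightarrow> (\<exists>j\<ge>1. u y = \<rho> j * v y) \<or> (\<forall>j\<ge>1. u y \<le> \<rho> j * v y)"
    and hz: "\<And>y. y \<in> topspace Y \<Longrightarrow> u y = 0 \<Longrightarrow> v y = 0 \<Longrightarrow> h y = z"
  shows "continuous_map Y Z (\<lambda>y. if u y = \<rho> m * v y then h y else z)"
proof -
  \<comment> \<open>Where \<open>v y > 0\<close>, the ratio of \<open>u y\<close> to
    \<open>v y\<close> is some \<open>\<rho> j\<close> or lies below all of them.
    \<open>T False\<close> collects the ratios up to the next value and from the previous value on;
    \<open>m \<ge> 2\<close> excludes index 0, for which \<open>\<rho>\<close> is unconstrained. The
    two closed sets meet only where \<open>v\<close> vanishes.\<close>
  define T where "T b = (if b then {y \<in> topspace Y. u y = \<rho> m * v y}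
     else {y \<in> topspace Y. u y \<le> \<rho> (Suc m) * v y \<or> m \<ge> 2 \<and> \<rho> (m - 1) * v y \<le> u y})" for b
  have cl: "closedin Y {y \<in> topspace Y. w y \<in> {0..}}" if "continuous_map Y euclideanreal w" for w
    by (rule closedin_continuous_map_preimage[OF that]) simp
  show ?thesis
  proof (rule pasting_lemma_closed[where I = UNIV and T = T and f = "\<lambda>b. if b then h else (\<lambda>_. z)"])
    fix b
    show "closedin Y (T b)"
    proof (cases b)
      case True
      have "T b = {y \<in> topspace Y. u y - \<rho> m * v y \<in> {0}}" using True by (auto simp: T_def)
      moreover have "closedin Y \<dots>"
        by (rule closedin_continuous_map_preimage[of _ euclideanreal], intro continuous_intros)
           (use u v in simp_all)
      ultimately show ?thesis by simp
    next
      case False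
      have "T b = {y \<in> topspace Y. \<rho> (Suc m) * v y - u y \<in> {0..}} \<union>
          (if m \<ge> 2 then {y \<in> topspace Y. u y - \<rho> (m - 1) * v y \<in> {0..}} else {})"
        using False by (auto simp: T_def)
      moreover have "closedin Y \<dots>"
      proof (rule closedin_Un)
        show "closedin Y {y \<in> topspace Y. \<rho> (Suc m) * v y - u y \<in> {0..}}"
          using u v by (intro cl continuous_intros) auto
        have "closedin Y {y \<in> topspace Y. u y - \<rho> (m - 1) * v y \<in> {0..}}"
          using u v by (intro cl continuous_intros) auto
        then show "closedin Y (if m \<ge> 2 then {y \<in> topspace Y. u y - \<rho> (m - 1) * v y \<in> {0..}} else {})"
          by (cases "m \<ge> 2") (simp_all only: if_True if_False closedin_empty)
      qed
      ultimately show ?thesis by simp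
    qed
    show "continuous_map (subtopology Y (T b)) Z (if b then h else (\<lambda>_. z))"
    proof (cases b)
      case True
      have "T b = topspace Y \<inter> {y. u y = \<rho> m * v y}"
        using True by (auto simp: T_def)
      then have "subtopology Y (T b) = subtopology Y {y. u y = \<rho> m * v y}"
        by (simp only: subtopology_restrict)
      then show ?thesis using h True by simp
    qed (use z in simp)
  next
    have *: "h y = z" if y: "y \<in> T True" "y \<in> T False" for y
    proof -
      have yY: "y \<in> topspace Y" and eq: "u y = \<rho> m * v y" using y by (auto simp: T_def)
      have "\<rho> m * v y \<le> \<rho> (Suc m) * v y \<or> m \<ge> 2 \<and> \<rho> (m - 1) * v y \<le> \<rho> m * v y"
        using y eq by (auto simp: T_def)
      moreover have "\<rho> (Suc m) < \<rho> m" using m dec[of m "Suc m"] by simp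
      moreover have "m \<ge> 2 \<Longrightarrow> \<rho> m < \<rho> (m - 1)" using dec[of "m - 1" m] by simp
      ultimately have "v y \<le> 0" by (smt (verit) mult_less_cancel_right)
      then have "v y = 0" using v0[OF yY] by simp
      then show ?thesis using hz[OF yY] eq by simp
    qed
    fix b c y assume "y \<in> topspace Y \<inter> T b \<inter> T c"
    then show "(if b then h else (\<lambda>_. z)) y = (if c then h else (\<lambda>_. z)) y"
      using *[of y] by (cases b; cases c) auto
  next
    fix y assume y: "y \<in> topspace Y"
    have "y \<in> T False" if ne: "u y \<noteq> \<rho> m * v y"
    proof -
      consider j where "j \<ge> 1" "u y = \<rho> j * v y" | "u y \<le> \<rho> (Suc m) * v y"
        using cover[OF y] by auto
      then show ?thesis
      proof cases
        case 1
        then have "j \<noteq> m" using ne by auto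
        have mono: "\<rho> k * v y \<le> \<rho> i * v y" if "1 \<le> i" "i \<le> k" for i k
          using that dec[of i k] v0[OF y] by (cases "i = k") (auto intro!: mult_right_mono)
        show ?thesis
        proof (cases "j < m")
          case True
          then show ?thesis using 1 m y mono[of j "m - 1"] by (auto simp: T_def)
        next
          case False
          then show ?thesis using 1 \<open>j \<noteq> m\<close> m y mono[of "Suc m" j] by (auto simp: T_def)
        qed
      qed (use y in \<open>simp add: T_def\<close>)
    qed
    then show "\<exists>b. b \<in> UNIV \<and> y \<in> T b \<and> (if u y = \<rho> m * v y then h y else z) = (if b then h else (\<lambda>_. z)) y"
      using y by (intro exI[of _ "u y = \<rho> m * v y"]) (auto simp: T_def)
  qed auto
qed

section \<open>Coordinates on the spaces\<close>

definition circle_radius :: "nat \<Rightarrow> real" where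
  "circle_radius m = (real m + 1) / (2 * real m)"

text \<open>The condition is the equation of the \<open>m\<close>-th circle. The affine map carries
  this circle onto the unit circle and the origin to 1, so up to coordinates this is the retraction
  of \<open>A\<close> onto the circle that collapses everything else.\<close>

definition circle_coord :: "nat \<Rightarrow> real \<times> real \<Rightarrow> complex" where
  "circle_coord m p = (if (fst p)\<^sup>2 + (snd p)\<^sup>2 = 2 * circle_radius m * fst p
     then 1 - Complex (fst p) (snd p) / of_real (circle_radius m) else 1)"

text \<open>Inverse of the affine map in \<open>circle_coord\<close>, with a free radius: radii up
  to 1/2 sweep out the disk, and radius 0 gives the constant at the origin.\<close>

definition circle_point :: "real \<Rightarrow> complex \<Rightarrow> real \<times> real" where
  "circle_point R z = (R * (1 - Re z), - R * Im z)"

text \<open>The earring spheres have their centres on the positive first axis; rescaling one of them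
  to the unit sphere moves the origin to this point.\<close>

definition nsphere_base :: "nat \<Rightarrow> real" where
  "nsphere_base = (\<lambda>i. if i = 0 then -1 else 0)"

definition earring_coord :: "nat \<Rightarrow> nat \<Rightarrow> (nat \<Rightarrow> real) \<Rightarrow> nat \<Rightarrow> real" where
  "earring_coord n k x = (if (\<Sum>i\<le>n. (x i)\<^sup>2) = 2 / real k * x 0
     then (\<lambda>i. real k * x i + nsphere_base i) else nsphere_base)"

definition earring_point :: "real \<Rightarrow> (nat \<Rightarrow> real) \<Rightarrow> nat \<Rightarrow> real" where
  "earring_point t w = (\<lambda>i. t * (w i - nsphere_base i))"

lemma circle_radius_gt_half: "m \<ge> 1 \<Longrightarrow> circle_radius m > 1/2"
  by (simp add: circle_radius_def field_simps)

lemma circle_radius_strict_antimono: "1 \<le> i \<Longrightarrow> i < j \<Longrightarrow> circle_radius j < circle_radius i"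
  by (simp add: circle_radius_def field_simps)

lemma circle_radius_tendsto: "circle_radius \<longlonglongrightarrow> 1/2"
proof (rule Lim_transform_eventually)
  have "(\<lambda>m. 1/2 + inverse (real m) / 2) \<longlonglongrightarrow> 1/2 + 0 / 2"
    by (intro tendsto_add tendsto_const tendsto_divide lim_inverse_n) simp
  then show "(\<lambda>m. 1/2 + inverse (real m) / 2) \<longlonglongrightarrow> 1/2" by simp
  show "\<forall>\<^sub>F m in sequentially. 1/2 + inverse (real m) / 2 = circle_radius m"
    using eventually_gt_at_top[of 0]
    by eventually_elim (simp add: circle_radius_def field_simps)
qed

lemma topspace_space_A:
  "p \<in> topspace space_A \<longleftrightarrow>
     (fst p)\<^sup>2 + (snd p)\<^sup>2 \<le> fst p \<or> (\<exists>m\<ge>1. (fst p)\<^sup>2 + (snd p)\<^sup>2 = 2 * circle_radius m * fst p)"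
proof -
  obtain a b where p: "p = (a, b)" by (cases p)
  have "(1/2 - a)\<^sup>2 + b\<^sup>2 = (1/2)\<^sup>2 + (a\<^sup>2 + b\<^sup>2 - a)"
    by (simp add: power2_diff)
  then have "sqrt ((1/2 - a)\<^sup>2 + b\<^sup>2) \<le> sqrt ((1/2)\<^sup>2) \<longleftrightarrow> a\<^sup>2 + b\<^sup>2 \<le> a"
    unfolding real_sqrt_le_iff by (intro iffI; linarith)
  then have D: "p \<in> cball (1/2, 0) (1/2) \<longleftrightarrow> a\<^sup>2 + b\<^sup>2 \<le> a"
    by (simp add: p dist_Pair_Pair dist_real_def)
  have C: "p \<in> sphere (R, 0) R \<longleftrightarrow> a\<^sup>2 + b\<^sup>2 = 2 * R * a" if "R > 0" for R
  proof -
    have "sqrt ((R - a)\<^sup>2 + b\<^sup>2) = sqrt (R\<^sup>2) \<longleftrightarrow> a\<^sup>2 + b\<^sup>2 = 2 * R * a"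
      unfolding real_sqrt_eq_iff by (auto simp: power2_diff)
    then show ?thesis using that by (simp add: p dist_Pair_Pair dist_real_def)
  qed
  have "p \<in> topspace space_A \<longleftrightarrow> p \<in> cball (1/2, 0) (1/2) \<or> (\<exists>m\<ge>1. p \<in> sphere (circle_radius m, 0) (circle_radius m))"
    by (auto simp: space_A_def circle_radius_def)
  also have "\<dots> \<longleftrightarrow> a\<^sup>2 + b\<^sup>2 \<le> a \<or> (\<exists>m\<ge>1. a\<^sup>2 + b\<^sup>2 = 2 * circle_radius m * a)"
    unfolding D using C circle_radius_gt_half by (metis half_gt_zero_iff less_trans zero_less_one)
  finally show ?thesis by (simp add: p)
qed

lemma space_A_fst_nonneg:
  assumes "p \<in> topspace space_A"
  shows "fst p \<ge> 0"
proof -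
  have "(fst p)\<^sup>2 + (snd p)\<^sup>2 \<ge> 0" by simp
  moreover have "0 \<le> fst p" if "0 \<le> 2 * circle_radius m * fst p" "m \<ge> 1" for m
    using that circle_radius_gt_half[of m] by (simp add: zero_le_mult_iff)
  ultimately show ?thesis using assms unfolding topspace_space_A by (metis order_trans)
qed

lemma continuous_map_space_A_iff:
  "continuous_map space_A euclidean f \<longleftrightarrow> continuous_on (topspace space_A) f"
  unfolding space_A_def by simp

text \<open>All diameters exceed 1, so on the disk
  \<open>u \<le> v \<le> 2 * circle_radius j * v\<close> for every \<open>j\<close>. Hence each
  single circle is isolated from the disk and the other circles away from the origin, although the
  circles accumulate at the boundary of the disk.\<close>

lemma continuous_map_circle_coord:
  assumes m: "m \<ge> 1"
  shows "continuous_map space_A euclidean (circle_coord m)"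
proof -
  have R: "circle_radius m \<noteq> 0" using circle_radius_gt_half[OF m] by simp
  have "continuous_map space_A euclidean
    (\<lambda>p. if (fst p)\<^sup>2 + (snd p)\<^sup>2 = (2 * circle_radius m) * fst p
         then 1 - Complex (fst p) (snd p) / of_real (circle_radius m) else 1)"
  proof (rule continuous_map_isolated_piece[where \<rho> = "\<lambda>m. 2 * circle_radius m"])
    show "continuous_map space_A euclideanreal (\<lambda>p. (fst p)\<^sup>2 + (snd p)\<^sup>2)" "continuous_map space_A euclideanreal fst"
      unfolding continuous_map_space_A_iff by (intro continuous_intros)+
    have "continuous_map space_A euclidean (\<lambda>p. 1 - Complex (fst p) (snd p) / of_real (circle_radius m))"
      unfolding continuous_map_space_A_iff Complex_eq using R by (intro continuous_intros) auto
    then show "continuous_map (subtopology space_A {y. (fst y)\<^sup>2 + (snd y)\<^sup>2 = 2 * circle_radius m * fst y})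
        euclidean (\<lambda>p. 1 - Complex (fst p) (snd p) / of_real (circle_radius m))"
      by (rule continuous_map_from_subtopology)
    show "(\<exists>j\<ge>1. (fst y)\<^sup>2 + (snd y)\<^sup>2 = 2 * circle_radius j * fst y) \<or>
          (\<forall>j\<ge>1. (fst y)\<^sup>2 + (snd y)\<^sup>2 \<le> 2 * circle_radius j * fst y)"
      if y: "y \<in> topspace space_A" for y
    proof -
      have "fst y \<le> 2 * circle_radius j * fst y" if "j \<ge> 1" for j
        using circle_radius_gt_half[OF that] space_A_fst_nonneg[OF y]
          mult_right_mono[of 1 "2 * circle_radius j" "fst y"] by simp
      then show ?thesis using y unfolding topspace_space_A by (meson order_trans)
    qed
    show "1 - Complex (fst y) (snd y) / of_real (circle_radius m) = 1"
      if "(fst y)\<^sup>2 + (snd y)\<^sup>2 = 0" for y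
      using that by (simp add: complex_eq_iff sum_power2_eq_zero_iff)
  qed (use m circle_radius_strict_antimono space_A_fst_nonneg in auto)
  then show ?thesis unfolding circle_coord_def by simp
qed

lemma norm_circle_coord:
  assumes "m \<ge> 1"
  shows "norm (circle_coord m p) = 1"
proof -
  define R where "R = circle_radius m"
  have R: "R > 0" using circle_radius_gt_half[OF assms] by (simp add: R_def)
  have "norm (1 - Complex a b / of_real R) = 1" if "a\<^sup>2 + b\<^sup>2 = 2 * R * a" for a b
  proof -
    have "(norm (1 - Complex a b / of_real R))\<^sup>2 = (1 - a / R)\<^sup>2 + (b / R)\<^sup>2"
      by (simp add: cmod_power2)
    also have "\<dots> = 1 + (a\<^sup>2 + b\<^sup>2 - 2 * R * a) / R\<^sup>2"
      using R by (simp add: power2_eq_square field_simps)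
    finally have "(norm (1 - Complex a b / of_real R))\<^sup>2 = 1\<^sup>2" using that by simp
    then show ?thesis by (rule power2_eq_imp_eq) simp_all
  qed
  then show ?thesis by (simp add: circle_coord_def R_def)
qed

text \<open>Converts an angle on the \<open>m\<close>-th circle into a horizontal position, a
  quantity that makes sense on \<open>A\<close> independently of \<open>m\<close>.\<close>

lemma fst_circle_coord:
  assumes "m \<ge> 1" "circle_coord m p \<noteq> 1"
  shows "fst p = circle_radius m * (1 - Re (circle_coord m p))"
  using assms circle_radius_gt_half[of m] by (auto simp: circle_coord_def split: if_splits)

lemma circle_point_eq:
  assumes "norm z = 1"
  shows "(R * (1 - Re z))\<^sup>2 + (- R * Im z)\<^sup>2 = 2 * R * (R * (1 - Re z))"
proof -
  have "(Re z)\<^sup>2 + (Im z)\<^sup>2 = 1" using assms by (metis cmod_power2 one_power2)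
  moreover have "(R * (1 - Re z))\<^sup>2 + (- R * Im z)\<^sup>2 = R\<^sup>2 * (1 - 2 * Re z + ((Re z)\<^sup>2 + (Im z)\<^sup>2))"
    by (simp add: power2_eq_square algebra_simps)
  ultimately show ?thesis by (simp add: power2_eq_square algebra_simps)
qed

lemma circle_coord_circle_point:
  assumes "m \<ge> 1" "norm z = 1"
  shows "circle_coord m (circle_point (circle_radius m) z) = z"
proof -
  have R: "circle_radius m \<noteq> 0" using circle_radius_gt_half[OF assms(1)] by simp
  note circle_point_eq[OF assms(2), of "circle_radius m"]
  then show ?thesis
    using R by (simp add: circle_coord_def circle_point_def complex_eq_iff)
qed

text \<open>One family serves both purposes of the circles: the radii from 0 to 1/2 give the
  nullhomotopy through the disk, and the radii of the circles of \<open>A\<close> converge to 1/2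
  from above.\<close>

lemma continuous_map_circle_point:
  "continuous_map (prod_topology (top_of_set ({0..1/2} \<union> circle_radius ` {1..})) (top_of_set (sphere 0 1)))
     space_A (\<lambda>(R, z). circle_point R z)"
proof -
  let ?T = "{0..1/2} \<union> circle_radius ` {1..}"
  have "circle_point R z \<in> topspace space_A" if "R \<in> ?T" "norm z = 1" for R z
  proof -
    note eq = circle_point_eq[OF that(2), of R]
    show ?thesis
    proof (cases "R \<in> {0..1/2}")
      case True
      have "0 \<le> R * (1 - Re z)" using True complex_Re_le_cmod[of z] that by simp
      then have "2 * R * (R * (1 - Re z)) \<le> 1 * (R * (1 - Re z))"
        using True by (intro mult_right_mono) auto
      then show ?thesis using eq by (simp add: topspace_space_A circle_point_def)
    next
      case False
      then have "R \<in> circle_radius ` {1..}" using that(1) by (simp only: Un_iff simp_thms)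
      then obtain m where m: "R = circle_radius m" "m \<ge> 1" by (elim imageE) simp
      have "(fst (circle_point R z))\<^sup>2 + (snd (circle_point R z))\<^sup>2 = 2 * circle_radius m * fst (circle_point R z)"
        unfolding circle_point_def fst_conv snd_conv eq m(1)[symmetric] ..
      then show ?thesis using m(2) unfolding topspace_space_A by (intro disjI2 exI[of _ m] conjI)
    qed
  qed
  moreover have "continuous_on (?T \<times> sphere 0 1) (\<lambda>(R, z). circle_point R z)"
    unfolding circle_point_def case_prod_unfold by (intro continuous_intros)
  ultimately have "continuous_map (top_of_set (?T \<times> sphere 0 1)) (top_of_set (topspace space_A)) (\<lambda>(R, z). circle_point R z)"
    unfolding continuous_map_subtopology_eu by auto
  moreover have "top_of_set (topspace space_A) = space_A"
    by (simp add: space_A_def)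
  ultimately show ?thesis
    by (simp only: prod_topology_subtopology_eu)
qed

section \<open>The spheres of the earring\<close>

lemma sum_split_first: fixes n :: nat shows "(\<Sum>i\<le>n. f i) = (f 0 :: real) + (\<Sum>i=1..n. f i)"
  using sum.atLeast_Suc_atMost[of 0 n f] by (simp add: atMost_atLeast0)

lemma nsphere_base_in_nsphere: "nsphere_base \<in> topspace (nsphere n)"
  by (simp add: topspace_nsphere_iff nsphere_base_def sum_split_first)

lemma topspace_hawaiian_earring:
  "x \<in> topspace (hawaiian_earring n) \<longleftrightarrow>
     (\<forall>i>n. x i = 0) \<and> (\<exists>m\<ge>1. (\<Sum>i\<le>n. (x i)\<^sup>2) = 2 / real m * x 0)"
proof -
  have "(x 0 - 1 / real m)\<^sup>2 + (\<Sum>i=1..n. (x i)\<^sup>2) = (1 / real m)\<^sup>2 \<longleftrightarrow> (\<Sum>i\<le>n. (x i)\<^sup>2) = 2 / real m * x 0" for m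
    unfolding sum_split_first by (auto simp: power2_diff)
  then show ?thesis
    by (auto simp: hawaiian_earring_def topspace_Euclidean_space Suc_le_eq)
qed

lemma hawaiian_earring_nonneg:
  assumes "x \<in> topspace (hawaiian_earring n)"
  shows "x 0 \<ge> 0"
proof -
  obtain m where "m \<ge> 1" "(\<Sum>i\<le>n. (x i)\<^sup>2) = 2 / real m * x 0"
    using assms by (auto simp: topspace_hawaiian_earring)
  moreover have "(\<Sum>i\<le>n. (x i)\<^sup>2) \<ge> 0" by (simp add: sum_nonneg)
  ultimately show ?thesis by (simp add: zero_le_mult_iff zero_le_divide_iff)
qed

lemma continuous_map_hawaiian_earring_projection:
  "continuous_map (hawaiian_earring n) euclideanreal (\<lambda>x. x i)"
  unfolding hawaiian_earring_def Euclidean_space_def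
  by (intro continuous_map_from_subtopology continuous_map_product_projection) simp

lemma continuous_map_into_hawaiian_earring_iff:
  "continuous_map T (hawaiian_earring n) f \<longleftrightarrow>
     (\<forall>i. continuous_map T euclideanreal (\<lambda>x. f x i)) \<and> f ` topspace T \<subseteq> topspace (hawaiian_earring n)"
proof -
  have "hawaiian_earring n = subtopology (powertop_real UNIV) (topspace (hawaiian_earring n))"
    by (simp add: hawaiian_earring_def Euclidean_space_def subtopology_subtopology)
  then have "continuous_map T (hawaiian_earring n) f \<longleftrightarrow>
      continuous_map T (powertop_real UNIV) f \<and> f ` topspace T \<subseteq> topspace (hawaiian_earring n)"
    by (metis continuous_map_in_subtopology image_subset_iff_funcset)
  then show ?thesis by (simp add: continuous_map_componentwise_UNIV)
qed

lemma earring_coord_in_nsphere: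
  assumes "k \<ge> 1" "\<forall>i>n. x i = 0"
  shows "earring_coord n k x \<in> topspace (nsphere n)"
proof (cases "(\<Sum>i\<le>n. (x i)\<^sup>2) = 2 / real k * x 0")
  case True
  then have "(x 0)\<^sup>2 + (\<Sum>i=1..n. (x i)\<^sup>2) = 2 / real k * x 0"
    by (simp add: sum_split_first)
  then have "(real k)\<^sup>2 * ((x 0)\<^sup>2 + (\<Sum>i=1..n. (x i)\<^sup>2)) = 2 * real k * x 0"
    using assms(1) by (simp add: power2_eq_square)
  then have "(\<Sum>i\<le>n. (real k * x i + nsphere_base i)\<^sup>2) = 1"
    unfolding sum_split_first
    by (simp add: nsphere_base_def power_mult_distrib power2_diff distrib_left sum_distrib_left)
  then show ?thesis
    using True assms by (simp add: earring_coord_def topspace_nsphere_iff) (simp add: nsphere_base_def)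
qed (use nsphere_base_in_nsphere in \<open>auto simp: earring_coord_def\<close>)

lemma continuous_map_earring_coord:
  assumes k: "k \<ge> 1"
  shows "continuous_map (hawaiian_earring n) (nsphere n) (earring_coord n k)"
proof -
  let ?H = "hawaiian_earring n"
  have "continuous_map ?H (nsphere n) (\<lambda>x. if (\<Sum>i\<le>n. (x i)\<^sup>2) = 2 / real k * x 0
     then (\<lambda>i. real k * x i + nsphere_base i) else nsphere_base)"
  proof (rule continuous_map_isolated_piece[where \<rho> = "\<lambda>k. 2 / real k"])
    show "continuous_map ?H euclideanreal (\<lambda>x. \<Sum>i\<le>n. (x i)\<^sup>2)" "continuous_map ?H euclideanreal (\<lambda>x. x 0)"
      by (intro continuous_intros continuous_map_hawaiian_earring_projection; simp)+
    let ?C = "{x. (\<Sum>i\<le>n. (x i)\<^sup>2) = 2 / real k * x 0}"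
    show "continuous_map (subtopology ?H ?C) (nsphere n) (\<lambda>x i. real k * x i + nsphere_base i)"
      unfolding continuous_map_nsphere_iff
    proof (intro conjI allI subsetI)
      show "continuous_map (subtopology ?H ?C) euclideanreal (\<lambda>x. real k * x i + nsphere_base i)" for i
        by (intro continuous_intros continuous_map_from_subtopology continuous_map_hawaiian_earring_projection) simp_all
      fix y assume "y \<in> (\<lambda>x i. real k * x i + nsphere_base i) ` topspace (subtopology ?H ?C)"
      then obtain x where "x \<in> topspace ?H" "x \<in> ?C" "y = (\<lambda>i. real k * x i + nsphere_base i)" by auto
      then show "y \<in> topspace (nsphere n)"
        using earring_coord_in_nsphere[OF k, of n x] by (auto simp: earring_coord_def topspace_hawaiian_earring)
    qed
    show "(\<lambda>i. real k * x i + nsphere_base i) = nsphere_base"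
      if x: "x \<in> topspace ?H" and "(\<Sum>i\<le>n. (x i)\<^sup>2) = 0" for x
    proof -
      have "x i = 0" for i
        using that by (cases "i \<le> n") (auto simp: sum_nonneg_eq_0_iff topspace_hawaiian_earring)
      then show ?thesis by simp
    qed
    show "2 / real j < 2 / real i" if "1 \<le> i" "i < j" for i j
      using that by (simp add: frac_less2)
  qed (use k nsphere_base_in_nsphere hawaiian_earring_nonneg in \<open>auto simp: topspace_hawaiian_earring\<close>)
  then show ?thesis unfolding earring_coord_def by simp
qed

lemma sum_earring_point:
  assumes "w \<in> topspace (nsphere n)"
  shows "(\<Sum>i\<le>n. (earring_point t w i)\<^sup>2) = 2 * t * earring_point t w 0"
proof -
  have "(w 0)\<^sup>2 + (\<Sum>i=1..n. (w i)\<^sup>2) = 1"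
    using assms by (simp add: topspace_nsphere_iff sum_split_first)
  then have "t\<^sup>2 * ((w 0)\<^sup>2 + (\<Sum>i=1..n. (w i)\<^sup>2)) = t\<^sup>2" by simp
  then show ?thesis
    unfolding sum_split_first
    by (simp add: earring_point_def nsphere_base_def power_mult_distrib power2_sum distrib_left
        sum_distrib_left power2_eq_square[of t] algebra_simps)
qed

lemma earring_coord_earring_point:
  assumes "k \<ge> 1" "w \<in> topspace (nsphere n)"
  shows "earring_coord n k (earring_point (1 / real k) w) = w"
  using sum_earring_point[OF assms(2), of "1 / real k"] assms
  by (auto simp: earring_coord_def) (simp add: earring_point_def)

text \<open>Parameter 0 stands for the constant map to the origin; continuity there expresses that
  the spheres shrink to it.\<close>

lemma continuous_map_earring_point:
  "continuous_map (prod_topology (top_of_set (insert 0 ((\<lambda>k. 1 / real k) ` {1..}))) (nsphere n))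
     (hawaiian_earring n) (\<lambda>(t, w). earring_point t w)"
  unfolding continuous_map_into_hawaiian_earring_iff
proof (intro conjI allI subsetI)
  let ?T = "top_of_set (insert 0 ((\<lambda>k. 1 / real k) ` {1..}))"
  have "continuous_map (prod_topology ?T (nsphere n)) euclideanreal fst"
    by (rule continuous_map_into_fulltopology[OF continuous_map_fst])
  moreover have "continuous_map (prod_topology ?T (nsphere n)) euclideanreal (\<lambda>z. snd z i)" for i
    using continuous_map_compose[OF continuous_map_snd continuous_map_nsphere_projection] by (simp add: o_def)
  ultimately show "continuous_map (prod_topology ?T (nsphere n)) euclideanreal (\<lambda>z. (case z of (t, w) \<Rightarrow> earring_point t w) i)" for i
    unfolding earring_point_def case_prod_unfold by (intro continuous_intros) auto
  fix x assume "x \<in> (\<lambda>(t, w). earring_point t w) ` topspace (prod_topology ?T (nsphere n))"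
  then obtain t w where x: "x = earring_point t w" and w: "w \<in> topspace (nsphere n)"
    and t: "t = 0 \<or> (\<exists>k\<ge>1. t = 1 / real k)" by auto
  have "\<forall>i>n. x i = 0"
    using w by (auto simp: x earring_point_def nsphere_base_def topspace_nsphere_iff)
  moreover have "\<exists>k\<ge>1. (\<Sum>i\<le>n. (x i)\<^sup>2) = 2 / real k * x 0"
  proof (cases "t = 0")
    case True
    then show ?thesis by (intro exI[of _ 1]) (simp add: x earring_point_def)
  next
    case False
    then obtain k where "k \<ge> 1" "t = 1 / real k" using t by blast
    then show ?thesis using sum_earring_point[OF w, of t] by (intro exI[of _ k]) (simp add: x)
  qed
  ultimately show "x \<in> topspace (hawaiian_earring n)"
    unfolding topspace_hawaiian_earring by blast
qed

section \<open>Maps that wind before they cover\<close>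

abbreviation inA :: "nat \<Rightarrow> real \<times> real \<Rightarrow> ((real \<times> real) + (nat \<Rightarrow> real)) set" where
  "inA n \<equiv> wedge_inl space_A (0, 0) (hawaiian_earring n) (\<lambda>i. 0)"

abbreviation inH :: "nat \<Rightarrow> (nat \<Rightarrow> real) \<Rightarrow> ((real \<times> real) + (nat \<Rightarrow> real)) set" where
  "inH n \<equiv> wedge_inr space_A (0, 0) (hawaiian_earring n) (\<lambda>i. 0)"

definition X_circle :: "nat \<Rightarrow> ((real \<times> real) + (nat \<Rightarrow> real)) set \<Rightarrow> complex" where
  "X_circle m = wedge_case (circle_coord m) (\<lambda>_. 1)"

definition X_sphere :: "nat \<Rightarrow> nat \<Rightarrow> ((real \<times> real) + (nat \<Rightarrow> real)) set \<Rightarrow> nat \<Rightarrow> real" where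
  "X_sphere n k = wedge_case (\<lambda>_. nsphere_base) (earring_coord n k)"

text \<open>Independent of \<open>m\<close>, so a single neighbourhood of a map controls its turns
  around all circles at once.\<close>

definition X_abscissa :: "((real \<times> real) + (nat \<Rightarrow> real)) set \<Rightarrow> real" where
  "X_abscissa = wedge_case fst (\<lambda>_. 0)"

lemma circle_coord_0: "circle_coord m (0, 0) = 1"
  by (simp add: circle_coord_def complex_eq_iff)

lemma earring_coord_0: "earring_coord n k (\<lambda>i. 0) = nsphere_base"
  by (simp add: earring_coord_def)

lemma X_circle_simps:
  "a \<in> topspace space_A \<Longrightarrow> X_circle m (inA n a) = circle_coord m a"
  "b \<in> topspace (hawaiian_earring n) \<Longrightarrow> X_circle m (inH n b) = 1"
  unfolding X_circle_def by (simp_all add: wedge_case circle_coord_0)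

lemma X_sphere_simps:
  "a \<in> topspace space_A \<Longrightarrow> X_sphere n k (inA n a) = nsphere_base"
  "b \<in> topspace (hawaiian_earring n) \<Longrightarrow> X_sphere n k (inH n b) = earring_coord n k b"
  unfolding X_sphere_def by (simp_all add: wedge_case earring_coord_0)

lemma X_abscissa_simps:
  "a \<in> topspace space_A \<Longrightarrow> X_abscissa (inA n a) = fst a"
  "b \<in> topspace (hawaiian_earring n) \<Longrightarrow> X_abscissa (inH n b) = 0"
  unfolding X_abscissa_def by (simp_all add: wedge_case)

lemma continuous_map_X_circle:
  "m \<ge> 1 \<Longrightarrow> continuous_map (space_X n) euclidean (X_circle m)"
  unfolding X_circle_def
  by (intro continuous_map_wedge_case continuous_map_circle_coord) (simp_all add: circle_coord_0)

lemma continuous_map_X_sphere: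
  "k \<ge> 1 \<Longrightarrow> continuous_map (space_X n) (nsphere n) (X_sphere n k)"
  unfolding X_sphere_def
  by (intro continuous_map_wedge_case continuous_map_earring_coord)
     (simp_all add: earring_coord_0 nsphere_base_in_nsphere)

lemma continuous_map_X_abscissa: "continuous_map (space_X n) euclideanreal X_abscissa"
  unfolding X_abscissa_def
proof (rule continuous_map_wedge_case)
  show "continuous_map space_A euclideanreal fst"
    unfolding continuous_map_space_A_iff by (intro continuous_intros)
qed simp_all

text \<open>A point with nontrivial sphere coordinate lies in the earring, which
  \<open>X_circle m\<close> collapses. This is why lifts take integer values at such points.\<close>

lemma X_circle_eq_1:
  assumes "p \<in> topspace (space_X n)" "X_sphere n k p \<noteq> nsphere_base"
  shows "X_circle m p = 1"
  using assms by (elim topspace_wedge_cases) (auto simp: X_sphere_simps X_circle_simps)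

lemma norm_X_circle:
  assumes "p \<in> topspace (space_X n)" "m \<ge> 1"
  shows "norm (X_circle m p) = 1"
  using assms by (elim topspace_wedge_cases) (auto simp: X_circle_simps norm_circle_coord)

lemma X_abscissa_eq:
  assumes "p \<in> topspace (space_X n)" "m \<ge> 1" "X_circle m p \<noteq> 1"
  shows "X_abscissa p = circle_radius m * (1 - Re (X_circle m p))"
  using assms by (elim topspace_wedge_cases) (auto simp: X_circle_simps X_abscissa_simps fst_circle_coord)

section \<open>Lifts along a circle and the degree at a given height\<close>

definition winding_lift ::
    "nat \<Rightarrow> (nat \<Rightarrow> real) \<Rightarrow> nat \<Rightarrow> ((nat \<Rightarrow> real) \<Rightarrow> ((real \<times> real) + (nat \<Rightarrow> real)) set) \<Rightarrow> ((nat \<Rightarrow> real) \<Rightarrow> real) \<Rightarrow> bool" where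
  "winding_lift n s m f \<theta> \<longleftrightarrow> continuous_map (nsphere n) euclideanreal \<theta> \<and> \<theta> s = 0 \<and>
     (\<forall>z \<in> topspace (nsphere n). X_circle m (f z) = cis (2 * pi * \<theta> z))"

text \<open>The part of \<open>f\<close> over the \<open>k\<close>-th sphere that happens on sheet
  \<open>k\<close> of the infinite cyclic cover of the circle. The cut at distance 1/2 from
  \<open>k\<close> does no harm: there the lift is not an integer, so the sphere coordinate is
  trivial.\<close>

definition level_map ::
    "nat \<Rightarrow> nat \<Rightarrow> ((nat \<Rightarrow> real) \<Rightarrow> real) \<Rightarrow> ((nat \<Rightarrow> real) \<Rightarrow> ((real \<times> real) + (nat \<Rightarrow> real)) set) \<Rightarrow> (nat \<Rightarrow> real) \<Rightarrow> nat \<Rightarrow> real" where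
  "level_map n k \<theta> f z = (if \<bar>\<theta> z - real k\<bar> < 1/2 then X_sphere n k (f z) else nsphere_base)"

abbreviation X_maps :: "nat \<Rightarrow> (nat \<Rightarrow> real) \<Rightarrow> ((nat \<Rightarrow> real) \<Rightarrow> ((real \<times> real) + (nat \<Rightarrow> real)) set) topology" where
  "X_maps n s \<equiv> sphere_space n s (space_X n) (base_X n)"

text \<open>The set \<open>twisted_maps n s m k\<close> collects maps that cover the \<open>k\<close>-th sphere where their lift along
  the \<open>m\<close>-th circle is \<open>k\<close>. The exponent \<open>m\<close> of the total degree ties the sphere to the circle:
  near a given map only finitely many pairs \<open>(m, k)\<close> can occur.\<close>

definition twisted_maps :: "nat \<Rightarrow> (nat \<Rightarrow> real) \<Rightarrow> nat \<Rightarrow> nat \<Rightarrow> ((nat \<Rightarrow> real) \<Rightarrow> ((real \<times> real) + (nat \<Rightarrow> real)) set) set" where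
  "twisted_maps n s m k = {f \<in> topspace (X_maps n s). \<bar>Brouwer_degree2 n (X_sphere n k \<circ> f)\<bar> = 2 ^ m \<and>
     (\<exists>\<theta>. winding_lift n s m f \<theta> \<and> Brouwer_degree2 n (level_map n k \<theta> f) \<noteq> 0)}"

lemma X_maps_continuous: "f \<in> topspace (X_maps n s) \<Longrightarrow> continuous_map (nsphere n) (space_X n) f"
  by (simp add: topspace_sphere_space)

lemma X_maps_in:
  assumes "f \<in> topspace (X_maps n s)" "z \<in> topspace (nsphere n)"
  shows "f z \<in> topspace (space_X n)"
  using X_maps_continuous[OF assms(1)] assms(2) by (auto simp: continuous_map_def)

lemma X_maps_basepoint: "f \<in> topspace (X_maps n s) \<Longrightarrow> f s = base_X n"
  by (simp add: topspace_sphere_space)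

lemma cis_2pi_eq_1_iff: "cis (2 * pi * x) = 1 \<longleftrightarrow> x \<in> \<int>"
proof -
  have "cis (2 * pi * x) = 1 \<longleftrightarrow> (\<exists>j::int. x = of_int j)"
    using exp_eq_1[of "\<i> * of_real (2 * pi * x)"] by (auto simp: cis_conv_exp)
  then show ?thesis by (auto elim: Ints_cases)
qed

lemma winding_lift_Ints:
  assumes "f \<in> topspace (X_maps n s)" "winding_lift n s m f \<theta>" "z \<in> topspace (nsphere n)"
    and "X_sphere n k (f z) \<noteq> nsphere_base"
  shows "\<theta> z \<in> \<int>"
  using X_circle_eq_1[OF X_maps_in[OF assms(1,3)] assms(4), of m] assms(2,3)
  by (simp add: winding_lift_def cis_2pi_eq_1_iff)

lemma continuous_map_level_map:
  assumes f: "f \<in> topspace (X_maps n s)" and w: "winding_lift n s m f \<theta>" and k: "k \<ge> 1"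
  shows "continuous_map (nsphere n) (nsphere n) (level_map n k \<theta> f)"
proof -
  have fc: "continuous_map (nsphere n) (nsphere n) (\<lambda>z. X_sphere n k (f z))"
    using continuous_map_compose[OF X_maps_continuous[OF f] continuous_map_X_sphere[OF k]]
    by (simp add: o_def)
  have \<theta>c: "continuous_map (nsphere n) euclideanreal \<theta>"
    using w by (simp add: winding_lift_def)
  have "continuous_map (nsphere n) (nsphere n)
     (\<lambda>z. if \<bar>\<theta> z - real k\<bar> < 1/2 then X_sphere n k (f z) else nsphere_base)"
  proof (rule continuous_map_cases_lt)
    show "continuous_map (nsphere n) euclideanreal (\<lambda>z. \<bar>\<theta> z - real k\<bar>)"
      by (intro continuous_intros \<theta>c) simp
    fix z assume z: "z \<in> topspace (nsphere n)" and eq: "\<bar>\<theta> z - real k\<bar> = 1/2"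
    show "X_sphere n k (f z) = nsphere_base"
    proof (rule ccontr)
      assume "X_sphere n k (f z) \<noteq> nsphere_base"
      then have "\<theta> z \<in> \<int>" by (rule winding_lift_Ints[OF f w z])
      then obtain j :: int where "\<theta> z = of_int j" by (auto elim: Ints_cases)
      \<comment> \<open>An integer is never at distance 1/2 from \<open>k\<close>; doubling makes
        this a matter of parity.\<close>
      then have "real_of_int (2 * j - 2 * int k) = 1 \<or> real_of_int (2 * j - 2 * int k) = -1"
        using eq by (auto simp: abs_if split: if_splits)
      then have "2 * j - 2 * int k = 1 \<or> 2 * j - 2 * int k = -1"
        by linarith
      then show False by presburger
    qed
  qed (use fc nsphere_base_in_nsphere in \<open>auto intro: continuous_map_from_subtopology\<close>)
  then show ?thesis by (simp add: level_map_def[abs_def])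
qed

text \<open>The quotient of the two circle coordinates has distance below 1 from 1, hence lies in
  the right half plane, where the principal argument is continuous and below \<open>pi / 2\<close>
  in absolute value. Adding this argument, divided by \<open>2 * pi\<close>, to the old lift gives
  the new one and the bound 1/4.\<close>

lemma winding_lift_perturb:
  assumes m: "m \<ge> 1" and f: "f \<in> topspace (X_maps n s)" and f': "f' \<in> topspace (X_maps n s)"
    and s: "s \<in> topspace (nsphere n)"
    and w: "winding_lift n s m f \<theta>"
    and close: "\<And>z. z \<in> topspace (nsphere n) \<Longrightarrow> dist (X_circle m (f' z)) (X_circle m (f z)) < 1"
  obtains \<theta>' where "winding_lift n s m f' \<theta>'" "\<And>z. z \<in> topspace (nsphere n) \<Longrightarrow> \<bar>\<theta>' z - \<theta> z\<bar> < 1/4"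
proof -
  let ?S = "nsphere n"
  define q where "q z = X_circle m (f' z) / X_circle m (f z)" for z
  define \<theta>' where "\<theta>' z = \<theta> z + Im (Ln (q z)) / (2 * pi)" for z
  have n1: "norm (X_circle m (f z)) = 1" "norm (X_circle m (f' z)) = 1" if "z \<in> topspace ?S" for z
    using norm_X_circle m f f' X_maps_in that by blast+
  have nz: "X_circle m (f z) \<noteq> 0" if "z \<in> topspace ?S" for z
    using n1[OF that] by auto
  have qn: "norm (q z) = 1" if "z \<in> topspace ?S" for z
    using n1[OF that] by (simp add: q_def norm_divide)
  have q1: "Re (q z) > 0" if z: "z \<in> topspace ?S" for z
  proof -
    have "q z - 1 = (X_circle m (f' z) - X_circle m (f z)) / X_circle m (f z)"
      using nz[OF z] by (simp add: q_def field_simps)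
    then have "norm (q z - 1) < 1"
      using close[OF z] n1[OF z] by (simp add: norm_divide dist_norm)
    then show ?thesis
      using abs_Re_le_cmod[of "q z - 1"] by simp
  qed
  have cont: "continuous_map ?S euclidean (\<lambda>z. X_circle m (g z))" if "g \<in> topspace (X_maps n s)" for g
    using continuous_map_compose[OF X_maps_continuous[OF that] continuous_map_X_circle[OF m]] by (simp add: o_def)
  have qc: "continuous_map ?S (top_of_set {w. Re w > 0}) q"
  proof -
    have "continuous_map ?S (top_of_set (UNIV \<times> (- {0}))) (\<lambda>z. (X_circle m (f' z), X_circle m (f z)))"
      using cont[OF f] cont[OF f'] nz
      by (simp add: continuous_map_in_subtopology continuous_map_pairedI flip: prod_topology_euclidean euclidean_product_topology)
    moreover have "continuous_map (top_of_set (UNIV \<times> (- {0}))) euclidean (\<lambda>(a, b). a / b :: complex)"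
      unfolding case_prod_unfold continuous_map_iff_continuous by (intro continuous_intros) auto
    ultimately have "continuous_map ?S euclidean ((\<lambda>(a, b). a / b) \<circ> (\<lambda>z. (X_circle m (f' z), X_circle m (f z))))"
      by (rule continuous_map_compose)
    then have "continuous_map ?S euclidean q" by (simp add: o_def q_def[abs_def])
    then show ?thesis using q1 by (auto simp: continuous_map_in_subtopology)
  qed
  have "continuous_on {w. Re w > 0} (\<lambda>w. Im (Ln w))"
    by (intro continuous_intros) (auto simp: complex_nonpos_Reals_iff)
  then have "continuous_map (top_of_set {w. Re w > 0}) euclideanreal (\<lambda>w. Im (Ln w))"
    by simp
  from continuous_map_compose[OF qc this]
  have Lc: "continuous_map ?S euclideanreal (\<lambda>z. Im (Ln (q z)))" by (simp add: o_def)
  have "winding_lift n s m f' \<theta>'"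
    unfolding winding_lift_def
  proof (intro conjI ballI)
    show "continuous_map ?S euclideanreal \<theta>'"
      unfolding \<theta>'_def[abs_def] using w Lc
      by (intro continuous_intros) (auto simp: winding_lift_def)
    have "q s = 1"
      using nz[OF s] by (simp add: q_def X_maps_basepoint[OF f] X_maps_basepoint[OF f'])
    then show "\<theta>' s = 0" using w by (simp add: \<theta>'_def winding_lift_def)
    fix z assume z: "z \<in> topspace ?S"
    have "q z \<noteq> 0" using qn[OF z] by auto
    then have "q z = exp (Ln (q z))" by simp
    also have "\<dots> = cis (Im (Ln (q z)))"
      using qn[OF z] \<open>q z \<noteq> 0\<close> by (simp add: exp_eq_polar)
    finally have "q z = cis (Im (Ln (q z)))" .
    moreover have "cis (2 * pi * \<theta>' z) = cis (2 * pi * \<theta> z) * cis (Im (Ln (q z)))"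
      by (simp add: cis_mult \<theta>'_def distrib_left)
    moreover have "X_circle m (f' z) = X_circle m (f z) * q z"
      using nz[OF z] by (simp add: q_def)
    ultimately show "X_circle m (f' z) = cis (2 * pi * \<theta>' z)"
      using w z by (simp add: winding_lift_def)
  qed
  moreover have "\<bar>\<theta>' z - \<theta> z\<bar> < 1/4" if z: "z \<in> topspace ?S" for z
  proof -
    have "q z \<noteq> 0" using qn[OF z] by auto
    then have "\<bar>Im (Ln (q z))\<bar> < pi / 2"
      using Re_Ln_pos_lt q1[OF z] by blast
    then show ?thesis by (simp add: \<theta>'_def field_simps)
  qed
  ultimately show thesis by (rule that)
qed

lemma continuous_map_X_sphere_comp:
  assumes "f \<in> topspace (X_maps n s)" "k \<ge> 1"
  shows "continuous_map (nsphere n) (nsphere n) (X_sphere n k \<circ> f)"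
  by (rule continuous_map_compose[OF X_maps_continuous[OF assms(1)] continuous_map_X_sphere[OF assms(2)]])

text \<open>Where one of the two sphere coordinates is nontrivial, one lift is an integer and the
  other is within 1/4 of it, so both fall on the same side of the cut at 1/2; elsewhere both level
  maps are \<open>nsphere_base\<close>. So the level maps are as close as the sphere coordinates,
  and both degrees persist.\<close>

lemma twisted_maps_perturb:
  assumes m: "m \<ge> 1" and k: "k \<ge> 1" and s: "s \<in> topspace (nsphere n)"
    and f: "f \<in> twisted_maps n s m k" and f': "f' \<in> topspace (X_maps n s)"
    and c_circle: "\<And>z. z \<in> topspace (nsphere n) \<Longrightarrow> dist (X_circle m (f' z)) (X_circle m (f z)) < 1"
    and c_sphere: "\<And>z i. z \<in> topspace (nsphere n) \<Longrightarrow> i \<le> n \<Longrightarrow>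
          \<bar>X_sphere n k (f' z) i - X_sphere n k (f z) i\<bar> < 1 / (real n + 1)"
  shows "f' \<in> twisted_maps n s m k"
proof -
  let ?S = "nsphere n"
  obtain \<theta> where fm: "f \<in> topspace (X_maps n s)" and deg: "\<bar>Brouwer_degree2 n (X_sphere n k \<circ> f)\<bar> = 2 ^ m"
    and w: "winding_lift n s m f \<theta>" and lev: "Brouwer_degree2 n (level_map n k \<theta> f) \<noteq> 0"
    using f by (auto simp: twisted_maps_def)
  obtain \<theta>' where w': "winding_lift n s m f' \<theta>'"
    and th: "\<And>z. z \<in> topspace ?S \<Longrightarrow> \<bar>\<theta>' z - \<theta> z\<bar> < 1/4"
    using winding_lift_perturb[OF m fm f' s w c_circle] by metis
  have "Brouwer_degree2 n (X_sphere n k \<circ> f') = Brouwer_degree2 n (X_sphere n k \<circ> f)"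
    by (rule Brouwer_degree2_close[OF continuous_map_X_sphere_comp[OF f' k] continuous_map_X_sphere_comp[OF fm k]])
       (use c_sphere in simp)
  moreover have "Brouwer_degree2 n (level_map n k \<theta>' f') = Brouwer_degree2 n (level_map n k \<theta> f)"
  proof (rule Brouwer_degree2_close[OF continuous_map_level_map[OF f' w' k] continuous_map_level_map[OF fm w k]])
    fix z i assume z: "z \<in> topspace ?S" and i: "i \<le> n"
    have int: "(\<bar>x - real k\<bar> < 1/2) = (\<bar>y - real k\<bar> < 1/2)" if xi: "x \<in> \<int>" and xy: "\<bar>y - x\<bar> < 1/4" for x y
    proof -
      obtain j :: int where j: "x = of_int j" using xi by (auto elim: Ints_cases)
      show ?thesis
      proof (cases "j = int k")
        case False
        then have "\<bar>real_of_int (j - int k)\<bar> \<ge> 1" by linarith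
        then have "\<bar>x - real k\<bar> \<ge> 1" by (simp add: j)
        then show ?thesis using xy by linarith
      qed (use j xy in simp)
    qed
    have "(\<bar>\<theta> z - real k\<bar> < 1/2) = (\<bar>\<theta>' z - real k\<bar> < 1/2)"
      if "X_sphere n k (f z) \<noteq> nsphere_base \<or> X_sphere n k (f' z) \<noteq> nsphere_base"
      using that
    proof
      assume "X_sphere n k (f z) \<noteq> nsphere_base"
      then show ?thesis using int[OF winding_lift_Ints[OF fm w z]] th[OF z] by blast
    next
      assume *: "X_sphere n k (f' z) \<noteq> nsphere_base"
      have "\<bar>\<theta> z - \<theta>' z\<bar> < 1/4" using th[OF z] by linarith
      then show ?thesis using int[OF winding_lift_Ints[OF f' w' z *], of "\<theta> z"] by blast
    qed
    then show "\<bar>level_map n k \<theta>' f' z i - level_map n k \<theta> f z i\<bar> < 1 / (real n + 1)"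
      using c_sphere[OF z i]
      by (cases "X_sphere n k (f z) = nsphere_base \<and> X_sphere n k (f' z) = nsphere_base")
         (auto simp: level_map_def)
  qed
  ultimately show ?thesis
    using f' deg lev w' by (auto simp: twisted_maps_def)
qed

section \<open>Sets of twisted maps in the mapping space\<close>

lemma X_sphere_nbhd:
  assumes k: "k \<ge> 1" and f: "f \<in> topspace (X_maps n s)"
  obtains N where "openin (X_maps n s) N" "f \<in> N"
    "\<And>g z i. g \<in> N \<Longrightarrow> z \<in> topspace (nsphere n) \<Longrightarrow> i \<le> n \<Longrightarrow>
        \<bar>X_sphere n k (g z) i - X_sphere n k (f z) i\<bar> < 1 / (real n + 1)"
proof -
  have "\<exists>N. openin (X_maps n s) N \<and> f \<in> N \<and>
     (\<forall>g\<in>N. \<forall>z \<in> topspace (nsphere n). \<bar>X_sphere n k (g z) i - X_sphere n k (f z) i\<bar> < 1 / (real n + 1))" for i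
  proof -
    have "continuous_map (space_X n) euclideanreal (\<lambda>p. X_sphere n k p i)"
      by (rule continuous_map_nsphere_component[OF continuous_map_X_sphere[OF k]])
    moreover have "1 / (real n + 1) > 0" by simp
    ultimately show ?thesis
      using sphere_space_uniform_nbhd[OF _ f, of "\<lambda>p. X_sphere n k p i" "1 / (real n + 1)"]
      unfolding dist_real_def by metis
  qed
  then obtain N where N: "\<And>i. openin (X_maps n s) (N i)" "\<And>i. f \<in> N i"
     "\<And>i g z. g \<in> N i \<Longrightarrow> z \<in> topspace (nsphere n) \<Longrightarrow>
        \<bar>X_sphere n k (g z) i - X_sphere n k (f z) i\<bar> < 1 / (real n + 1)"
    by metis
  show thesis
  proof (rule that[of "\<Inter>i\<in>{..n}. N i"])
    show "openin (X_maps n s) (\<Inter>i\<in>{..n}. N i)"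
      using N(1) by (intro openin_Inter) auto
  qed (use N in auto)
qed

lemma locally_constant_imp_clopen:
  assumes G: "G \<subseteq> topspace X"
    and loc: "\<And>f. f \<in> topspace X \<Longrightarrow> \<exists>N. openin X N \<and> f \<in> N \<and> (\<forall>g\<in>N. g \<in> G \<longleftrightarrow> f \<in> G)"
  shows "openin X G" and "closedin X G"
proof -
  have *: "openin X {f \<in> topspace X. (f \<in> G) = b}" for b
  proof (subst openin_subopen, intro ballI)
    fix f assume "f \<in> {f \<in> topspace X. (f \<in> G) = b}"
    then have fX: "f \<in> topspace X" and fb: "(f \<in> G) = b" by (simp_all only: mem_Collect_eq)
    obtain N where N: "openin X N" "f \<in> N" and eq: "\<forall>g\<in>N. (g \<in> G) = (f \<in> G)"
      using loc[OF fX] by (elim exE conjE) (rule that)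
    have "N \<subseteq> {f \<in> topspace X. (f \<in> G) = b}"
    proof
      fix g assume "g \<in> N"
      then show "g \<in> {f \<in> topspace X. (f \<in> G) = b}"
        using openin_subset[OF N(1)] bspec[OF eq, of g] fb by (simp only: mem_Collect_eq subset_iff simp_thms)
    qed
    then show "\<exists>N. openin X N \<and> f \<in> N \<and> N \<subseteq> {f \<in> topspace X. (f \<in> G) = b}"
      by (intro exI[of _ N] conjI N)
  qed
  have "{f \<in> topspace X. (f \<in> G) = True} = G" "{f \<in> topspace X. (f \<in> G) = False} = topspace X - G"
    using G by auto
  then show "openin X G" "closedin X G" using *[of True] *[of False] G by (auto simp: closedin_def)
qed

text \<open>The closeness conditions of \<open>twisted_maps_perturb\<close> are symmetric in the two
  maps, so membership is locally constant.\<close>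

lemma twisted_maps_clopen:
  assumes m: "m \<ge> 1" and k: "k \<ge> 1" and s: "s \<in> topspace (nsphere n)"
  shows "openin (X_maps n s) (twisted_maps n s m k)"
    and "closedin (X_maps n s) (twisted_maps n s m k)"
proof -
  let ?SS = "X_maps n s" and ?G = "twisted_maps n s m k"
  have sub: "?G \<subseteq> topspace ?SS" by (auto simp: twisted_maps_def)
  have *: "\<exists>N. openin ?SS N \<and> f \<in> N \<and> (\<forall>g\<in>N. g \<in> ?G \<longleftrightarrow> f \<in> ?G)" if f: "f \<in> topspace ?SS" for f
  proof -
    obtain N1 where N1: "openin ?SS N1" "f \<in> N1"
      "\<And>g z. g \<in> N1 \<Longrightarrow> z \<in> topspace (nsphere n) \<Longrightarrow> dist (X_circle m (g z)) (X_circle m (f z)) < 1"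
      using sphere_space_uniform_nbhd[OF continuous_map_X_circle[OF m] f, of 1] by auto
    obtain N2 where N2: "openin ?SS N2" "f \<in> N2"
      "\<And>g z i. g \<in> N2 \<Longrightarrow> z \<in> topspace (nsphere n) \<Longrightarrow> i \<le> n \<Longrightarrow>
        \<bar>X_sphere n k (g z) i - X_sphere n k (f z) i\<bar> < 1 / (real n + 1)"
      using X_sphere_nbhd[OF k f] by metis
    have "g \<in> ?G \<longleftrightarrow> f \<in> ?G" if g: "g \<in> N1 \<inter> N2" for g
    proof
      have gS: "g \<in> topspace ?SS" using g openin_subset[OF N1(1)] by blast
      have gN: "g \<in> N1" "g \<in> N2" using g by auto
      show "g \<in> ?G" if "f \<in> ?G"
        by (rule twisted_maps_perturb[OF m k s that gS N1(3)[OF gN(1)] N2(3)[OF gN(2)]])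
      show "f \<in> ?G" if "g \<in> ?G"
      proof (rule twisted_maps_perturb[OF m k s that f])
        show "dist (X_circle m (f z)) (X_circle m (g z)) < 1" if "z \<in> topspace (nsphere n)" for z
          using N1(3)[OF gN(1) that] by (subst dist_commute)
        show "\<bar>X_sphere n k (f z) i - X_sphere n k (g z) i\<bar> < 1 / (real n + 1)"
          if "z \<in> topspace (nsphere n)" "i \<le> n" for z i
          using N2(3)[OF gN(2) that] by (subst abs_minus_commute)
      qed
    qed
    then show ?thesis
      by (intro exI[of _ "N1 \<inter> N2"] conjI ballI openin_Int IntI N1(1,2) N2(1,2))
  qed
  show "openin ?SS ?G" "closedin ?SS ?G"
    by (rule locally_constant_imp_clopen[OF sub *]; assumption)+
qed

text \<open>A map in \<open>twisted_maps n s m k\<close> winds \<open>k\<close> times around a circle of diameter at least 1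
  on the way from the basepoint to some point. So \<open>k\<close> cannot exceed the number of
  connected pieces on which a given nearby map is almost constant.\<close>

lemma twisted_maps_bounded:
  assumes n: "n \<ge> 1" and s: "s \<in> topspace (nsphere n)" and f0: "f0 \<in> topspace (X_maps n s)"
  obtains N K where "openin (X_maps n s) N" "f0 \<in> N"
    "\<And>f m k. f \<in> N \<Longrightarrow> m \<ge> 1 \<Longrightarrow> f \<in> twisted_maps n s m k \<Longrightarrow> k \<le> K"
proof -
  let ?S = "nsphere n" and ?SS = "X_maps n s"
  define h where "h z = X_abscissa (f0 z)" for z
  have hc: "continuous_map ?S euclideanreal h"
    using continuous_map_compose[OF X_maps_continuous[OF f0] continuous_map_X_abscissa]
    by (simp add: o_def h_def[abs_def])
  \<comment> \<open>The pieces must be connected so that the lift takes intermediate values inside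
    one piece.\<close>
  have "\<exists>B. openin ?S B \<and> connectedin ?S B \<and> d \<in> B \<and> (\<forall>z\<in>B. \<bar>h z - h d\<bar> < 1/16)" if d: "d \<in> topspace ?S" for d
  proof -
    let ?V = "{z \<in> topspace ?S. h z \<in> ball (h d) (1/16)}"
    have "openin ?S ?V"
      by (rule openin_continuous_map_preimage[OF hc]) simp
    moreover have "d \<in> ?V" using d by simp
    ultimately have "\<exists>U. openin ?S U \<and> connectedin ?S U \<and> d \<in> U \<and> U \<subseteq> ?V"
      by (rule locally_connected_space_nsphere[of n, unfolded locally_connected_space, rule_format, OF conjI])
    then obtain B where B: "openin ?S B" "connectedin ?S B" "d \<in> B" "B \<subseteq> ?V"
      by (elim exE conjE)
    have "\<bar>h z - h d\<bar> < 1/16" if "z \<in> B" for z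
    proof -
      have "h z \<in> ball (h d) (1/16)" using that B(4) by blast
      then show ?thesis by (simp add: dist_real_def abs_minus_commute)
    qed
    then show ?thesis by (intro exI[of _ B] conjI ballI B(1-3))
  qed
  then obtain B where B: "\<And>d. d \<in> topspace ?S \<Longrightarrow> openin ?S (B d)" "\<And>d. d \<in> topspace ?S \<Longrightarrow> connectedin ?S (B d)"
      "\<And>d. d \<in> topspace ?S \<Longrightarrow> d \<in> B d" "\<And>d z. d \<in> topspace ?S \<Longrightarrow> z \<in> B d \<Longrightarrow> \<bar>h z - h d\<bar> < 1/16"
    by metis
  have "compactin ?S (topspace ?S)" using compact_space_nsphere by (simp add: compact_space_def)
  moreover have "\<forall>U\<in>B ` topspace ?S. openin ?S U" using B(1) by blast
  moreover have "topspace ?S \<subseteq> \<Union>(B ` topspace ?S)" using B(3) by blast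
  ultimately obtain \<F> where "finite \<F>" "\<F> \<subseteq> B ` topspace ?S" "topspace ?S \<subseteq> \<Union>\<F>"
    unfolding compactin_def by (elim conjE allE[of _ "B ` topspace ?S"]) auto
  then obtain D where D: "finite D" "D \<subseteq> topspace ?S" "topspace ?S \<subseteq> (\<Union>d\<in>D. B d)"
    using finite_subset_image[of \<F> B "topspace ?S"] by metis
  obtain N where N: "openin ?SS N" "f0 \<in> N"
    "\<And>f z. f \<in> N \<Longrightarrow> z \<in> topspace ?S \<Longrightarrow> dist (X_abscissa (f z)) (X_abscissa (f0 z)) < 1/8"
    using sphere_space_uniform_nbhd[OF continuous_map_X_abscissa f0, of "1/8"] by auto
  have bound: "k \<le> card D" if f: "f \<in> N" and m: "m \<ge> 1" and G: "f \<in> twisted_maps n s m k" for f m k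
  proof (rule ccontr)
    assume big: "\<not> k \<le> card D"
    have fm: "f \<in> topspace ?SS" using openin_subset[OF N(1)] f by blast
    obtain \<theta> where w: "winding_lift n s m f \<theta>" and lev: "Brouwer_degree2 n (level_map n k \<theta> f) \<noteq> 0"
      using G by (auto simp: twisted_maps_def)
    have \<theta>c: "continuous_map ?S euclideanreal \<theta>" and \<theta>s: "\<theta> s = 0"
      and \<theta>w: "\<And>z. z \<in> topspace ?S \<Longrightarrow> X_circle m (f z) = cis (2 * pi * \<theta> z)"
      using w by (auto simp: winding_lift_def)
    \<comment> \<open>Otherwise the level map is constant and has degree 0. So the lift, which
      starts from 0, gets within 1/2 of \<open>k\<close> and passes through every integer from 0 to
      \<open>k - 1\<close>.\<close>
    have "\<exists>z\<in>topspace ?S. \<bar>\<theta> z - real k\<bar> < 1/2"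
    proof (rule ccontr)
      assume "\<not> ?thesis"
      then have "Brouwer_degree2 n (level_map n k \<theta> f) = Brouwer_degree2 n (\<lambda>_. nsphere_base)"
        by (intro Brouwer_degree2_eq) (auto simp: level_map_def)
      with lev show False by (simp add: Brouwer_degree2_const)
    qed
    then obtain z where z: "z \<in> topspace ?S" "\<bar>\<theta> z - real k\<bar> < 1/2" by blast
    have im: "connected (\<theta> ` C)" if "connectedin ?S C" for C
      using connectedin_continuous_map_image[OF \<theta>c that] by simp
    have "\<exists>x\<in>topspace ?S. \<theta> x = real j" if "j < k" for j
    proof -
      have "connected (\<theta> ` topspace ?S)"
        using im connected_space_nsphere[OF n] by (simp add: connectedin_topspace)
      moreover have "0 \<in> \<theta> ` topspace ?S" using \<theta>s s by (metis image_eqI)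
      moreover have "\<theta> z \<in> \<theta> ` topspace ?S" using z by blast
      moreover have "0 \<le> real j" "real j \<le> \<theta> z" using z that by linarith+
      ultimately have "real j \<in> \<theta> ` topspace ?S" by (rule connectedD_interval)
      then show ?thesis by force
    qed
    then obtain x where x: "\<And>j. j < k \<Longrightarrow> x j \<in> topspace ?S" "\<And>j. j < k \<Longrightarrow> \<theta> (x j) = real j" by metis
    have "\<exists>d\<in>D. x j \<in> B d" if "j < k" for j using x(1)[OF that] D(3) by blast
    then obtain d where d: "\<And>j. j < k \<Longrightarrow> d j \<in> D" "\<And>j. j < k \<Longrightarrow> x j \<in> B (d j)" by metis
    \<comment> \<open>With more integer heights than pieces, one piece contains points of two
      different integer heights, hence a full turn.\<close>
    have "\<not> inj_on d {..<k}"
    proof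
      assume "inj_on d {..<k}"
      then have "card {..<k} \<le> card D"
        by (rule card_inj_on_le) (use d(1) D(1) in auto)
      with big show False by simp
    qed
    then obtain i j where ij: "i < k" "j < k" "i \<noteq> j" "d i = d j" by (auto simp: inj_on_def)
    obtain a b where ab: "a < k" "b < k" "a < b" "d a = d b"
      using ij by (metis nat_neq_iff)
    let ?B = "B (d a)"
    have dS: "d a \<in> topspace ?S" using d(1)[OF ab(1)] D(2) by blast
    have BS: "?B \<subseteq> topspace ?S" using connectedin_subset_topspace[OF B(2)[OF dS]] .
    have "connected (\<theta> ` ?B)" by (rule im[OF B(2)[OF dS]])
    moreover have "real a \<in> \<theta> ` ?B" "real b \<in> \<theta> ` ?B"
      using d(2) ab x(2) by (metis image_eqI)+
    ultimately have btw: "t \<in> \<theta> ` ?B" if "real a \<le> t" "t \<le> real b" for t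
      using connectedD_interval that by metis
    have "real a + 1 \<le> real b" using ab(3) by linarith
    \<comment> \<open>After a quarter and a half turn the circle coordinate is \<open>\<i>\<close>
      and -1, so the abscissa is one and two radii: a change above 1/2. Within a single piece,
      closeness to \<open>f0\<close> allows less than 1/8 + 1/16 + 1/16 + 1/8 = 3/8.\<close>
    then have "real a + 1/4 \<in> \<theta> ` ?B" "real a + 1/2 \<in> \<theta> ` ?B"
      by (intro btw; linarith)+
    then obtain p q where pq: "p \<in> ?B" "\<theta> p = real a + 1/4" "q \<in> ?B" "\<theta> q = real a + 1/2" by (metis imageE)
    have cis_a: "cis (2 * pi * (real a + t)) = cis (2 * pi * t)" for t
      by (simp add: distrib_left cis_mult[symmetric])
    have "X_circle m (f p) = \<i>"
      using \<theta>w[of p] pq(1,2) BS cis_a[of "1/4"] by auto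
    moreover have "X_circle m (f q) = -1"
      using \<theta>w[of q] pq(3,4) BS cis_a[of "1/2"] by auto
    moreover have "f p \<in> topspace (space_X n)" "f q \<in> topspace (space_X n)"
      using X_maps_in[OF fm] pq BS by auto
    ultimately have "X_abscissa (f p) = circle_radius m" "X_abscissa (f q) = 2 * circle_radius m"
      using m by (simp_all add: X_abscissa_eq complex_eq_iff)
    then have "X_abscissa (f q) - X_abscissa (f p) > 1/2"
      using circle_radius_gt_half[OF m] by simp
    moreover have "\<bar>X_abscissa (f p) - h p\<bar> < 1/8" "\<bar>X_abscissa (f q) - h q\<bar> < 1/8"
      using N(3)[OF f] pq BS by (auto simp: h_def dist_real_def)
    moreover have "\<bar>h p - h (d a)\<bar> < 1/16" "\<bar>h q - h (d a)\<bar> < 1/16"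
      using B(4)[OF dS] pq by auto
    ultimately show False by linarith
  qed
  show thesis by (rule that[OF N(1,2) bound])
qed

text \<open>Near a map outside the union only finitely many sets matter:
  \<open>twisted_maps_bounded\<close> bounds \<open>k\<close>, and for each \<open>k\<close> the
  locally constant degree admits at most one \<open>m\<close>, whose closed set can be
  avoided.\<close>

lemma twisted_maps_Union_closed:
  assumes n: "n \<ge> 1" and s: "s \<in> topspace (nsphere n)"
  shows "closedin (X_maps n s) (\<Union>m\<in>{1..}. \<Union>k\<in>{1..}. twisted_maps n s m k)"
proof -
  let ?SS = "X_maps n s"
  let ?G = "\<Union>m\<in>{1..}. \<Union>k\<in>{1..}. twisted_maps n s m k"
  have sub: "?G \<subseteq> topspace ?SS" by (auto simp: twisted_maps_def)
  have "openin ?SS (topspace ?SS - ?G)"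
  proof (subst openin_subopen, intro ballI)
    fix f assume f: "f \<in> topspace ?SS - ?G"
    then have fS: "f \<in> topspace ?SS" by simp
    obtain N0 K where N0: "openin ?SS N0" "f \<in> N0"
      "\<And>g m k. g \<in> N0 \<Longrightarrow> m \<ge> 1 \<Longrightarrow> g \<in> twisted_maps n s m k \<Longrightarrow> k \<le> K"
      using twisted_maps_bounded[OF n s fS] by metis
    have "\<exists>N. openin ?SS N \<and> f \<in> N \<and> (\<forall>g\<in>N. \<forall>m\<ge>1. g \<notin> twisted_maps n s m k)" if k: "k \<ge> 1" for k
    proof -
      obtain N where N: "openin ?SS N" "f \<in> N"
        "\<And>g z i. g \<in> N \<Longrightarrow> z \<in> topspace (nsphere n) \<Longrightarrow> i \<le> n \<Longrightarrow>
          \<bar>X_sphere n k (g z) i - X_sphere n k (f z) i\<bar> < 1 / (real n + 1)"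
        using X_sphere_nbhd[OF k fS] by metis
      have deg: "Brouwer_degree2 n (X_sphere n k \<circ> g) = Brouwer_degree2 n (X_sphere n k \<circ> f)" if g: "g \<in> N" for g
      proof -
        have gS: "g \<in> topspace ?SS" using g openin_subset[OF N(1)] by blast
        show ?thesis
          by (rule Brouwer_degree2_close[OF continuous_map_X_sphere_comp[OF gS k] continuous_map_X_sphere_comp[OF fS k]])
             (use N(3)[OF g] in simp)
      qed
      show ?thesis
      proof (cases "\<exists>m\<ge>1. \<bar>Brouwer_degree2 n (X_sphere n k \<circ> f)\<bar> = 2 ^ m")
        case True
        then obtain m where m: "m \<ge> 1" "\<bar>Brouwer_degree2 n (X_sphere n k \<circ> f)\<bar> = 2 ^ m" by blast
        have fG: "f \<notin> twisted_maps n s m k" using f m k by blast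
        let ?N = "N \<inter> (topspace ?SS - twisted_maps n s m k)"
        have avoid: "g \<notin> twisted_maps n s m' k" if "g \<in> ?N" for g m'
          using that deg[of g] m by (auto simp: twisted_maps_def)
        have "openin ?SS ?N"
          by (intro openin_Int N openin_diff twisted_maps_clopen m k s) simp
        moreover have "f \<in> ?N" using N(2) fS fG by (intro IntI DiffI)
        ultimately show ?thesis by (intro exI[of _ ?N] conjI ballI allI impI avoid)
      next
        case False
        have avoid: "g \<notin> twisted_maps n s m k" if "g \<in> N" "m \<ge> 1" for g m
          using that deg[OF that(1)] False by (auto simp: twisted_maps_def)
        then show ?thesis by (intro exI[of _ N] conjI ballI allI impI avoid N(1,2))
      qed
    qed
    then obtain N where N: "\<And>k. k \<ge> 1 \<Longrightarrow> openin ?SS (N k)" "\<And>k. k \<ge> 1 \<Longrightarrow> f \<in> N k"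
      "\<And>k g m. k \<ge> 1 \<Longrightarrow> g \<in> N k \<Longrightarrow> m \<ge> 1 \<Longrightarrow> g \<notin> twisted_maps n s m k"
      by metis
    \<comment> \<open>The bound \<open>Suc K\<close> keeps the index set nonempty when
      \<open>K = 0\<close>.\<close>
    let ?N = "N0 \<inter> (\<Inter>k\<in>{1..Suc K}. N k)"
    have "openin ?SS ?N"
      using N0(1) N(1) by (intro openin_Int openin_Inter) auto
    moreover have "f \<in> ?N" using N0 N by auto
    moreover have "?N \<subseteq> topspace ?SS - ?G"
    proof
      fix g assume g: "g \<in> ?N"
      have "g \<notin> twisted_maps n s m k" if "m \<ge> 1" "k \<ge> 1" for m k
      proof (cases "k \<le> K")
        case True
        then show ?thesis using g that N(3)[of k g m] by auto
      next
        case False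
        then show ?thesis using g that N0(3)[of g m k] by auto
      qed
      then show "g \<in> topspace ?SS - ?G" using g openin_subset[OF N0(1)] by auto
    qed
    ultimately show "\<exists>T. openin ?SS T \<and> f \<in> T \<and> T \<subseteq> topspace ?SS - ?G" by blast
  qed
  then show ?thesis using sub by (simp add: closedin_def)
qed

section \<open>Discontinuity of the action\<close>

lemma base_X_eq:
  "base_X n = inA n (0, 0)" "base_X n = inH n (\<lambda>i. 0)"
  using wedge_point(2)[OF basepoints(1) basepoints(2)] by (simp_all add: wedge_point_def)

lemma X_sphere_base_X: "X_sphere n k (base_X n) = nsphere_base"
  unfolding base_X_eq(1) by (rule X_sphere_simps(1)[OF basepoints(1)])

lemma cyl_retraction_in:
  assumes r: "cyl_retraction n s r" and "x \<in> topspace (nsphere n)" "u \<in> {0..1}"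
  shows "r (x, u) \<in> topspace (nsphere n) \<times> {0..1}" and "r (x, u) \<in> cyl_base n s"
proof -
  have "continuous_map (cyl n) (subtopology (cyl n) (cyl_base n s)) r"
    using r by (simp add: cyl_retraction_def retraction_maps_def)
  moreover have "(x, u) \<in> topspace (cyl n)" using assms(2,3) by (simp add: cyl_def)
  ultimately have "r (x, u) \<in> topspace (subtopology (cyl n) (cyl_base n s))"
    by (meson continuous_map_image_subset_topspace imageI subsetD)
  then show "r (x, u) \<in> topspace (nsphere n) \<times> {0..1}" "r (x, u) \<in> cyl_base n s"
    by (simp_all add: cyl_def)
qed

lemma circle_param_in:
  assumes "circle_param s e" "t \<in> {0..1}"
  shows "e t \<in> topspace (nsphere 1)"
proof -
  have "continuous_map (top_of_set {0..1}) (nsphere 1) e"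
    using assms(1) by (simp add: circle_param_def quotient_imp_continuous_map)
  then have "e ` topspace (top_of_set {0..1}) \<subseteq> topspace (nsphere 1)"
    by (rule continuous_map_image_subset_topspace)
  then show ?thesis using assms(2) by auto
qed

text \<open>If \<open>t x\<close> is the height of \<open>r (x, 1)\<close> in the cylinder, the lift
  is \<open>k * (1 - t x)\<close>. It follows \<open>\<alpha>\<close> from 0 at the basepoint up to
  \<open>k\<close>, reached where \<open>t x = 0\<close>; only there does \<open>\<gamma>\<close>
  take over. So the whole degree of \<open>\<gamma>\<close> sits on level \<open>k\<close>.\<close>

lemma twisted_maps_act_map:
  assumes s: "s \<in> topspace (nsphere n)" and e: "circle_param s1 e" and r: "cyl_retraction n s r"
    and k: "k \<ge> 1"
    and \<alpha>: "\<alpha> \<in> topspace (sphere_space 1 s1 (space_X n) (base_X n))"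
    and \<alpha>_circle: "\<And>t. t \<in> {0..1} \<Longrightarrow> X_circle m (\<alpha> (e t)) = cis (2 * pi * (real k * t))"
    and \<alpha>_sphere: "\<And>t. t \<in> {0..1} \<Longrightarrow> X_sphere n k (\<alpha> (e t)) = nsphere_base"
    and \<gamma>: "\<gamma> \<in> topspace (X_maps n s)"
    and \<gamma>_circle: "\<And>y. y \<in> topspace (nsphere n) \<Longrightarrow> X_circle m (\<gamma> y) = 1"
    and \<gamma>_deg: "\<bar>Brouwer_degree2 n (X_sphere n k \<circ> \<gamma>)\<bar> = 2 ^ m"
  shows "act_map n r (\<alpha> \<circ> e) \<gamma> \<in> twisted_maps n s m k"
proof -
  let ?S = "nsphere n" and ?I = "top_of_set {0..1::real}"
  let ?f = "act_map n r (\<alpha> \<circ> e) \<gamma>"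
  let ?Z = "subtopology (cyl n) (cyl_base n s)"
  define Y where "Y x u = fst (r (x, u))" for x u
  define t where "t x = snd (r (x, 1))" for x
  define \<theta> where "\<theta> x = real k * (1 - t x)" for x
  define g where "g = X_sphere n k \<circ> \<gamma>"
  have fS: "?f \<in> topspace (X_maps n s)"
    by (rule pi1_action_class(1)[OF s e r \<alpha> \<gamma>])
  have rc: "continuous_map (prod_topology ?S ?I) (prod_topology ?S ?I) r"
    using r by (auto simp: cyl_retraction_def retraction_maps_def cyl_def intro: continuous_map_into_fulltopology)
  note rZ = cyl_retraction_in(2)[OF r]
  have rid: "r z = z" if "z \<in> topspace ?Z" for z
    using r that by (simp add: cyl_retraction_def retraction_maps_def)
  have r0: "r (x, 0) = (x, 0)" if "x \<in> topspace ?S" for x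
    by (rule rid) (use that in \<open>simp add: cyl_def cyl_base_def\<close>)
  have rs: "r (s, 1) = (s, 1)"
    by (rule rid) (use s in \<open>simp add: cyl_def cyl_base_def\<close>)
  have Yc: "continuous_map (prod_topology ?S ?I) ?S (\<lambda>(x, u). Y x u)"
    using continuous_map_compose[OF rc continuous_map_fst] by (simp add: o_def Y_def case_prod_unfold)
  have tc: "continuous_map ?S ?I t"
  proof -
    have "continuous_map ?S (prod_topology ?S ?I) (\<lambda>x. (x, 1))"
      by (intro continuous_map_pairedI) auto
    from continuous_map_compose[OF continuous_map_compose[OF this rc] continuous_map_snd]
    show ?thesis by (simp add: o_def t_def[abs_def])
  qed
  have t01: "t x \<in> {0..1}" if "x \<in> topspace ?S" for x
    using tc that by (auto simp: continuous_map_def)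
  have YS: "Y x 1 \<in> topspace ?S" if "x \<in> topspace ?S" for x
    using rZ[OF that, of 1] s by (auto simp: Y_def cyl_base_def)
  have Ys: "Y x 1 = s" if "x \<in> topspace ?S" "t x \<noteq> 0" for x
    using rZ[OF that(1), of 1] that(2) by (auto simp: Y_def t_def cyl_base_def)
  have f_eq: "?f x = (if t x = 0 then \<gamma> (Y x 1) else \<alpha> (e (1 - t x)))" if "x \<in> topspace ?S" for x
    using that by (simp add: act_map_def glue_def t_def Y_def case_prod_unfold)
  have gs: "g s = nsphere_base"
    using X_maps_basepoint[OF \<gamma>] by (simp add: g_def X_sphere_base_X)
  have fg: "X_sphere n k (?f x) = g (Y x 1)" if x: "x \<in> topspace ?S" for x
  proof (cases "t x = 0")
    case False
    then show ?thesis
      using f_eq[OF x] Ys[OF x] \<alpha>_sphere[of "1 - t x"] t01[OF x] gs by simp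
  qed (simp add: f_eq[OF x] g_def)
  have w: "winding_lift n s m ?f \<theta>"
    unfolding winding_lift_def
  proof (intro conjI ballI)
    show "continuous_map ?S euclideanreal \<theta>"
      unfolding \<theta>_def[abs_def] by (intro continuous_intros continuous_map_into_fulltopology[OF tc]) simp_all
    show "\<theta> s = 0" by (simp add: \<theta>_def t_def rs)
    fix x assume x: "x \<in> topspace ?S"
    show "X_circle m (?f x) = cis (2 * pi * \<theta> x)"
    proof (cases "t x = 0")
      case True
      then show ?thesis using \<gamma>_circle[OF YS[OF x]] by (simp add: f_eq[OF x] \<theta>_def)
    next
      case False
      then show ?thesis using \<alpha>_circle[of "1 - t x"] t01[OF x] by (simp add: f_eq[OF x] \<theta>_def)
    qed
  qed
  have gc: "continuous_map ?S ?S g"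
    unfolding g_def by (rule continuous_map_X_sphere_comp[OF \<gamma> k])
  have "continuous_map (prod_topology ?I ?S) (prod_topology ?S ?I) (\<lambda>(u, x). (x, u))"
    unfolding case_prod_unfold by (intro continuous_map_pairedI continuous_map_fst continuous_map_snd)
  from continuous_map_compose[OF continuous_map_compose[OF this Yc] gc]
  have Hc: "continuous_map (prod_topology ?I ?S) ?S (\<lambda>(u, x). g (Y x u))"
    by (simp add: o_def case_prod_unfold)
  \<comment> \<open>As \<open>u\<close> runs from 0 to 1, the sphere component \<open>Y x u\<close>
    of the retraction deforms the identity into the map sending \<open>x\<close> to
    \<open>Y x 1\<close>; precomposition with the latter therefore keeps the degree.\<close>
  have "homotopic_with (\<lambda>_. True) ?S ?S g (\<lambda>x. g (Y x 1))"
    unfolding homotopic_with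
    by (rule homotopic_with[THEN iffD2]) (use Hc r0 in \<open>auto simp: Y_def intro!: exI[of _ "\<lambda>(u, x). g (Y x u)"]\<close>)
  then have deg: "Brouwer_degree2 n (\<lambda>x. g (Y x 1)) = Brouwer_degree2 n g"
    using Brouwer_degree2_homotopic by metis
  have "Brouwer_degree2 n (X_sphere n k \<circ> ?f) = Brouwer_degree2 n g"
    unfolding deg[symmetric] by (rule Brouwer_degree2_eq) (simp add: fg)
  moreover have "Brouwer_degree2 n (level_map n k \<theta> ?f) = Brouwer_degree2 n g"
    unfolding deg[symmetric]
  proof (rule Brouwer_degree2_eq)
    fix x assume x: "x \<in> topspace ?S"
    \<comment> \<open>Off level \<open>k\<close> the retraction has left the bottom of the cylinder,
      so \<open>Y x 1 = s\<close> and the cut removes nothing.\<close>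
    have "g (Y x 1) = nsphere_base" if "\<not> \<bar>\<theta> x - real k\<bar> < 1/2"
    proof -
      have "t x \<noteq> 0" using that by (auto simp: \<theta>_def)
      then show ?thesis using Ys[OF x] gs by simp
    qed
    then show "level_map n k \<theta> ?f x = g (Y x 1)"
      by (simp add: level_map_def fg[OF x])
  qed
  moreover have "\<bar>Brouwer_degree2 n g\<bar> = 2 ^ m" using \<gamma>_deg by (simp add: g_def)
  ultimately show ?thesis
    using fS w unfolding twisted_maps_def by force
qed

section \<open>Representatives near the neutral elements\<close>

lemma circle_param_character:
  assumes "circle_param s e"
  obtains \<zeta> where "continuous_map (nsphere 1) (top_of_set (sphere 0 1)) \<zeta>"
    "\<And>t. t \<in> {0..1} \<Longrightarrow> \<zeta> (e t) = cis (2 * pi * (real k * t))"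
proof -
  let ?I = "top_of_set {0..1::real}"
  let ?h = "\<lambda>t. cis (2 * pi * (real k * t))"
  have q: "quotient_map ?I (nsphere 1) e" and e01: "e 0 = s" "e 1 = s" and inj: "inj_on e {0..<1}"
    using assms by (auto simp: circle_param_def)
  have h1: "?h 0 = ?h 1" by simp
  have hc: "continuous_map ?I (top_of_set (sphere 0 1)) ?h"
    unfolding cis_conv_exp by (auto intro!: continuous_intros simp: norm_exp_i_times)
  have eq: "?h x = ?h y" if xy: "x \<in> topspace ?I" "y \<in> topspace ?I" "e x = e y" for x y
  proof -
    \<comment> \<open>Folding 1 onto 0 reduces the identifications made by \<open>e\<close> to its
      injectivity on \<open>{0..<1}\<close>.\<close>
    define \<rho> where "\<rho> t = (if t = 1 then 0 else t)" for t :: real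
    have "e (\<rho> x) = e (\<rho> y)" using xy e01 by (auto simp: \<rho>_def)
    moreover have "\<rho> x \<in> {0..<1}" "\<rho> y \<in> {0..<1}" using xy by (auto simp: \<rho>_def)
    ultimately have "\<rho> x = \<rho> y" using inj by (auto dest: inj_onD)
    moreover have "?h t = ?h (\<rho> t)" for t using h1 by (simp add: \<rho>_def)
    ultimately show ?thesis by metis
  qed
  have "\<exists>\<zeta>. continuous_map (nsphere 1) (top_of_set (sphere 0 1)) \<zeta> \<and> (\<forall>t \<in> topspace ?I. \<zeta> (e t) = ?h t)"
    by (rule quotient_map_lift_exists[OF q hc]) (rule eq, assumption+, blast)
  then show thesis using that by auto
qed

text \<open>The loops \<open>A R\<close> of \<open>k\<close> turns on the circle of radius
  \<open>R\<close> form a continuous family. Shrinking through the disk makes \<open>A (1/2)\<close>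
  nullhomotopic, so \<open>U\<close> contains its class, and by continuity also that of
  \<open>A (circle_radius m)\<close> for large \<open>m\<close>. How large depends on
  \<open>k\<close>.\<close>

lemma pi1_X_circles_converge:
  assumes s: "s \<in> topspace (nsphere 1)" and e: "circle_param s e"
    and U: "openin (homotopy_group 1 s (space_X n) (base_X n)) U"
    and cU: "based_homotopy 1 s (space_X n) (base_X n) `` {restrict (\<lambda>_. base_X n) (topspace (nsphere 1))} \<in> U"
  obtains m \<alpha> where "m \<ge> 1" "\<alpha> \<in> topspace (sphere_space 1 s (space_X n) (base_X n))"
    "based_homotopy 1 s (space_X n) (base_X n) `` {\<alpha>} \<in> U"
    "\<And>t. t \<in> {0..1} \<Longrightarrow> X_circle m (\<alpha> (e t)) = cis (2 * pi * (real k * t))"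
    "\<And>t. t \<in> {0..1} \<Longrightarrow> X_sphere n k (\<alpha> (e t)) = nsphere_base"
proof -
  let ?S = "nsphere 1" and ?X = "space_X n" and ?x0 = "base_X n"
  let ?SS = "sphere_space 1 s ?X ?x0" and ?R = "based_homotopy 1 s ?X ?x0"
  let ?D = "{0..1/2} \<union> circle_radius ` {1..}"
  let ?T = "top_of_set ?D"
  obtain \<zeta> where \<zeta>c: "continuous_map ?S (top_of_set (sphere 0 1)) \<zeta>"
    and \<zeta>e: "\<And>t. t \<in> {0..1} \<Longrightarrow> \<zeta> (e t) = cis (2 * pi * (real k * t))"
    using circle_param_character[OF e] by metis
  have \<zeta>s: "\<zeta> s = 1" using \<zeta>e[of 0] e by (simp add: circle_param_def)
  define F where "F = (\<lambda>(R, y). inA n (circle_point R (\<zeta> y)))"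
  have "continuous_map (prod_topology ?T ?S) (prod_topology ?T (top_of_set (sphere 0 1))) (\<lambda>(R, y). (R, \<zeta> y))"
    unfolding case_prod_unfold
    using continuous_map_compose[OF continuous_map_snd \<zeta>c]
    by (intro continuous_map_pairedI continuous_map_fst) (simp add: o_def)
  from continuous_map_compose[OF continuous_map_compose[OF this continuous_map_circle_point] continuous_map_wedge_inl]
  have Fc: "continuous_map (prod_topology ?T ?S) ?X F"
    by (simp add: o_def F_def case_prod_unfold)
  have Fs: "F (R, s) = ?x0" for R
    by (simp add: F_def \<zeta>s circle_point_def base_X_eq(1))
  define A where "A R = restrict (\<lambda>y. F (R, y)) (topspace ?S)" for R
  have Ac: "continuous_map ?T ?SS A"
    unfolding A_def[abs_def] by (rule continuous_map_into_sphere_space[OF s Fc Fs])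
  have AS: "A R \<in> topspace ?SS" if "R \<in> ?D" for R
    using Ac that by (auto simp: continuous_map_def)
  have A0: "A 0 = restrict (\<lambda>_. ?x0) (topspace ?S)"
    by (simp add: A_def F_def circle_point_def base_X_eq(1))
  have "(A 0, A (1/2)) \<in> ?R"
  proof -
    have "continuous_map (prod_topology (top_of_set {0..1}) ?S) (prod_topology ?T ?S) (\<lambda>(u, y). (u / 2, y))"
      unfolding case_prod_unfold
    proof (intro continuous_map_pairedI continuous_map_snd)
      have "continuous_map (top_of_set {0..1}) ?T (\<lambda>u. u / 2)"
        by (auto intro!: continuous_intros)
      from continuous_map_compose[OF continuous_map_fst this]
      show "continuous_map (prod_topology (top_of_set {0..1}) ?S) ?T (\<lambda>z. fst z / 2)" by (simp add: o_def)
    qed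
    from continuous_map_compose[OF this Fc]
    have "continuous_map (prod_topology (top_of_set {0..1}) ?S) ?X (\<lambda>(u, y). F (u / 2, y))"
      by (simp add: o_def case_prod_unfold)
    then have "homotopic_with (\<lambda>h. h s = ?x0) ?S ?X (\<lambda>y. F (0, y)) (\<lambda>y. F (1/2, y))"
      unfolding homotopic_with_def using Fs by (intro exI[of _ "\<lambda>(u, y). F (u / 2, y)"]) auto
    then have "homotopic_with (\<lambda>h. h s = ?x0) ?S ?X (A 0) (A (1/2))"
      by (rule homotopic_with_eq) (use s in \<open>auto simp: A_def\<close>)
    then show ?thesis using AS[of 0] AS[of "1/2"] by (simp add: based_homotopy_def)
  qed
  then have half: "?R `` {A (1/2)} \<in> U"
    using equiv_class_eq[OF equiv_based_homotopy] cU A0 by metis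
  have "openin ?SS {f \<in> topspace ?SS. ?R `` {f} \<in> U}"
    using U by (simp add: homotopy_group_def openin_quotient_topology)
  from openin_continuous_map_preimage[OF Ac this]
  obtain V where V: "open V" "{R \<in> ?D. A R \<in> topspace ?SS \<and> ?R `` {A R} \<in> U} = ?D \<inter> V"
    by (auto simp: openin_open)
  have "1/2 \<in> V" using V(2) half AS[of "1/2"] by auto
  then have "\<forall>\<^sub>F m in sequentially. circle_radius m \<in> V"
    using circle_radius_tendsto V(1) by (rule topological_tendstoD[rotated 2])
  then have "\<forall>\<^sub>F m in sequentially. circle_radius m \<in> V \<and> m \<ge> 1"
    using eventually_ge_at_top by (rule eventually_conj)
  then obtain m where m: "circle_radius m \<in> V" "m \<ge> 1"
    using eventually_happens'[OF sequentially_bot] by blast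
  have RT: "circle_radius m \<in> ?D" using m by auto
  note eS = circle_param_in[OF e]
  have cp: "circle_point (circle_radius m) z \<in> topspace space_A" if "norm z = 1" for z
    using funcset_mem[OF continuous_map_funspace[OF continuous_map_circle_point], of "(circle_radius m, z)"] RT that
    by simp
  have nc: "norm (\<zeta> (e t)) = 1" if "t \<in> {0..1}" for t
    using \<zeta>e[OF that] by simp
  show thesis
  proof (rule that[of m "A (circle_radius m)"])
    show "?R `` {A (circle_radius m)} \<in> U" using V(2) RT m(1) by auto
    fix t :: real assume t: "t \<in> {0..1}"
    have At: "A (circle_radius m) (e t) = inA n (circle_point (circle_radius m) (\<zeta> (e t)))"
      using eS[OF t] by (simp add: A_def F_def)
    show "X_circle m (A (circle_radius m) (e t)) = cis (2 * pi * (real k * t))"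
      unfolding At using X_circle_simps(1)[OF cp[OF nc[OF t]]] circle_coord_circle_point[OF m(2) nc[OF t]] \<zeta>e[OF t]
      by simp
    show "X_sphere n k (A (circle_radius m) (e t)) = nsphere_base"
      unfolding At by (rule X_sphere_simps(1)[OF cp[OF nc[OF t]]])
  qed (use m AS RT in auto)
qed

text \<open>For suitable \<open>k\<close> the whole \<open>k\<close>-th sphere lies in a prescribed
  neighbourhood \<open>W\<close> of the basepoint, so every \<open>g\<close> followed by its
  inclusion stays in \<open>W\<close>, whatever the degree of \<open>g\<close>. This uniformity
  allows \<open>m\<close> to be chosen after \<open>k\<close>.\<close>

lemma pi_n_X_spheres_converge:
  assumes s: "s \<in> topspace (nsphere n)"
    and V: "openin (homotopy_group n s (space_X n) (base_X n)) V"
    and cV: "based_homotopy n s (space_X n) (base_X n) `` {restrict (\<lambda>_. base_X n) (topspace (nsphere n))} \<in> V"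
  obtains k where "k \<ge> 1"
    "\<And>g m. continuous_map (nsphere n) (nsphere n) g \<Longrightarrow> g s = nsphere_base \<Longrightarrow>
       \<exists>\<gamma> \<in> topspace (X_maps n s). based_homotopy n s (space_X n) (base_X n) `` {\<gamma>} \<in> V \<and>
         (\<forall>y \<in> topspace (nsphere n). X_circle m (\<gamma> y) = 1 \<and> X_sphere n k (\<gamma> y) = g y)"
proof -
  let ?S = "nsphere n" and ?SS = "X_maps n s" and ?R = "based_homotopy n s (space_X n) (base_X n)"
  let ?D = "insert 0 ((\<lambda>k. 1 / real k) ` {1..})"
  let ?T = "top_of_set ?D"
  have "openin ?SS {f \<in> topspace ?SS. ?R `` {f} \<in> V}"
    using V by (simp add: homotopy_group_def openin_quotient_topology)
  moreover have "restrict (\<lambda>_. base_X n) (topspace ?S) \<in> {f \<in> topspace ?SS. ?R `` {f} \<in> V}"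
    using cV s wedge_point(3)[OF basepoints] by (auto simp: topspace_sphere_space)
  ultimately obtain W where W: "openin (space_X n) W" "base_X n \<in> W"
    and WV: "\<And>f. f \<in> topspace ?SS \<Longrightarrow> f ` topspace ?S \<subseteq> W \<Longrightarrow> f \<in> {f \<in> topspace ?SS. ?R `` {f} \<in> V}"
    by (rule sphere_space_const_nbhd) (rule that; blast)
  define F where "F = (\<lambda>(t, w). inH n (earring_point t w))"
  have Fc: "continuous_map (prod_topology ?T ?S) (space_X n) F"
    using continuous_map_compose[OF continuous_map_earring_point continuous_map_wedge_inr]
    by (simp add: o_def F_def case_prod_unfold)
  have F0: "F (0, w) = base_X n" for w
    by (simp add: F_def earring_point_def base_X_eq(2))
  have "openin (prod_topology ?T ?S) {z \<in> topspace (prod_topology ?T ?S). F z \<in> W}"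
    by (rule openin_continuous_map_preimage[OF Fc W(1)])
  moreover have "compactin ?S (topspace ?S)" using compact_space_nsphere by (simp add: compact_space_def)
  moreover have "{0} \<times> topspace ?S \<subseteq> {z \<in> topspace (prod_topology ?T ?S). F z \<in> W}"
    using F0 W(2) by auto
  moreover have "0 \<in> topspace ?T" by simp
  \<comment> \<open>By compactness of the sphere, one bound on the parameter works for all its
    points.\<close>
  ultimately have "\<exists>A B. openin ?T A \<and> openin ?S B \<and> 0 \<in> A \<and> topspace ?S \<subseteq> B \<and>
      A \<times> B \<subseteq> {z \<in> topspace (prod_topology ?T ?S). F z \<in> W}"
    by (intro tube_lemma_right)
  then obtain A B where AB: "openin ?T A" "0 \<in> A" "topspace ?S \<subseteq> B"
      "A \<times> B \<subseteq> {z \<in> topspace (prod_topology ?T ?S). F z \<in> W}"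
    by (elim exE conjE)
  obtain A' where A': "open A'" "A = ?D \<inter> A'" using AB(1) by (auto simp: openin_open)
  have "(\<lambda>k. 1 / real k) \<longlonglongrightarrow> 0" by (rule lim_1_over_n)
  then have "\<forall>\<^sub>F k in sequentially. 1 / real k \<in> A'"
    using A' AB(2) by (intro topological_tendstoD) auto
  then have "\<forall>\<^sub>F k in sequentially. 1 / real k \<in> A' \<and> k \<ge> 1"
    using eventually_ge_at_top by (rule eventually_conj)
  then obtain k where k: "1 / real k \<in> A'" "k \<ge> 1"
    using eventually_happens'[OF sequentially_bot] by blast
  have kA: "1 / real k \<in> A" using k A'(2) by auto
  show thesis
  proof (rule that[OF k(2)])
    fix g m assume g: "continuous_map ?S ?S g" and gs: "g s = nsphere_base"
    define \<gamma> where "\<gamma> = restrict (\<lambda>y. F (1 / real k, g y)) (topspace ?S)"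
    have gS: "g y \<in> topspace ?S" if "y \<in> topspace ?S" for y
      using g that by (auto simp: continuous_map_def)
    have "continuous_map ?S (prod_topology ?T ?S) (\<lambda>y. (1 / real k, g y))"
      using g k(2) by (intro continuous_map_pairedI) auto
    from continuous_map_compose[OF this Fc] have "continuous_map ?S (space_X n) \<gamma>"
      by (rule continuous_map_eq) (simp add: \<gamma>_def)
    moreover have "\<gamma> s = base_X n"
      using s by (simp add: \<gamma>_def F_def gs earring_point_def base_X_eq(2))
    ultimately have \<gamma>S: "\<gamma> \<in> topspace ?SS"
      by (simp add: topspace_sphere_space \<gamma>_def)
    have "\<gamma> y \<in> W" if y: "y \<in> topspace ?S" for y
    proof -
      have "(1 / real k, g y) \<in> A \<times> B" using kA gS[OF y] AB(3) by blast
      then show ?thesis using AB(4) y by (auto simp: \<gamma>_def)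
    qed
    then have "?R `` {\<gamma>} \<in> V" using WV[OF \<gamma>S] by blast
    moreover have "X_circle m (\<gamma> y) = 1 \<and> X_sphere n k (\<gamma> y) = g y" if y: "y \<in> topspace ?S" for y
    proof -
      have "earring_point (1 / real k) (g y) \<in> topspace (hawaiian_earring n)"
        using funcset_mem[OF continuous_map_funspace[OF continuous_map_earring_point], of "(1 / real k, g y)"] gS[OF y] k(2)
        by simp
      then show ?thesis
        using y X_circle_simps(2) X_sphere_simps(2) earring_coord_earring_point[OF k(2) gS[OF y]]
        by (simp add: \<gamma>_def F_def)
    qed
    ultimately show "\<exists>\<gamma> \<in> topspace ?SS. ?R `` {\<gamma>} \<in> V \<and>
         (\<forall>y \<in> topspace ?S. X_circle m (\<gamma> y) = 1 \<and> X_sphere n k (\<gamma> y) = g y)"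
      using \<gamma>S by blast
  qed
qed

theorem theorem22:
  fixes n :: nat
    and s :: "nat \<Rightarrow> nat \<Rightarrow> real"
    and e :: "real \<Rightarrow> nat \<Rightarrow> real"
    and r :: "(nat \<Rightarrow> real) \<times> real \<Rightarrow> (nat \<Rightarrow> real) \<times> real"
  assumes "n \<ge> 1"
    and "\<And>k. k \<ge> 1 \<Longrightarrow> s k \<in> topspace (nsphere k)"
    and "circle_param (s 1) e"
    and "cyl_retraction n (s n) r"
  shows "\<not> continuous_map
            (prod_topology (homotopy_group 1 (s 1) (space_X n) (base_X n))
                           (homotopy_group n (s n) (space_X n) (base_X n)))
            (homotopy_group n (s n) (space_X n) (base_X n))
            (\<lambda>(a, b). pi1_action n (s n) e r (space_X n) (base_X n) a b)"
proof
  let ?P1 = "homotopy_group 1 (s 1) (space_X n) (base_X n)"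
  let ?Pn = "homotopy_group n (s n) (space_X n) (base_X n)"
  let ?R1 = "based_homotopy 1 (s 1) (space_X n) (base_X n)"
  let ?R = "based_homotopy n (s n) (space_X n) (base_X n)"
  let ?SS1 = "sphere_space 1 (s 1) (space_X n) (base_X n)"
  let ?SS = "X_maps n (s n)"
  let ?act = "\<lambda>(a, b). pi1_action n (s n) e r (space_X n) (base_X n) a b"
  let ?c1 = "restrict (\<lambda>_. base_X n) (topspace (nsphere 1))"
  let ?c = "restrict (\<lambda>_. base_X n) (topspace (nsphere n))"
  assume cont: "continuous_map (prod_topology ?P1 ?Pn) ?Pn ?act"
  have sn: "s n \<in> topspace (nsphere n)" and s1: "s 1 \<in> topspace (nsphere 1)"
    using assms(1,2) by auto
  note act_class = pi1_action_class[OF sn assms(3,4)]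
  have cS: "?c1 \<in> topspace ?SS1" "?c \<in> topspace ?SS"
    using sn s1 wedge_point(3)[OF basepoints] by (auto simp: topspace_sphere_space)
  define G where "G = (\<Union>m\<in>{1..}. \<Union>k\<in>{1..}. twisted_maps n (s n) m k)"
  have G_closed: "closedin ?SS G"
    unfolding G_def by (rule twisted_maps_Union_closed[OF assms(1) sn])
  \<comment> \<open>Each set of the union is clopen and hence saturated; the union, known only to be
    closed, inherits saturation.\<close>
  have G_saturated: "g \<in> G" if fg: "(f, g) \<in> ?R" and fG: "f \<in> G" for f g
  proof -
    obtain m k where mk: "m \<ge> 1" "k \<ge> 1" "f \<in> twisted_maps n (s n) m k"
      using fG by (auto simp: G_def)
    then have "g \<in> twisted_maps n (s n) m k"
      using sphere_space_clopen_saturated[OF sn twisted_maps_clopen(1,2)[OF mk(1,2) sn] fg] by blast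
    then show ?thesis using mk by (auto simp: G_def)
  qed
  \<comment> \<open>The classes that avoid \<open>G\<close>. By saturation the preimage of
    \<open>W\<close> in the mapping space is exactly the complement of \<open>G\<close>, so
    \<open>W\<close> is open in the quotient.\<close>
  define W where "W = (\<lambda>f. ?R `` {f}) ` (topspace ?SS - G)"
  have W_iff: "?R `` {f} \<in> W \<longleftrightarrow> f \<notin> G" if f: "f \<in> topspace ?SS" for f
  proof
    assume "?R `` {f} \<in> W"
    then obtain g where g: "g \<in> topspace ?SS" "g \<notin> G" "?R `` {f} = ?R `` {g}"
      unfolding W_def by blast
    then have "(f, g) \<in> ?R"
      using eq_equiv_class_iff[OF equiv_based_homotopy f g(1)] by blast
    then show "f \<notin> G" using G_saturated g(2) by blast
  qed (use f in \<open>auto simp: W_def\<close>)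
  have "{f \<in> topspace ?SS. ?R `` {f} \<in> W} = topspace ?SS - G"
    using W_iff by blast
  then have "openin ?Pn W"
    using G_closed by (auto simp: homotopy_group_def openin_quotient_topology W_def quotientI)
  from openin_continuous_map_preimage[OF cont this]
  have pre: "openin (prod_topology ?P1 ?Pn) {z \<in> topspace (prod_topology ?P1 ?Pn). ?act z \<in> W}" .
  \<comment> \<open>The neutral pair acts to a constant map, whose degree over each sphere is 0 and
    not a power of 2.\<close>
  have "act_map n r (?c1 \<circ> e) ?c \<notin> G"
  proof
    assume "act_map n r (?c1 \<circ> e) ?c \<in> G"
    then obtain m k where "\<bar>Brouwer_degree2 n (X_sphere n k \<circ> act_map n r (?c1 \<circ> e) ?c)\<bar> = 2 ^ m"
      by (auto simp: G_def twisted_maps_def)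
    moreover have "Brouwer_degree2 n (X_sphere n k \<circ> act_map n r (?c1 \<circ> e) ?c) = Brouwer_degree2 n (\<lambda>_. nsphere_base)"
    proof (rule Brouwer_degree2_eq)
      fix x assume x: "x \<in> topspace (nsphere n)"
      have "fst (r (x, 1)) \<in> topspace (nsphere n)" "1 - snd (r (x, 1)) \<in> {0..1}"
        using cyl_retraction_in(1)[OF assms(4) x, of 1] by (auto simp: mem_Times_iff)
      moreover from this have "e (1 - snd (r (x, 1))) \<in> topspace (nsphere 1)"
        by (intro circle_param_in[OF assms(3)])
      ultimately have "act_map n r (?c1 \<circ> e) ?c x = base_X n"
        using x by (simp add: act_map_def glue_def case_prod_unfold)
      then show "(X_sphere n k \<circ> act_map n r (?c1 \<circ> e) ?c) x = nsphere_base"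
        by (simp add: X_sphere_base_X)
    qed
    ultimately show False by (simp add: Brouwer_degree2_const)
  qed
  then have "?act (?R1 `` {?c1}, ?R `` {?c}) \<in> W"
    using act_class[OF cS] W_iff by simp
  moreover have "?R1 `` {?c1} \<in> topspace ?P1" "?R `` {?c} \<in> topspace ?Pn"
    using cS by (auto simp: homotopy_group_def quotientI)
  ultimately have "(?R1 `` {?c1}, ?R `` {?c}) \<in> {z \<in> topspace (prod_topology ?P1 ?Pn). ?act z \<in> W}"
    by simp
  from pre[unfolded openin_prod_topology_alt, rule_format, OF this]
  obtain U V where U: "openin ?P1 U" "?R1 `` {?c1} \<in> U" and V: "openin ?Pn V" "?R `` {?c} \<in> V"
    and UV: "U \<times> V \<subseteq> {z \<in> topspace (prod_topology ?P1 ?Pn). ?act z \<in> W}"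
    by (elim exE conjE)
  \<comment> \<open>\<open>k\<close> depends on \<open>V\<close> alone, then \<open>m\<close> on
    \<open>U\<close> and \<open>k\<close>; the degree of \<open>g\<close> comes last, as it must
    encode \<open>m\<close>.\<close>
  obtain k where k: "k \<ge> 1" and kV: "\<And>g m. continuous_map (nsphere n) (nsphere n) g \<Longrightarrow> g (s n) = nsphere_base \<Longrightarrow>
       \<exists>\<gamma> \<in> topspace ?SS. ?R `` {\<gamma>} \<in> V \<and>
         (\<forall>y \<in> topspace (nsphere n). X_circle m (\<gamma> y) = 1 \<and> X_sphere n k (\<gamma> y) = g y)"
    by (rule pi_n_X_spheres_converge[OF sn V]) (rule that; blast)
  obtain m \<alpha> where m: "m \<ge> 1" and \<alpha>: "\<alpha> \<in> topspace ?SS1" "?R1 `` {\<alpha>} \<in> U"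
    and \<alpha>_circle: "\<And>t. t \<in> {0..1} \<Longrightarrow> X_circle m (\<alpha> (e t)) = cis (2 * pi * (real k * t))"
    and \<alpha>_sphere: "\<And>t. t \<in> {0..1} \<Longrightarrow> X_sphere n k (\<alpha> (e t)) = nsphere_base"
    by (rule pi1_X_circles_converge[OF s1 assms(3) U, where k = k]) (rule that)
  obtain g where g: "continuous_map (nsphere n) (nsphere n) g" "g (s n) = nsphere_base"
    "\<bar>Brouwer_degree2 n g\<bar> = 2 ^ m"
    by (rule ex_based_map_degree[OF assms(1) sn nsphere_base_in_nsphere])
  from kV[OF g(1,2), of m] obtain \<gamma> where \<gamma>: "\<gamma> \<in> topspace ?SS" "?R `` {\<gamma>} \<in> V"
    and \<gamma>_eq: "\<forall>y \<in> topspace (nsphere n). X_circle m (\<gamma> y) = 1 \<and> X_sphere n k (\<gamma> y) = g y"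
    by (elim bexE conjE)
  note \<gamma>_circle = bspec[OF \<gamma>_eq, THEN conjunct1] and \<gamma>_sphere = bspec[OF \<gamma>_eq, THEN conjunct2]
  have "Brouwer_degree2 n (X_sphere n k \<circ> \<gamma>) = Brouwer_degree2 n g"
    by (rule Brouwer_degree2_eq) (simp add: \<gamma>_sphere)
  then have "act_map n r (\<alpha> \<circ> e) \<gamma> \<in> twisted_maps n (s n) m k"
    using g(3) by (intro twisted_maps_act_map[OF sn assms(3,4) k \<alpha>(1) \<alpha>_circle \<alpha>_sphere \<gamma>(1) \<gamma>_circle]) simp_all
  then have "act_map n r (\<alpha> \<circ> e) \<gamma> \<in> G" using m k by (auto simp: G_def)
  moreover have "?act (?R1 `` {\<alpha>}, ?R `` {\<gamma>}) \<in> W"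
    using UV \<alpha>(2) \<gamma>(2) by blast
  then have "?R `` {act_map n r (\<alpha> \<circ> e) \<gamma>} \<in> W"
    using act_class(2)[OF \<alpha>(1) \<gamma>(1)] by simp
  ultimately show False
    using W_iff[OF act_class(1)[OF \<alpha>(1) \<gamma>(1)]] by blast
qed

end
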